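(* There exist an integer $n\ge 1$ and a Poisson structure $\pi$ on $\mathbb{R}^n$ with $\pi(0)=0$ such that: (1) no quantization of the evaluation map $ev_0: f\mapsto f(0)$ exists for the Kontsevich star product $\star_\pi$ associated to $\pi$; (2) more generally, for every formal Poisson structure $\pi_\epsilon=\pi+\epsilon\pi_1+\epsilon^2\pi_2+\cdots$ on $\mathbb{R}^n$ extending this $\pi$ and satisfying $\pi_\epsilon(0)=0$ (to all orders in $\epsilon$), no quantization of $ev_0$ exists for the Kontsevich star product $\star_{\pi_\epsilon}$.
   Context: $C^\infty(\mathbb{R}^n)$ denotes smooth (complex-valued) functions. A formal Poisson structure on $\mathbb{R}^n$ is $\pi_\epsilon\in\Gamma(\Lambda^2T\mathbb{R}^n)[[\epsilon]]$ with $[\pi_\epsilon,\pi_\epsilon]=0$ (Schouten-Nijenhuis bracket, extended $\epsilon$-linearly); it extends a Poisson structure $\pi$ if its $\epsilon^0$-component is $\pi$. Components: $\pi^{ij}=\{x^i,x^j\}$. An ordinary Poisson structure is a formal one with no higher order terms. Kontsevich star product. Let $\mathbb{H}$ be the open upper half plane. For $p\in\mathbb{H}$, $q\in\mathbb{H}\cup\mathbb{R}$, $p\neq q$, let $\varphi(p,q)=\arg\big((q-p)(\bar q-p)\big)$, defined mod $2\pi$, so that $d\varphi$ is a well-defined one-form. Let $G_N$ be the set of directed graphs with vertices $1,\dots,N,L,R$ and $2N$ edges, where each vertex $k\in\{1,\dots,N\}$ is the source of exactly two edges, ordered as $e_k^1,e_k^2$, with targets in $\{1,\dots,N,L,R\}\setminus\{k\}$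 ($L,R$ have no outgoing edges). The weight of $\Gamma\in G_N$ is $$w_\Gamma=\frac{1}{N!(2\pi)^{2N}}\int\bigwedge_{k=1}^N\big(d\varphi(e_k^1)\wedge d\varphi(e_k^2)\big),$$ integrated over tuples of pairwise distinct points $(p_1,\dots,p_N)\in\mathbb{H}^N$ (standard orientation) assigned to the vertices $1,\dots,N$, with $L,R$ placed at $0,1$, and $\varphi(e)=\varphi(\text{source},\text{target})$. For a bivector field with components $\alpha^{ij}$, $B_{\Gamma,\alpha}(f,g)$ is obtained by assigning a summation index in $\{1,\dots,n\}$ to each edge, placing $\alpha^{i_{e_k^1}i_{e_k^2}}$ at vertex $k$ and $f,g$ at $L,R$, differentiating the function at each vertex by $\partial_{i_e}$ for every edge $e$ pointing to it, multiplying, and summing over all index assignments. Then $$f\star_{\pi_\epsilon}g=\sum_{N\ge0}\epsilon^N\sum_{\Gamma\in G_N}w_\Gamma B_{\Gamma,\pi_\epsilon/2}(f,g)=fg+\tfrac{\epsilon}{2}\{f,g\}+O(\epsilon^2),$$ where $\{\cdot,\cdot\}$ is the bracket of the $\epsilon^0$-component of $\pi_\epsilon$. This is an associative product on $C^\infty(\mathbb{R}^n)[[\epsilon]]$. Quantization of $ev_m$ ($m\in\mathbb{R}^n$) for $\star_{\pi_\epsilon}$: a linear map $\rho:C^\infty(\mathbb{R}^n)\to\mathbb{C}[[\epsilon]]$ (extended $\mathbb{C}[[\epsilon]]$-linearly to $C^\infty(\mathbb{R}^n)[[\epsilon]]$) of the form $\rho(f)=f(m)+\epsilon\rho_1(f)+\epsilon^2\rho_2(f)+\cdots$,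 where each $\rho_k$ is a differential operator evaluated at $m$, i.e. $\rho_k(f)=\sum_I c_{k,I}\frac{\partial f}{\partial x^I}(m)$ with constants $c_{k,I}$, only finitely many nonzero for each $k$, such that $\rho(f\star_{\pi_\epsilon}g)=\rho(f)\rho(g)$ for all $f,g\in C^\infty(\mathbb{R}^n)$. *)

theory Defs
  imports "HOL-Analysis.Analysis" "Jordan_Normal_Form.Determinant"
begin

section \<open>Smooth functions on Euclidean space of variable dimension\<close>

text \<open>
  The dimension \<open>n\<close> has to be bound inside a formula, so Euclidean \<open>n\<close>-space is the library's
  \<^const>\<open>Euclidean_space\<close> \<open>n\<close>: functions \<open>nat \<Rightarrow> real\<close> vanishing at all indices \<open>\<ge> n\<close>.
  Coordinates are numbered \<open>0, \<dots>, n - 1\<close>. Only the values of functions on this carrier matter.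
\<close>

definition pderiv_coord :: "nat \<Rightarrow> ((nat \<Rightarrow> real) \<Rightarrow> 'a::real_normed_vector) \<Rightarrow> (nat \<Rightarrow> real) \<Rightarrow> 'a"
  where "pderiv_coord i f x = vector_derivative (\<lambda>t. f (x(i := t))) (at (x i))"

definition pderivs :: "nat list \<Rightarrow> ((nat \<Rightarrow> real) \<Rightarrow> 'a::real_normed_vector) \<Rightarrow> (nat \<Rightarrow> real) \<Rightarrow> 'a"
  where "pderivs I f = foldr pderiv_coord I f"

definition smooth_fun :: "nat \<Rightarrow> ((nat \<Rightarrow> real) \<Rightarrow> 'a::real_normed_vector) \<Rightarrow> bool"
  where "smooth_fun n f \<longleftrightarrow>
    (\<forall>I \<in> lists {..<n}.
       continuous_map (Euclidean_space n) euclidean (pderivs I f) \<and>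
       (\<forall>i<n. \<forall>x \<in> topspace (Euclidean_space n).
          (\<lambda>t. pderivs I f (x(i := t))) differentiable (at (x i))))"

text \<open>
  A formal power series of functions is represented by its pointwise values in \<open>'a fps\<close>;
  differentiation acts coefficientwise.
\<close>

definition formal_pderivs ::
    "nat list \<Rightarrow> ((nat \<Rightarrow> real) \<Rightarrow> 'a::real_normed_vector fps) \<Rightarrow> (nat \<Rightarrow> real) \<Rightarrow> 'a fps"
  where "formal_pderivs I F x = Abs_fps (\<lambda>k. pderivs I (\<lambda>y. fps_nth (F y) k) x)"

definition formal_smooth :: "nat \<Rightarrow> ((nat \<Rightarrow> real) \<Rightarrow> 'a::real_normed_vector fps) \<Rightarrow> bool"
  where "formal_smooth n F \<longleftrightarrow> (\<forall>k. smooth_fun n (\<lambda>x. fps_nth (F x) k))"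


section \<open>Formal Poisson structures\<close>

type_synonym formal_bivector = "nat \<Rightarrow> nat \<Rightarrow> (nat \<Rightarrow> real) \<Rightarrow> real fps"

definition formal_bivector_field :: "nat \<Rightarrow> formal_bivector \<Rightarrow> bool"
  where "formal_bivector_field n \<alpha> \<longleftrightarrow>
    (\<forall>i<n. \<forall>j<n. formal_smooth n (\<alpha> i j) \<and>
       (\<forall>x \<in> topspace (Euclidean_space n). \<alpha> j i x = - \<alpha> i j x))"

text \<open>
  The \<open>(i, j, k)\<close> component of the Schouten--Nijenhuis bracket of the bivector fields
  \<open>(1/2) \<Sum> \<alpha>\<^sup>i\<^sup>j \<partial>\<^sub>i \<and> \<partial>\<^sub>j\<close> and \<open>(1/2) \<Sum> \<beta>\<^sup>i\<^sup>j \<partial>\<^sub>i \<and> \<partial>\<^sub>j\<close>, up to the overall sign, which depends on conventions.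
  For \<open>\<alpha> = \<beta>\<close> it is twice the Jacobiator of the coordinate functions \<open>x\<^sup>i, x\<^sup>j, x\<^sup>k\<close>.
\<close>

definition schouten_bracket ::
    "nat \<Rightarrow> formal_bivector \<Rightarrow> formal_bivector \<Rightarrow> nat \<Rightarrow> nat \<Rightarrow> nat \<Rightarrow> (nat \<Rightarrow> real) \<Rightarrow> real fps"
  where "schouten_bracket n \<alpha> \<beta> i j k x =
    (\<Sum>l<n.
       \<alpha> i l x * formal_pderivs [l] (\<beta> j k) x + \<beta> i l x * formal_pderivs [l] (\<alpha> j k) x
     + \<alpha> j l x * formal_pderivs [l] (\<beta> k i) x + \<beta> j l x * formal_pderivs [l] (\<alpha> k i) x
     + \<alpha> k l x * formal_pderivs [l] (\<beta> i j) x + \<beta> k l x * formal_pderivs [l] (\<alpha> i j) x)"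

definition formal_poisson :: "nat \<Rightarrow> formal_bivector \<Rightarrow> bool"
  where "formal_poisson n \<pi> \<longleftrightarrow>
    formal_bivector_field n \<pi> \<and>
    (\<forall>i<n. \<forall>j<n. \<forall>k<n. \<forall>x \<in> topspace (Euclidean_space n). schouten_bracket n \<pi> \<pi> i j k x = 0)"

definition const_bivector :: "(nat \<Rightarrow> nat \<Rightarrow> (nat \<Rightarrow> real) \<Rightarrow> real) \<Rightarrow> formal_bivector"
  where "const_bivector \<pi> i j x = fps_const (\<pi> i j x)"

definition poisson_structure :: "nat \<Rightarrow> (nat \<Rightarrow> nat \<Rightarrow> (nat \<Rightarrow> real) \<Rightarrow> real) \<Rightarrow> bool"
  where "poisson_structure n \<pi> \<longleftrightarrow> formal_poisson n (const_bivector \<pi>)"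

definition extends_poisson ::
    "nat \<Rightarrow> formal_bivector \<Rightarrow> (nat \<Rightarrow> nat \<Rightarrow> (nat \<Rightarrow> real) \<Rightarrow> real) \<Rightarrow> bool"
  where "extends_poisson n \<pi>\<^sub>\<epsilon> \<pi> \<longleftrightarrow>
    (\<forall>i<n. \<forall>j<n. \<forall>x \<in> topspace (Euclidean_space n). fps_nth (\<pi>\<^sub>\<epsilon> i j x) 0 = \<pi> i j x)"


section \<open>Kontsevich graphs and weights\<close>

text \<open>
  The vertices \<open>1, \<dots>, N\<close> are renumbered \<open>0, \<dots>, N - 1\<close>. The two edges starting at vertex \<open>k\<close> are
  \<open>(k, 0)\<close> and \<open>(k, 1)\<close>, in this order, and a graph is the map from its edges to their targets.
\<close>

datatype vertex = Vertex nat | VL | VR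

type_synonym kgraph = "nat \<times> nat \<Rightarrow> vertex"

definition kgraphs :: "nat \<Rightarrow> kgraph set"
  where "kgraphs N =
    (\<Pi>\<^sub>E (k, b) \<in> {..<N} \<times> {..<2}. (Vertex ` {..<N} \<union> {VL, VR}) - {Vertex k})"

fun position :: "(nat \<Rightarrow> complex) \<Rightarrow> vertex \<Rightarrow> complex" where
  "position p (Vertex k) = p k"
| "position p VL = 0"
| "position p VR = 1"

definition angle_arg :: "complex \<Rightarrow> complex \<Rightarrow> complex"
  where "angle_arg p q = (q - p) * (cnj q - p)"

text \<open>
  The angle of the edge \<open>e\<close> is \<open>arg (angle_arg (source) (target))\<close>, defined modulo \<open>2\<pi>\<close>. Its increment
  from the configuration \<open>p\<close> to a nearby configuration \<open>p'\<close>, reduced modulo \<open>2\<pi>\<close> to lie near 0,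
  is the principal argument of the quotient. The derivative of this increment along the
  vector \<open>v\<close> moving the point \<open>k\<close> is the value of the one-form \<open>d\<phi>(e)\<close> on that vector.
\<close>

definition edge_arg :: "kgraph \<Rightarrow> nat \<times> nat \<Rightarrow> (nat \<Rightarrow> complex) \<Rightarrow> complex"
  where "edge_arg \<Gamma> e p = angle_arg (p (fst e)) (position p (\<Gamma> e))"

definition d_angle :: "kgraph \<Rightarrow> nat \<times> nat \<Rightarrow> (nat \<Rightarrow> complex) \<Rightarrow> nat \<Rightarrow> complex \<Rightarrow> real"
  where "d_angle \<Gamma> e p k v =
    deriv (\<lambda>t::real. Arg (edge_arg \<Gamma> e (p(k := p k + of_real t * v)) / edge_arg \<Gamma> e p)) 0"

text \<open>
  Configurations have the real coordinates \<open>Re p\<^sub>0, Im p\<^sub>0, Re p\<^sub>1, Im p\<^sub>1, \<dots>\<close>, in this order.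
  The wedge product of the one-forms \<open>d\<phi>(0,0), d\<phi>(0,1), d\<phi>(1,0), d\<phi>(1,1), \<dots>\<close> is the standard volume
  form times the determinant of the matrix of their values on the coordinate vectors.
\<close>

definition weight_density :: "nat \<Rightarrow> kgraph \<Rightarrow> (nat \<Rightarrow> complex) \<Rightarrow> real"
  where "weight_density N \<Gamma> p = Determinant.det (Matrix.mat (2 * N) (2 * N)
    (\<lambda>(r, c). d_angle \<Gamma> (r div 2, r mod 2) p (c div 2) (if even c then 1 else \<i>)))"

definition configurations :: "nat \<Rightarrow> (nat \<Rightarrow> complex) set"
  where "configurations N = {p \<in> {..<N} \<rightarrow>\<^sub>E {z. Im z > 0}. inj_on p {..<N}}"

definition kweight :: "nat \<Rightarrow> kgraph \<Rightarrow> real"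
  where "kweight N \<Gamma> = 1 / (fact N * (2 * pi) ^ (2 * N)) *
    set_lebesgue_integral (\<Pi>\<^sub>M k \<in> {..<N}. lborel) (configurations N) (weight_density N \<Gamma>)"


section \<open>The Kontsevich star product\<close>

definition edge_list :: "nat \<Rightarrow> (nat \<times> nat) list"
  where "edge_list N = List.product [0..<N] [0..<2]"

definition incoming :: "nat \<Rightarrow> kgraph \<Rightarrow> (nat \<times> nat \<Rightarrow> nat) \<Rightarrow> vertex \<Rightarrow> nat list"
  where "incoming N \<Gamma> I v = map I (filter (\<lambda>e. \<Gamma> e = v) (edge_list N))"

type_synonym formal_function = "(nat \<Rightarrow> real) \<Rightarrow> complex fps"

definition graph_operator ::
    "nat \<Rightarrow> nat \<Rightarrow> kgraph \<Rightarrow> (nat \<Rightarrow> nat \<Rightarrow> formal_function) \<Rightarrow>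
     formal_function \<Rightarrow> formal_function \<Rightarrow> formal_function"
  where "graph_operator n N \<Gamma> \<alpha> f g x =
    (\<Sum>I \<in> {..<N} \<times> {..<2} \<rightarrow>\<^sub>E {..<n}.
       (\<Prod>k<N. formal_pderivs (incoming N \<Gamma> I (Vertex k)) (\<alpha> (I (k, 0)) (I (k, 1))) x) *
       formal_pderivs (incoming N \<Gamma> I VL) f x *
       formal_pderivs (incoming N \<Gamma> I VR) g x)"

definition half_bivector :: "formal_bivector \<Rightarrow> nat \<Rightarrow> nat \<Rightarrow> formal_function"
  where "half_bivector \<pi> i j x = Abs_fps (\<lambda>k. complex_of_real (fps_nth (\<pi> i j x) k / 2))"

text \<open>
  Only the summands with \<open>N \<le> K\<close> of the infinite sum \<open>\<Sum> \<epsilon>\<^sup>N \<dots>\<close> contribute to its coefficient of \<open>\<epsilon>\<^sup>K\<close>.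
  The formal parameter \<open>\<epsilon>\<close> is \<^const>\<open>fps_X\<close>.
\<close>

definition star_product ::
    "nat \<Rightarrow> formal_bivector \<Rightarrow> formal_function \<Rightarrow> formal_function \<Rightarrow> formal_function"
  where "star_product n \<pi> f g x = Abs_fps (\<lambda>K. fps_nth
    (\<Sum>N\<le>K. fps_X ^ N * (\<Sum>\<Gamma> \<in> kgraphs N.
       fps_const (complex_of_real (kweight N \<Gamma>)) * graph_operator n N \<Gamma> (half_bivector \<pi>) f g x)) K)"


section \<open>Quantizations of evaluation maps\<close>

definition eps_linear_extension ::
    "(((nat \<Rightarrow> real) \<Rightarrow> complex) \<Rightarrow> complex fps) \<Rightarrow> formal_function \<Rightarrow> complex fps"
  where "eps_linear_extension \<rho> F = Abs_fps (\<lambda>K. fps_nth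
    (\<Sum>k\<le>K. fps_X ^ k * \<rho> (\<lambda>x. fps_nth (F x) k)) K)"

definition is_quantization ::
    "nat \<Rightarrow> (nat \<Rightarrow> real) \<Rightarrow> formal_bivector \<Rightarrow> (((nat \<Rightarrow> real) \<Rightarrow> complex) \<Rightarrow> complex fps) \<Rightarrow> bool"
  where "is_quantization n m \<pi> \<rho> \<longleftrightarrow>
    (\<forall>f g a b. smooth_fun n f \<longrightarrow> smooth_fun n g \<longrightarrow>
       \<rho> (\<lambda>x. a * f x + b * g x) = fps_const a * \<rho> f + fps_const b * \<rho> g) \<and>
    (\<forall>f. smooth_fun n f \<longrightarrow> fps_nth (\<rho> f) 0 = f m) \<and>
    (\<forall>k\<ge>1. \<exists>c :: nat list \<Rightarrow> complex.
       finite {I. c I \<noteq> 0} \<and> {I. c I \<noteq> 0} \<subseteq> lists {..<n} \<and>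
       (\<forall>f. smooth_fun n f \<longrightarrow> fps_nth (\<rho> f) k = (\<Sum>I | c I \<noteq> 0. c I * pderivs I f m))) \<and>
    (\<forall>f g. smooth_fun n f \<longrightarrow> smooth_fun n g \<longrightarrow>
       eps_linear_extension \<rho>
         (star_product n \<pi> (\<lambda>x. fps_const (f x)) (\<lambda>x. fps_const (g x))) = \<rho> f * \<rho> g)"

end

theory Submission
  imports Defs "HOL-Real_Asymp.Real_Asymp"
begin

text \<open>The space is the dual of the eight-dimensional Lie algebra (sl(2) semidirect R^2) +
  so(3), with coordinates 0-2, 3-4 and 5-7. Its Lie-Poisson bracket is modified by setting {x3, x4}
  = x5^2 + x6^2 + x7^2, the Casimir function of so(3). The Jacobi identity survives because sl(2)
  preserves the area form of the plane and the Casimir function Poisson-commutes with every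
  coordinate.

  Let rho = ev_0 + eps rho_1 + eps^2 rho_2 + ... be multiplicative for the star product of an
  extension vanishing at 0, and let S_k be the coefficient of eps^k in the star product. Since the
  bivector vanishes at 0, order eps says that rho_1 is a derivation at 0. At order eps^2, applied to
  two coordinates, S_2 at 0 is symmetric, so antisymmetrising gives rho_1({x_a, x_b}) = 0. Every
  coordinate is a multiple of such a bracket (\<open>pi0_single\<close>), and a derivation at 0 of
  finite order that kills the coordinates is zero (\<open>derivation_at_0_eq_0\<close>); hence rho_1
  = 0 (\<open>r_1_eq_0\<close>). The diagonal of order eps^2 now reads rho_2(x_a^2) = - G K(a, a),
  where K is the Killing form of the Lie algebra and G a sum of graph weights. At order eps^3,
  applied to x3 and x4, S_3 at 0 is again symmetric (\<open>S_2_3\<close>), so rho_2({x3, x4}) = 0.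
  This says that G times the sum of K(a, a) over so(3), which is -6 (\<open>killing\<close>),
  vanishes. So everything rests on two facts about weights.

  First, G is not 0. At order two only the two-wheels contribute, with one spoke to L and one to R.
  Integrating over the common horizontal translation by the semigroup law of the Poisson kernel
  leaves an odd factor in the horizontal distance times a kernel centred at 1 or -1, so the weight
  has a strict sign (\<open>integral_two_wheel_neg\<close>, \<open>kweight_2\<close>). Signs of
  weights and operators match, so contributions cannot cancel (\<open>graph_sum_2\<close>).

  Second, the graphs of order three contribute nothing. Counting edges and index types leaves only
  the graphs in which an apex with edges to L and R receives both spokes of a two-wheel
  (\<open>op_3\<close>). With the apex fixed, the integral over the rim is zero
  (\<open>integral_two_wheel_interior\<close>): the horizontal integrations leave a function of two
  heights whose pieces cancel, one pair by a translation, the other because the difference is the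
  derivative of a product of two logarithms vanishing at both ends
  (\<open>has_bochner_integral_rim_total\<close>). Hence these weights vanish
  (\<open>kweight_3_eq_0\<close>). Higher terms of the bivector enter S_3 at 0 only through the
  symmetric second-order contraction, so every extension is covered.\<close>

section \<open>Determinants with the block shapes of the weight matrices\<close>

lemma det_row:
  fixes f :: "nat \<Rightarrow> nat \<Rightarrow> 'a::comm_ring_1"
  assumes "i \<le> n"
  shows "Determinant.det (Matrix.mat (Suc n) (Suc n) (\<lambda>(r, c). f r c)) =
    (\<Sum>j<Suc n. (-1) ^ (i + j) * f i j * Determinant.det (Matrix.mat n n
       (\<lambda>(r, c). f (if r < i then r else Suc r) (if c < j then c else Suc c))))"
proof -
  let ?A = "Matrix.mat (Suc n) (Suc n) (\<lambda>(r, c). f r c)"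
  let ?B = "\<lambda>j. Matrix.mat n n (\<lambda>(r, c). f (if r < i then r else Suc r) (if c < j then c else Suc c))"
  have "Determinant.det ?A = (\<Sum>j<Suc n. ?A $$ (i, j) * cofactor ?A i j)"
    using assms by (intro laplace_expansion_row[of _ "Suc n"]) auto
  also have "\<dots> = (\<Sum>j<Suc n. (-1) ^ (i + j) * f i j * Determinant.det (?B j))"
  proof (rule sum.cong[OF refl])
    fix j assume j: "j \<in> {..<Suc n}"
    have "mat_delete ?A i j = ?B j"
      using j assms by (auto simp: mat_delete_def intro!: eq_matI)
    thus "?A $$ (i, j) * cofactor ?A i j = (-1) ^ (i + j) * f i j * Determinant.det (?B j)"
      using j assms by (simp add: cofactor_def)
  qed
  finally show ?thesis .
qed

lemma det_mat_0 [simp]: "Determinant.det (Matrix.mat 0 0 f) = (1 :: 'a :: comm_ring_1)"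
  by (rule det_dim_zero) simp

lemma sum_lessThan_eq_two:
  fixes F :: "nat \<Rightarrow> 'a::comm_monoid_add"
  assumes "\<And>j. j < n \<Longrightarrow> j \<noteq> a \<Longrightarrow> j \<noteq> b \<Longrightarrow> F j = 0" "a < n" "b < n" "a \<noteq> b"
  shows "(\<Sum>j<n. F j) = F a + F b"
proof -
  have "(\<Sum>j<n. F j) = (\<Sum>j\<in>{a, b}. F j)"
    using assms by (intro sum.mono_neutral_right) auto
  thus ?thesis using assms by simp
qed

text \<open>Expanding along the two rows splits off a 2 x 2 minor; the sign is + because rows and
  columns sit at the same positions. This separates a vertex both of whose edges end at L or R,
  since the angle forms of these edges involve only its own position.\<close>

lemma det_pair_block:
  fixes f :: "nat \<Rightarrow> nat \<Rightarrow> 'a::comm_ring_1"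
  assumes i: "i \<le> n"
    and z: "\<And>c. c < Suc (Suc n) \<Longrightarrow> c \<noteq> i \<Longrightarrow> c \<noteq> Suc i \<Longrightarrow> f i c = 0 \<and> f (Suc i) c = 0"
  shows "Determinant.det (Matrix.mat (Suc (Suc n)) (Suc (Suc n)) (\<lambda>(r, c). f r c)) =
    (f i i * f (Suc i) (Suc i) - f i (Suc i) * f (Suc i) i) *
    Determinant.det (Matrix.mat n n (\<lambda>(r, c). f (if r < i then r else r + 2) (if c < i then c else c + 2)))"
proof -
  let ?D = "Determinant.det (Matrix.mat n n (\<lambda>(r, c). f (if r < i then r else r + 2) (if c < i then c else c + 2)))"
  have step: "Determinant.det (Matrix.mat (Suc n) (Suc n)
       (\<lambda>(r, c). f (if r < i then r else Suc r) (if c < j then c else Suc c))) = f (Suc i) k * ?D"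
    if jk: "j = i \<and> k = Suc i \<or> j = Suc i \<and> k = i" for j k
  proof -
    define g where "g r c = f (if r < i then r else Suc r) (if c < j then c else Suc c)" for r c
    have "Determinant.det (Matrix.mat (Suc n) (Suc n) (\<lambda>(r, c). g r c)) =
      (\<Sum>l<Suc n. (-1) ^ (i + l) * g i l * Determinant.det (Matrix.mat n n
       (\<lambda>(r, c). g (if r < i then r else Suc r) (if c < l then c else Suc c))))"
      by (rule det_row[OF i])
    also have "\<dots> = (\<Sum>l\<in>{i}. (-1) ^ (i + l) * g i l * Determinant.det (Matrix.mat n n
       (\<lambda>(r, c). g (if r < i then r else Suc r) (if c < l then c else Suc c))))"
    proof (intro sum.mono_neutral_right ballI)
      fix l assume "l \<in> {..<Suc n} - {i}"
      hence "g i l = 0" using jk z[of "if l < j then l else Suc l"] unfolding g_def 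
        by (auto split: if_splits)
      thus "(-1) ^ (i + l) * g i l * Determinant.det (Matrix.mat n n
       (\<lambda>(r, c). g (if r < i then r else Suc r) (if c < l then c else Suc c))) = 0" by simp
    qed (use i in auto)
    also have "\<dots> = g i i * Determinant.det (Matrix.mat n n
       (\<lambda>(r, c). g (if r < i then r else Suc r) (if c < i then c else Suc c)))"
      by (simp add: power_add flip: power_mult_distrib)
    also have "(\<lambda>(r, c). g (if r < i then r else Suc r) (if c < i then c else Suc c)) =
       (\<lambda>(r, c). f (if r < i then r else r + 2) (if c < i then c else c + 2))"
      using jk by (auto simp: g_def fun_eq_iff)
    also have "g i i = f (Suc i) k" using jk by (auto simp: g_def)
    finally show ?thesis by (simp add: g_def)
  qed
  have "Determinant.det (Matrix.mat (Suc (Suc n)) (Suc (Suc n)) (\<lambda>(r, c). f r c)) =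
    (\<Sum>j<Suc (Suc n). (-1) ^ (i + j) * f i j * Determinant.det (Matrix.mat (Suc n) (Suc n)
       (\<lambda>(r, c). f (if r < i then r else Suc r) (if c < j then c else Suc c))))"
    using i by (intro det_row) auto
  also have "\<dots> = (-1) ^ (i + i) * f i i * (f (Suc i) (Suc i) * ?D)
     + (-1) ^ (i + Suc i) * f i (Suc i) * (f (Suc i) i * ?D)"
    using i by (subst sum_lessThan_eq_two[of _ i "Suc i"]) (auto simp: z step)
  finally show ?thesis by (simp add: algebra_simps power_add flip: power_mult_distrib)
qed

text \<open>The weight matrix of a two-wheel. The numbers \<open>i\<close> and \<open>j\<close> tell
  which edge of the first and of the second vertex runs along the rim (rows \<open>s\<close> and
  \<open>t\<close>); the other edge is a spoke (rows \<open>a\<close> and \<open>b\<close>) and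
  involves only the coordinates of its source. Exchanging the two edges of a vertex exchanges two
  rows, whence the sign.\<close>

lemma det_rim:
  fixes g :: "nat \<Rightarrow> nat \<Rightarrow> real"
  assumes ij: "i < 2" "j < 2"
   and "g i 0 = s0" "g i 1 = s1" "g i 2 = s2" "g i 3 = s3"
   and "g (1 - i) 0 = a0" "g (1 - i) 1 = a1" "g (1 - i) 2 = 0" "g (1 - i) 3 = 0"
   and "g (2 + j) 0 = t0" "g (2 + j) 1 = t1" "g (2 + j) 2 = t2" "g (2 + j) 3 = t3"
   and "g (2 + (1 - j)) 0 = 0" "g (2 + (1 - j)) 1 = 0" "g (2 + (1 - j)) 2 = b2" "g (2 + (1 - j)) 3 = b3"
  shows "Determinant.det (Matrix.mat 4 4 (\<lambda>(r, c). g r c)) = (-1) ^ (i + j) *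
     ((a0 * s1 - a1 * s0) * (b2 * t3 - b3 * t2) + (a0 * t1 - a1 * t0) * (s2 * b3 - s3 * b2))"
proof -
  have e: "Determinant.det (Matrix.mat 4 4 (\<lambda>(r, c). g r c)) =
    Determinant.det (Matrix.mat (Suc (Suc (Suc (Suc 0)))) (Suc (Suc (Suc (Suc 0)))) (\<lambda>(r, c). g r c))"
    by (simp add: eval_nat_numeral)
  consider "i = 0" "j = 0" | "i = 0" "j = 1" | "i = 1" "j = 0" | "i = 1" "j = 1"
    using ij by linarith
  thus ?thesis
    by cases (use assms in \<open>simp_all add: e det_row[of 0] lessThan_Suc numeral_2_eq_2 numeral_3_eq_3 algebra_simps\<close>)
qed

section \<open>The angle forms and the weight densities\<close>

text \<open>The quotient starts at 1, away from the cut of the logarithm, so near 0 the argument is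
  the imaginary part of \<open>Ln\<close> and its derivative a logarithmic derivative.\<close>

lemma deriv_Arg_quotient:
  fixes F :: "real \<Rightarrow> complex"
  assumes "(F has_vector_derivative F') (at 0)" "F 0 \<noteq> 0"
  shows "deriv (\<lambda>t. Arg (F t / F 0)) 0 = Im (F' / F 0)"
proof -
  have d1: "((\<lambda>t. F t / F 0) has_vector_derivative (F' / F 0)) (at 0)"
    using assms(1) by (intro derivative_eq_intros) auto
  have "(Ln has_field_derivative inverse (F 0 / F 0)) (at (F 0 / F 0))"
    using assms(2) by (intro has_field_derivative_Ln) (auto simp: complex_nonpos_Reals_iff)
  from field_vector_diff_chain_at[OF d1 this]
  have "((\<lambda>t. Ln (F t / F 0)) has_vector_derivative (F' / F 0)) (at 0)"
    using assms(2) by (simp add: o_def)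
  hence "((\<lambda>t. Im (Ln (F t / F 0))) has_vector_derivative Im (F' / F 0)) (at 0)"
    by (rule bounded_linear.has_vector_derivative[OF bounded_linear_Im])
  hence D: "((\<lambda>t. Im (Ln (F t / F 0))) has_real_derivative Im (F' / F 0)) (at 0)"
    by (simp add: has_real_derivative_iff_has_vector_derivative)
  have "isCont F 0"
    using assms(1) by (auto intro: differentiable_imp_continuous_within differentiableI_vector)
  hence "eventually (\<lambda>t. F t \<noteq> 0) (nhds 0)"
    using assms(2) by (metis continuous_at t1_space_nhds tendsto_imp_eventually_ne
      eventually_nhds_conv_at isCont_def)
  hence "eventually (\<lambda>t. Arg (F t / F 0) = Im (Ln (F t / F 0))) (nhds 0)"
    by eventually_elim (use assms(2) in \<open>simp add: Arg_eq_Im_Ln\<close>)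
  hence "((\<lambda>t. Arg (F t / F 0)) has_real_derivative Im (F' / F 0)) (at 0)"
    using D by (subst DERIV_cong_ev[OF refl _ refl]) 
  thus ?thesis by (rule DERIV_imp_deriv)
qed

text \<open>The value of \<open>d\<phi>(p, q)\<close> on the velocities \<open>p'\<close>, \<open>q'\<close>.\<close>

definition dphi :: "complex \<Rightarrow> complex \<Rightarrow> complex \<Rightarrow> complex \<Rightarrow> real"
  where "dphi p q p' q' = Im ((q' - p') / (q - p) + (cnj q' - p') / (cnj q - p))"

definition velocity :: "nat \<Rightarrow> complex \<Rightarrow> vertex \<Rightarrow> complex"
  where "velocity k v x = (if x = Vertex k then v else 0)"

lemma d_angle_eq:
  assumes "position p (\<Gamma> e) \<noteq> p (fst e)" "cnj (position p (\<Gamma> e)) \<noteq> p (fst e)"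
  shows "d_angle \<Gamma> e p k v =
    dphi (p (fst e)) (position p (\<Gamma> e)) (velocity k v (Vertex (fst e))) (velocity k v (\<Gamma> e))"
proof -
  let ?P = "p (fst e)" and ?Q = "position p (\<Gamma> e)"
  let ?P' = "velocity k v (Vertex (fst e))" and ?Q' = "velocity k v (\<Gamma> e)"
  let ?F = "\<lambda>t::real. ((?Q + of_real t * ?Q') - (?P + of_real t * ?P')) *
                 ((cnj ?Q + of_real t * cnj ?Q') - (?P + of_real t * ?P'))"
  have eq: "edge_arg \<Gamma> e (p(k := p k + of_real t * v)) = ?F t" for t
    by (cases "\<Gamma> e") (auto simp: edge_arg_def angle_arg_def velocity_def algebra_simps)
  have eq0: "edge_arg \<Gamma> e p = ?F 0"
    by (simp add: edge_arg_def angle_arg_def)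
  have "(?F has_vector_derivative
       ((?Q' - ?P') * (cnj ?Q - ?P) + (?Q - ?P) * (cnj ?Q' - ?P'))) (at 0)"
    by (auto intro!: derivative_eq_intros simp: algebra_simps)
  from deriv_Arg_quotient[OF this]
  have "d_angle \<Gamma> e p k v = Im (((?Q' - ?P') * (cnj ?Q - ?P) + (?Q - ?P) * (cnj ?Q' - ?P')) / ?F 0)"
    using assms unfolding d_angle_def eq eq0 by simp
  also have "((?Q' - ?P') * (cnj ?Q - ?P) + (?Q - ?P) * (cnj ?Q' - ?P')) / ?F 0 =
     (?Q' - ?P') / (?Q - ?P) + (cnj ?Q' - ?P') / (cnj ?Q - ?P)"
    using assms by (simp add: field_simps)
  finally show ?thesis by (simp add: dphi_def)
qed


text \<open>The rows of the weight matrix, for the values \<open>d\<phi>(p, q)\<close> on the two coordinate vectors of the source or target.\<close>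

lemma dphi_source: "dphi p q w 0 = - Im (w * (1 / (q - p) + 1 / (cnj q - p)))"
  by (simp add: dphi_def algebra_simps flip: add_divide_distrib)

lemma dphi_target: "dphi p q 0 w = Im (w / (q - p) + cnj w / (cnj q - p))"
  by (simp add: dphi_def)

lemma Re_Im_inverse_diff:
  "Re (1 / (z - w)) = (Re z - Re w) / ((Re z - Re w)\<^sup>2 + (Im z - Im w)\<^sup>2)"
  "Im (1 / (z - w)) = - (Im z - Im w) / ((Re z - Re w)\<^sup>2 + (Im z - Im w)\<^sup>2)"
  by (simp_all add: Re_divide Im_divide)

text \<open>The density of the two-wheel with rim \<open>u, v\<close>, whose spokes contribute the one-forms
  \<open>f\<^sub>1 dy - f\<^sub>2 dx\<close>.\<close>

definition wheel :: "real \<times> real \<Rightarrow> real \<times> real \<Rightarrow> complex \<Rightarrow> complex \<Rightarrow> real"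
  where "wheel e f u v = - 4 * (Re u - Re v) *
    (snd e * snd f * (Re u - Re v) + snd e * fst f * Im v - fst e * snd f * Im u) /
    (((Re u - Re v)\<^sup>2 + (Im u - Im v)\<^sup>2) * ((Re u - Re v)\<^sup>2 + (Im u + Im v)\<^sup>2))"

definition spoke :: "complex \<Rightarrow> complex \<Rightarrow> real \<times> real"
  where "spoke a u = (dphi u a \<i> 0, - dphi u a 1 0)"

lemma spoke_eq:
  "spoke a u =
    ((Re u - Re a) / ((Re u - Re a)\<^sup>2 + (Im u - Im a)\<^sup>2) + (Re u - Re a) / ((Re u - Re a)\<^sup>2 + (Im u + Im a)\<^sup>2),
     (Im u - Im a) / ((Re u - Re a)\<^sup>2 + (Im u - Im a)\<^sup>2) + (Im u + Im a) / ((Re u - Re a)\<^sup>2 + (Im u + Im a)\<^sup>2))"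
proof -
  have "1 / (a - u) = - (1 / (u - a))" "1 / (cnj a - u) = - (1 / (u - cnj a))"
    by (metis minus_diff_eq minus_divide_right)+
  thus ?thesis
    unfolding spoke_def dphi_source by (simp add: Re_Im_inverse_diff del: divide_const_simps)
      (simp add: add.commute add_divide_distrib diff_divide_distrib)
qed

text \<open>The right-hand side is the determinant of \<open>det_rim\<close> with the spoke rows
  expressed by the pairs \<open>e\<close> and \<open>f\<close>. Only these components of the spokes
  enter, so they are arbitrary here and serve boundary and interior spoke targets alike.\<close>

lemma wheel_eq:
  assumes "u \<noteq> v" "u \<noteq> cnj v"
  shows "wheel e f u v =
    (- snd e * dphi u v \<i> 0 - fst e * dphi u v 1 0) * (- snd f * dphi v u \<i> 0 - fst f * dphi v u 1 0) +
    (- snd e * dphi v u 0 \<i> - fst e * dphi v u 0 1) * (dphi u v 0 1 * fst f + dphi u v 0 \<i> * snd f)"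
proof -
  \<comment> \<open>With the reciprocals named \<open>r\<close> and \<open>R\<close>, both sides
    become polynomials and the claim a polynomial identity.\<close>
  define x m Y where d: "x = Re u - Re v" "m = Im u - Im v" "Y = Im u + Im v"
  define r R where rR: "r = 1 / (x\<^sup>2 + m\<^sup>2)" "R = 1 / (x\<^sup>2 + Y\<^sup>2)"
  have neg: "1 / (v - u) = - (1 / (u - v))" "1 / (cnj v - u) = - (1 / (u - cnj v))"
    by (metis minus_diff_eq minus_divide_right)+
  have c: "1 / (u - v) = Complex (x * r) (- m * r)" "1 / (u - cnj v) = Complex (x * R) (- Y * R)"
     "1 / (cnj u - v) = Complex (x * R) (Y * R)"
    by (simp_all add: complex_eq_iff Re_Im_inverse_diff d rR power2_commute[of "Re v" "Re u"] add.commute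
        minus_divide_left) (simp_all add: power2_eq_square algebra_simps)?
  have alt: "dphi p q p' q' = Im ((q' - p') * (1 / (q - p)) + (cnj q' - p') * (1 / (cnj q - p)))" for p q p' q'
    by (simp add: dphi_def)
  have "wheel e f u v = - 4 * x * (snd e * snd f * x + snd e * fst f * Im v - fst e * snd f * Im u) * r * R"
    by (simp add: wheel_def d rR)
  thus ?thesis
    unfolding alt neg c by (simp add: algebra_simps d(2,3))
qed

lemma configurations_Im: "p \<in> configurations N \<Longrightarrow> k < N \<Longrightarrow> Im (p k) > 0"
  by (auto simp: configurations_def PiE_def Pi_def)

lemma d_angle_configuration:
  assumes "p \<in> configurations N" "k < N" "\<Gamma> (k, b) = x" "x \<in> Vertex ` {..<N} \<union> {VL, VR}" "x \<noteq> Vertex k"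
  shows "d_angle \<Gamma> (k, b) p l v =
    dphi (p k) (position p x) (velocity l v (Vertex k)) (velocity l v x)"
proof -
  have "position p x \<noteq> p k" "cnj (position p x) \<noteq> p k"
    using assms configurations_Im[OF assms(1)] 
    by (auto simp: configurations_def complex_eq_iff inj_on_def) (smt (verit))+
  thus ?thesis using assms(3) by (subst d_angle_eq) auto
qed

lemma dphi_0_0 [simp]: "dphi p q 0 0 = 0"
  by (simp add: dphi_def)

text \<open>The density of the two-form given by the angles from \<open>z\<close> to 0 and from
  \<open>z\<close> to 1.\<close>

definition ground_density :: "complex \<Rightarrow> real"
  where "ground_density z = 4 * Im z / (((Re z)\<^sup>2 + (Im z)\<^sup>2) * ((Re z - 1)\<^sup>2 + (Im z)\<^sup>2))"

lemma ground_density_eq: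
  assumes "z \<noteq> 0" "z \<noteq> 1"
  shows "ground_density z = dphi z 0 1 0 * dphi z 1 \<i> 0 - dphi z 0 \<i> 0 * dphi z 1 1 0"
proof -
  define r R where rR: "r = 1 / ((Re z)\<^sup>2 + (Im z)\<^sup>2)" "R = 1 / ((Re z - 1)\<^sup>2 + (Im z)\<^sup>2)"
  have c: "1 / (0 - z) = Complex (- Re z * r) (Im z * r)" "1 / (1 - z) = Complex ((1 - Re z) * R) (Im z * R)"
    using assms by (simp_all add: complex_eq_iff Re_divide Im_divide rR power2_commute[of 1])
  have "ground_density z = 4 * Im z * r * R"
    by (simp add: ground_density_def rR)
  thus ?thesis
    unfolding dphi_source complex_cnj_zero complex_cnj_one c by (simp add: algebra_simps)
qed

lemma weight_density_1:
  assumes p: "p \<in> configurations 1" and "\<Gamma> (0, l) = VL" "\<Gamma> (0, 1 - l) = VR" "l < 2"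
  shows "weight_density 1 \<Gamma> p = (-1) ^ l * ground_density (p 0)"
proof -
  have "weight_density 1 \<Gamma> p =
     d_angle \<Gamma> (0, 0) p 0 1 * d_angle \<Gamma> (0, 1) p 0 \<i> - d_angle \<Gamma> (0, 0) p 0 \<i> * d_angle \<Gamma> (0, 1) p 0 1"
    unfolding weight_density_def using det_pair_block[of 0 0 "\<lambda>r c. d_angle \<Gamma> (r div 2, r mod 2) p (c div 2) (if even c then 1 else \<i>)"]
    by (simp add: numeral_2_eq_2)
  also have "\<dots> = (-1) ^ l * ground_density (p 0)"
    using assms configurations_Im[OF p, of 0]
    by (subst ground_density_eq) (auto simp: d_angle_configuration[OF p] velocity_def less_2_cases_iff)
  finally show ?thesis .
qed

lemma weight_density_2:
  assumes p: "p \<in> configurations 2" and \<Gamma>: "\<Gamma> (0, i) = Vertex 1" "\<Gamma> (0, 1 - i) = s" 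
     "\<Gamma> (1, j) = Vertex 0" "\<Gamma> (1, 1 - j) = t"
     and ij: "i < 2" "j < 2" and st: "s \<in> {VL, VR}" "t \<in> {VL, VR}"
  shows "weight_density 2 \<Gamma> p = (-1) ^ (i + j) *
    wheel (spoke (position p s) (p 0)) (spoke (position p t) (p 1)) (p 0) (p 1)"
proof -
  note da = d_angle_configuration[OF p]
  have ne: "p 0 \<noteq> p 1" "p 0 \<noteq> cnj (p 1)"
    using p configurations_Im[OF p, of 0] configurations_Im[OF p, of 1] 
    by (auto simp: configurations_def complex_eq_iff inj_on_def) force
  define g where "g r c = d_angle \<Gamma> (r div 2, r mod 2) p (c div 2) (if even c then 1 else \<i>)" for r c
  have dm: "(2 + j) div 2 = 1" "(2 + j) mod 2 = j" "(2 + (1 - j)) div 2 = 1" "(2 + (1 - j)) mod 2 = 1 - j" 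
       "i div 2 = 0" "i mod 2 = i" "(1 - i) div 2 = 0" "(1 - i) mod 2 = 1 - i"
       "j div 2 = 0" "j mod 2 = j" "(Suc 0 - j) div 2 = 0" "(Suc 0 - i) div 2 = 0" "(Suc 0 - j) mod 2 = Suc 0 - j" "(Suc 0 - i) mod 2 = Suc 0 - i"
    using ij by auto
  have "weight_density 2 \<Gamma> p = Determinant.det (Matrix.mat 4 4 (\<lambda>(r, c). g r c))"
    by (simp add: weight_density_def g_def)
  also have "\<dots> = (-1) ^ (i + j) *
    wheel (spoke (position p s) (p 0)) (spoke (position p t) (p 1)) (p 0) (p 1)"
    unfolding wheel_eq[OF ne] 
    apply (subst det_rim[OF ij refl refl refl refl refl refl _ _ refl refl refl refl _ _ refl refl])
    using \<Gamma> st apply (auto simp: g_def dm da velocity_def spoke_def)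
    done
  finally show ?thesis .
qed

text \<open>The rows of the apex \<open>k\<close> involve only the position of \<open>k\<close>, so
  its 2 x 2 block factors off as a ground density. In the remaining minor the apex is at rest and
  the two other vertices, \<open>u\<close> before \<open>v\<close>, form a two-wheel with both
  spokes at the apex.\<close>

lemma weight_density_3:
  assumes p: "p \<in> configurations 3" and k: "k < 3" and uv: "u = (if k = 0 then 1 else 0)" "v = (if k = 2 then 1 else 2)"
     and \<Gamma>: "\<Gamma> (u, i) = Vertex v" "\<Gamma> (u, 1 - i) = Vertex k" 
     "\<Gamma> (v, j) = Vertex u" "\<Gamma> (v, 1 - j) = Vertex k"
     "\<Gamma> (k, l) = VL" "\<Gamma> (k, 1 - l) = VR"
     and ijl: "i < 2" "j < 2" "l < 2"
  shows "weight_density 3 \<Gamma> p = (-1) ^ (i + j + l) * ground_density (p k) *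
    wheel (spoke (p k) (p u)) (spoke (p k) (p v)) (p u) (p v)"
proof -
  have uv3: "u < 3" "v < 3" "u \<noteq> v" "u \<noteq> k" "v \<noteq> k" using k uv by (auto split: if_splits)
  note da = d_angle_configuration[OF p]
  have ne: "p u \<noteq> p v" "p u \<noteq> cnj (p v)"
    using p configurations_Im[OF p, of u] configurations_Im[OF p, of v] uv3
    by (auto simp: configurations_def complex_eq_iff inj_on_def) 
  have gd: "ground_density (p k) = dphi (p k) 0 1 0 * dphi (p k) 1 \<i> 0 - dphi (p k) 0 \<i> 0 * dphi (p k) 1 1 0"
    using configurations_Im[OF p k] by (intro ground_density_eq) auto
  define f where "f r c = d_angle \<Gamma> (r div 2, r mod 2) p (c div 2) (if even c then 1 else \<i>)" for r c
  \<comment> \<open>The minor with the rows and columns of the apex removed; \<open>uvd\<close>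
    translates its indices back to the vertices \<open>u\<close> and \<open>v\<close>.\<close>
  define g where "g r c = f (if r < 2 * k then r else r + 2) (if c < 2 * k then c else c + 2)" for r c
  have uvd: "(if c < 2 * k then c else c + 2) div 2 = (if c < 2 then u else v)"
       "even (if c < 2 * k then c else c + 2) = even c" "(if c < 2 * k then c else c + 2) mod 2 = c mod 2" if "c < 4" for c
    using that k unfolding uv by (auto split: if_splits) 
  have g: "g r c = d_angle \<Gamma> (if r < 2 then u else v, r mod 2) p (if c < 2 then u else v) (if even c then 1 else \<i>)"
    if "r < 4" "c < 4" for r c
    unfolding g_def f_def uvd[OF that(1)] uvd[OF that(2)] ..
  have kk: "f (2 * k + b) c = dphi (p k) (position p (\<Gamma> (k, b))) (velocity (c div 2) (if even c then 1 else \<i>) (Vertex k)) 0"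
    if "b < 2" for b c
  proof -
    have "b = l \<or> b = 1 - l" using that ijl by linarith
    moreover have "(2 * k + b) div 2 = k" "(2 * k + b) mod 2 = b" using that by auto
    ultimately show ?thesis using \<Gamma> k by (auto simp: f_def da velocity_def)
  qed
  have z: "f (2 * k) c = 0 \<and> f (Suc (2 * k)) c = 0" if "c \<noteq> 2 * k" "c \<noteq> Suc (2 * k)" for c
  proof -
    have "c div 2 \<noteq> k" using that by presburger
    thus ?thesis using kk[of 0 c] kk[of 1 c] by (simp add: velocity_def)
  qed
  have kk': "f (2 * k) (2 * k) * f (Suc (2 * k)) (Suc (2 * k)) - f (2 * k) (Suc (2 * k)) * f (Suc (2 * k)) (2 * k)
     = (-1) ^ l * ground_density (p k)"
    using kk[of 0] kk[of 1] \<Gamma>(5,6) ijl(3) unfolding gd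
    by (cases "l = 0") (auto simp: velocity_def algebra_simps less_2_cases_iff)
  have "weight_density 3 \<Gamma> p = Determinant.det (Matrix.mat (Suc (Suc 4)) (Suc (Suc 4)) (\<lambda>(r, c). f r c))"
    by (simp add: weight_density_def f_def)
  also have "\<dots> = (-1) ^ l * ground_density (p k) * Determinant.det (Matrix.mat 4 4 (\<lambda>(r, c). g r c))"
    using k by (subst det_pair_block[where i = "2 * k"]) (auto simp: z kk' g_def[abs_def])
  also have "Determinant.det (Matrix.mat 4 4 (\<lambda>(r, c). g r c)) = (-1) ^ (i + j) *
    wheel (spoke (p k) (p u)) (spoke (p k) (p v)) (p u) (p v)"
  proof -
    have "(2 + j) mod 2 = j" "(2 + (1 - j)) mod 2 = 1 - j" "\<not> 2 + j < 2" "\<not> 2 + (1 - j) < 2" "2 + j < 4" "2 + (1 - j) < 4" 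
       "i < 4" "1 - i < 4" "i mod 2 = i" "(1 - i) mod 2 = 1 - i" "1 - i < 2"
      using ijl by auto
    note dm = this ijl
    show ?thesis
      unfolding wheel_eq[OF ne] 
      apply (subst det_rim[OF ijl(1,2) refl refl refl refl refl refl _ _ refl refl refl refl _ _ refl refl])
      using \<Gamma> uv3 k by (simp_all only: g dm) (auto simp: da velocity_def spoke_def)
  qed
  finally show ?thesis by (simp add: power_add)
qed

section \<open>Lebesgue measure on configurations in adapted coordinates\<close>

abbreviation lborel2 :: "(real \<times> real) measure"
  where "lborel2 \<equiv> lborel \<Otimes>\<^sub>M lborel"

lemma measurable_Complex [measurable]:
  assumes [measurable]: "f \<in> borel_measurable M" "g \<in> borel_measurable M"
  shows "(\<lambda>x. Complex (f x) (g x)) \<in> borel_measurable M"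
proof -
  have "(\<lambda>x. complex_of_real (f x) + \<i> * complex_of_real (g x)) \<in> borel_measurable M"
    by measurable
  thus ?thesis by (simp add: Complex_eq)
qed

lemma lborel_complex: "distr lborel2 lborel (\<lambda>(x, y). Complex x y) = (lborel :: complex measure)"
proof (rule lborel_eqI[symmetric])
  fix l u :: complex assume le: "\<And>b. b \<in> Basis \<Longrightarrow> l \<bullet> b \<le> u \<bullet> b"
  have le': "Re l \<le> Re u" "Im l \<le> Im u"
    using le[of 1] le[of \<i>] by (auto simp: Basis_complex_def)
  have "(\<lambda>(x, y). Complex x y) -` box l u \<inter> space lborel2 = {Re l<..<Re u} \<times> {Im l<..<Im u}"
    by (auto simp: in_box_complex_iff space_pair_measure)
  hence "emeasure (distr lborel2 lborel (\<lambda>(x, y). Complex x y)) (box l u) =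
      emeasure lborel2 ({Re l<..<Re u} \<times> {Im l<..<Im u})"
    by (subst emeasure_distr) auto
  also have "\<dots> = emeasure lborel {Re l<..<Re u} * emeasure lborel {Im l<..<Im u}"
    by (intro lborel.emeasure_pair_measure_Times) auto
  also have "\<dots> = ennreal (\<Prod>b\<in>Basis. (u - l) \<bullet> b)"
    using le' by (simp add: Basis_complex_def ennreal_mult)
  finally show "emeasure (distr lborel2 lborel (\<lambda>(x, y). Complex x y)) (box l u) =
     ennreal (\<Prod>b\<in>Basis. (u - l) \<bullet> b)" .
qed simp

lemma nn_integral_complex:
  assumes [measurable]: "f \<in> borel_measurable (borel :: complex measure)"
  shows "(\<integral>\<^sup>+z. f z \<partial>lborel) = (\<integral>\<^sup>+y. \<integral>\<^sup>+x. f (Complex x y) \<partial>lborel \<partial>lborel)"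
proof -
  have "(\<integral>\<^sup>+z. f z \<partial>lborel) = (\<integral>\<^sup>+z. f z \<partial>distr lborel2 lborel (\<lambda>(x, y). Complex x y))"
    unfolding lborel_complex ..
  also have "\<dots> = (\<integral>\<^sup>+p. f (Complex (fst p) (snd p)) \<partial>lborel2)"
    by (subst nn_integral_distr) (auto simp: split_beta)
  also have "\<dots> = (\<integral>\<^sup>+y. \<integral>\<^sup>+x. f (Complex x y) \<partial>lborel \<partial>lborel)"
    by (subst lborel_pair.nn_integral_snd[symmetric]) auto
  finally show ?thesis .
qed

lemma nn_integral_shift:
  fixes f :: "real \<Rightarrow> ennreal"
  assumes [measurable]: "f \<in> borel_measurable borel"
  shows "(\<integral>\<^sup>+x. f x \<partial>lborel) = (\<integral>\<^sup>+x. f (c + x) \<partial>lborel)"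
  using nn_integral_real_affine[of f 1 c] by simp

type_synonym real4 = "real \<times> real \<times> real \<times> real"

text \<open>The coordinates are the two heights \<open>y\<close>, \<open>y'\<close>, the horizontal
  distance \<open>x\<close> and the horizontal position \<open>s\<close> of the second point
  relative to \<open>c\<close>. The rim factor of a two-wheel depends only on the first three, so
  \<open>s\<close> is placed innermost and integrated first.\<close>

lemma nn_integral_complex_pair:
  fixes c :: real
  assumes [measurable]: "f \<in> borel_measurable (borel \<Otimes>\<^sub>M borel :: (complex \<times> complex) measure)"
  shows "(\<integral>\<^sup>+u. \<integral>\<^sup>+v. f (u, v) \<partial>lborel \<partial>lborel) =
    (\<integral>\<^sup>+y. \<integral>\<^sup>+y'. \<integral>\<^sup>+x. \<integral>\<^sup>+s. f (Complex (c + s + x) y, Complex (c + s) y') \<partial>lborel \<partial>lborel \<partial>lborel \<partial>lborel)"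
proof -
  have "(\<integral>\<^sup>+u. \<integral>\<^sup>+v. f (u, v) \<partial>lborel \<partial>lborel) =
    (\<integral>\<^sup>+y. \<integral>\<^sup>+t. \<integral>\<^sup>+y'. \<integral>\<^sup>+s. f (Complex t y, Complex s y') \<partial>lborel \<partial>lborel \<partial>lborel \<partial>lborel)"
    by (subst nn_integral_complex, measurable, subst nn_integral_complex, measurable)
  also have "\<dots> = (\<integral>\<^sup>+y. \<integral>\<^sup>+y'. \<integral>\<^sup>+t. \<integral>\<^sup>+s. f (Complex t y, Complex s y') \<partial>lborel \<partial>lborel \<partial>lborel \<partial>lborel)"
    by (rule nn_integral_cong, rule lborel_pair.Fubini') measurable
  also have "\<dots> = (\<integral>\<^sup>+y. \<integral>\<^sup>+y'. \<integral>\<^sup>+s. \<integral>\<^sup>+t. f (Complex t y, Complex s y') \<partial>lborel \<partial>lborel \<partial>lborel \<partial>lborel)"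
    by (intro nn_integral_cong lborel_pair.Fubini') measurable
  also have "\<dots> = (\<integral>\<^sup>+y. \<integral>\<^sup>+y'. \<integral>\<^sup>+s. \<integral>\<^sup>+x. f (Complex (s + x) y, Complex s y') \<partial>lborel \<partial>lborel \<partial>lborel \<partial>lborel)"
    by (intro nn_integral_cong nn_integral_shift) measurable
  also have "\<dots> = (\<integral>\<^sup>+y. \<integral>\<^sup>+y'. \<integral>\<^sup>+s. \<integral>\<^sup>+x. f (Complex (c + s + x) y, Complex (c + s) y') \<partial>lborel \<partial>lborel \<partial>lborel \<partial>lborel)"
    by (intro nn_integral_cong nn_integral_shift) measurable
  also have "\<dots> = (\<integral>\<^sup>+y. \<integral>\<^sup>+y'. \<integral>\<^sup>+x. \<integral>\<^sup>+s. f (Complex (c + s + x) y, Complex (c + s) y') \<partial>lborel \<partial>lborel \<partial>lborel \<partial>lborel)"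
    by (intro nn_integral_cong lborel_pair.Fubini') measurable
  finally show ?thesis .
qed

lemma measurable_fst_snd_borel [measurable]:
  "fst \<in> borel_measurable (borel :: ('a::second_countable_topology \<times> 'b::second_countable_topology) measure)"
  "snd \<in> borel_measurable (borel :: ('a::second_countable_topology \<times> 'b::second_countable_topology) measure)"
  by (simp_all flip: borel_prod)

lemma nn_integral_lborel_prod:
  fixes g :: "'a::euclidean_space \<times> 'b::euclidean_space \<Rightarrow> ennreal"
  assumes "g \<in> borel_measurable borel"
  shows "(\<integral>\<^sup>+q. g q \<partial>lborel) = (\<integral>\<^sup>+x. \<integral>\<^sup>+y. g (x, y) \<partial>lborel \<partial>lborel)"
proof -
  have "g \<in> borel_measurable (lborel \<Otimes>\<^sub>M lborel)" using assms by (simp add: lborel_prod)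
  thus ?thesis unfolding lborel_prod[symmetric] by (rule lborel.nn_integral_fst[symmetric])
qed

lemma measurable_Pair_borel [measurable]:
  fixes f :: "'c \<Rightarrow> 'a::second_countable_topology" and g :: "'c \<Rightarrow> 'b::second_countable_topology"
  assumes "f \<in> borel_measurable M" "g \<in> borel_measurable M"
  shows "(\<lambda>x. (f x, g x)) \<in> borel_measurable M"
  using assms by (rule borel_measurable_Pair)

lemma nn_integral_real4:
  assumes [measurable]: "f \<in> borel_measurable (borel :: real4 measure)"
  shows "(\<integral>\<^sup>+q. f q \<partial>lborel) = (\<integral>\<^sup>+y. \<integral>\<^sup>+y'. \<integral>\<^sup>+x. \<integral>\<^sup>+s. f (y, y', x, s) \<partial>lborel \<partial>lborel \<partial>lborel \<partial>lborel)"
proof -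
  show ?thesis
    by (subst nn_integral_lborel_prod, measurable)+
qed

interpretation cprod: product_sigma_finite "\<lambda>_::nat. lborel :: complex measure" ..

abbreviation PiC :: "nat set \<Rightarrow> (nat \<Rightarrow> complex) measure"
  where "PiC I \<equiv> (\<Pi>\<^sub>M k\<in>I. lborel)"

text \<open>The value at all other indices is \<open>undefined\<close>, because the points of the
  product measure are extensional functions.\<close>

definition pair_config :: "real4 \<Rightarrow> nat \<Rightarrow> complex"
  where "pair_config = (\<lambda>(y, y', x, s). (\<lambda>_. undefined)(0 := Complex (s + x) y, 1 := Complex s y'))"

text \<open>Horizontal positions on the rim are taken relative to the apex; by translation
  invariance the rim density then depends on the apex only through its height.\<close>

definition triple_config :: "nat \<Rightarrow> nat \<Rightarrow> nat \<Rightarrow> complex \<times> real4 \<Rightarrow> nat \<Rightarrow> complex"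
  where "triple_config k u v = (\<lambda>(a, y, y', x, s).
    (\<lambda>_. undefined)(k := a, u := Complex (Re a + s + x) y, v := Complex (Re a + s) y'))"

lemma measurable_pair_config [measurable]: "pair_config \<in> borel \<rightarrow>\<^sub>M PiC {..<2}"
proof -
  have "pair_config = (\<lambda>q. \<lambda>i\<in>{..<2}. if i = 0 then Complex (snd (snd (snd q)) + fst (snd (snd q))) (fst q)
     else Complex (snd (snd (snd q))) (fst (snd q)))"
    by (auto simp: pair_config_def fun_eq_iff)
  also have "\<dots> \<in> borel \<rightarrow>\<^sub>M PiC {..<2}"
    by (rule measurable_restrict) simp
  finally show ?thesis .
qed

lemma measurable_triple_config [measurable]:
  assumes "distinct [k, u, v]" "{..<n} = {k, u, v}"
  shows "triple_config k u v \<in> borel \<rightarrow>\<^sub>M PiC {..<n}"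
proof -
  have "triple_config k u v = (\<lambda>(a, y, y', x, s). \<lambda>i\<in>{..<n}. if i = k then a
     else if i = u then Complex (Re a + s + x) y else Complex (Re a + s) y')"
    using assms by (auto simp: triple_config_def fun_eq_iff)
  also have "\<dots> \<in> borel \<rightarrow>\<^sub>M PiC {..<n}"
    unfolding split_beta by (rule measurable_restrict) simp
  finally show ?thesis .
qed

text \<open>A horizontal shear preserves Lebesgue measure. The product measure is unrolled one
  vertex at a time, and both measures are compared on indicator functions.\<close>

lemma distr_pair_config: "distr lborel (PiC {..<2}) pair_config = PiC {..<2}"
proof (rule measure_eqI)
  fix A assume "A \<in> sets (distr lborel (PiC {..<2}) pair_config)"
  hence A: "A \<in> sets (PiC {..<2})" by simp
  have I: "{..<2} = {1, 0::nat}" by auto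
  define f :: "(nat \<Rightarrow> complex) \<Rightarrow> ennreal" where "f = indicator A"
  have fm: "f \<in> borel_measurable (PiC {1, 0})" using A unfolding f_def I by simp
  have m: "(\<lambda>(u, v). f ((\<lambda>_. undefined)(0 := u, 1 := v))) \<in> borel_measurable (borel \<Otimes>\<^sub>M borel)"
  proof -
    have e: "(\<lambda>_. undefined)(0 := u, 1 := v) = (\<lambda>i\<in>{1, 0::nat}. if i = 0 then u else v)" for u v :: complex
      by (auto simp: fun_eq_iff)
    show ?thesis unfolding e split_beta
      by (rule measurable_compose[OF _ fm], rule measurable_restrict) auto
  qed
  have "emeasure (PiC {..<2}) A = (\<integral>\<^sup>+p. f p \<partial>PiC {1, 0})"
    using A by (simp add: f_def I)
  also have "\<dots> = (\<integral>\<^sup>+p. \<integral>\<^sup>+v. f (p(1 := v)) \<partial>lborel \<partial>PiC {0})"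
    by (rule cprod.product_nn_integral_insert[OF _ _ fm]) auto
  also have "\<dots> = (\<integral>\<^sup>+p. \<integral>\<^sup>+v. f ((\<lambda>_. undefined)(0 := p 0, 1 := v)) \<partial>lborel \<partial>PiC {0})"
    by (intro nn_integral_cong arg_cong[of _ _ f]) (auto simp: space_PiM PiE_def extensional_def fun_eq_iff)
  also have "\<dots> = (\<integral>\<^sup>+u. \<integral>\<^sup>+v. f ((\<lambda>_. undefined)(0 := u, 1 := v)) \<partial>lborel \<partial>lborel)"
  proof (rule cprod.product_nn_integral_singleton)
    have "(\<lambda>x. f ((\<lambda>_. undefined)(0 := fst x, 1 := snd x))) \<in> borel_measurable (borel \<Otimes>\<^sub>M borel)"
      using m by (simp add: split_beta)
    thus "(\<lambda>u. \<integral>\<^sup>+v. f ((\<lambda>_. undefined)(0 := u, 1 := v)) \<partial>lborel) \<in> borel_measurable lborel"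
      by measurable
  qed
  also have "\<dots> = (\<integral>\<^sup>+y. \<integral>\<^sup>+y'. \<integral>\<^sup>+x. \<integral>\<^sup>+s. f (pair_config (y, y', x, s)) \<partial>lborel \<partial>lborel \<partial>lborel \<partial>lborel)"
    using nn_integral_complex_pair[OF m, of 0] by (simp add: pair_config_def)
  also have "\<dots> = (\<integral>\<^sup>+q. f (pair_config q) \<partial>lborel)"
    using measurable_compose[OF measurable_pair_config, of f borel] A
    by (intro nn_integral_real4[symmetric]) (simp add: f_def)
  also have "\<dots> = emeasure (distr lborel (PiC {..<2}) pair_config) A"
    using A by (subst nn_integral_distr[symmetric, of _ _ "PiC {..<2}"]) (auto simp: f_def)
  finally show "emeasure (distr lborel (PiC {..<2}) pair_config) A = emeasure (PiC {..<2}) A" by simp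
qed simp

lemma distr_triple_config:
  assumes kuv: "distinct [k, u, v]" and n: "{..<n} = {k, u, v}"
  shows "distr lborel (PiC {..<n}) (triple_config k u v) = PiC {..<n}"
proof (rule measure_eqI)
  fix A assume "A \<in> sets (distr lborel (PiC {..<n}) (triple_config k u v))"
  hence A: "A \<in> sets (PiC {..<n})" by simp
  have I: "{..<n} = {v, u, k}" using n by auto
  define f :: "(nat \<Rightarrow> complex) \<Rightarrow> ennreal" where "f = indicator A"
  have fm: "f \<in> borel_measurable (PiC {v, u, k})" using A unfolding f_def I by simp
  have mm: "(\<lambda>(a, u', v'). f ((\<lambda>_. undefined)(k := a, u := u', v := v'))) \<in> borel_measurable (borel \<Otimes>\<^sub>M (borel \<Otimes>\<^sub>M borel))"
  proof -
    have e: "(\<lambda>_. undefined)(k := a, u := u', v := v') = (\<lambda>i\<in>{v, u, k}. if i = k then a else if i = u then u' else v')" for a u' v' :: complex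
      using kuv by (auto simp: fun_eq_iff)
    show ?thesis unfolding e split_beta
      by (rule measurable_compose[OF _ fm], rule measurable_restrict) auto
  qed
  have m: "(\<lambda>(u', v'). f ((\<lambda>_. undefined)(k := a, u := u', v := v'))) \<in> borel_measurable (borel \<Otimes>\<^sub>M borel)" for a
    using measurable_compose[OF measurable_Pair1' mm, of a] by simp
  have "emeasure (PiC {..<n}) A = (\<integral>\<^sup>+p. f p \<partial>PiC {v, u, k})"
    using A by (simp add: f_def I)
  also have "\<dots> = (\<integral>\<^sup>+p. \<integral>\<^sup>+v'. f (p(v := v')) \<partial>lborel \<partial>PiC {u, k})"
    using kuv by (intro cprod.product_nn_integral_insert fm) auto
  also have "\<dots> = (\<integral>\<^sup>+p. \<integral>\<^sup>+u'. \<integral>\<^sup>+v'. f (p(u := u', v := v')) \<partial>lborel \<partial>lborel \<partial>PiC {k})"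
  proof (rule cprod.product_nn_integral_insert)
    have "(\<lambda>(p, v'). f (p(v := v'))) \<in> borel_measurable (PiC {u, k} \<Otimes>\<^sub>M lborel)"
      using measurable_compose[OF measurable_add_dim fm] by (simp add: split_beta)
    thus "(\<lambda>p. \<integral>\<^sup>+v'. f (p(v := v')) \<partial>lborel) \<in> borel_measurable (PiC {u, k})"
      by measurable
  qed (use kuv in auto)
  also have "\<dots> = (\<integral>\<^sup>+p. \<integral>\<^sup>+u'. \<integral>\<^sup>+v'. f ((\<lambda>_. undefined)(k := p k, u := u', v := v')) \<partial>lborel \<partial>lborel \<partial>PiC {k})"
    using kuv by (intro nn_integral_cong arg_cong[of _ _ f]) (auto simp: space_PiM PiE_def extensional_def fun_eq_iff)
  also have "\<dots> = (\<integral>\<^sup>+a. \<integral>\<^sup>+u'. \<integral>\<^sup>+v'. f ((\<lambda>_. undefined)(k := a, u := u', v := v')) \<partial>lborel \<partial>lborel \<partial>lborel)"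
  proof (rule cprod.product_nn_integral_singleton)
    have "(\<lambda>x. f ((\<lambda>_. undefined)(k := fst (fst x), u := snd (fst x), v := snd x)))
        \<in> borel_measurable ((borel \<Otimes>\<^sub>M borel) \<Otimes>\<^sub>M borel)"
      using measurable_compose[OF _ mm, of "\<lambda>x. (fst (fst x), snd (fst x), snd x)"] by simp
    thus "(\<lambda>a. \<integral>\<^sup>+u'. \<integral>\<^sup>+v'. f ((\<lambda>_. undefined)(k := a, u := u', v := v')) \<partial>lborel \<partial>lborel) \<in> borel_measurable lborel"
      by measurable
  qed
  also have "\<dots> = (\<integral>\<^sup>+a. \<integral>\<^sup>+y. \<integral>\<^sup>+y'. \<integral>\<^sup>+x. \<integral>\<^sup>+s. f (triple_config k u v (a, y, y', x, s)) \<partial>lborel \<partial>lborel \<partial>lborel \<partial>lborel \<partial>lborel)"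
    by (intro nn_integral_cong) (use nn_integral_complex_pair[OF m] in \<open>simp add: triple_config_def\<close>)
  also have "\<dots> = (\<integral>\<^sup>+a. \<integral>\<^sup>+q. f (triple_config k u v (a, q)) \<partial>lborel \<partial>lborel)"
  proof (intro nn_integral_cong nn_integral_real4[symmetric])
    fix a
    show "(\<lambda>q. f (triple_config k u v (a, q))) \<in> borel_measurable borel"
      by (rule measurable_compose[OF _ measurable_compose[OF measurable_triple_config[OF assms], of f]])
         (use A in \<open>auto simp: f_def\<close>)
  qed
  also have "\<dots> = (\<integral>\<^sup>+q. f (triple_config k u v q) \<partial>lborel)"
    using measurable_compose[OF measurable_triple_config[OF assms], of f borel] A
    by (intro nn_integral_lborel_prod[symmetric]) (auto simp: f_def)
  also have "\<dots> = emeasure (distr lborel (PiC {..<n}) (triple_config k u v)) A"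
    using A measurable_triple_config[OF assms] by (subst nn_integral_distr[symmetric, of _ _ "PiC {..<n}"]) (auto simp: f_def)
  finally show "emeasure (distr lborel (PiC {..<n}) (triple_config k u v)) A = emeasure (PiC {..<n}) A" by simp
qed simp

section \<open>Integrals of rational functions\<close>

lemma FTC_einterval_nonneg:
  fixes f F :: "real \<Rightarrow> real" and a b :: ereal
  assumes "a < b"
    and "\<And>x. a < ereal x \<Longrightarrow> ereal x < b \<Longrightarrow> DERIV F x :> f x"
    and "\<And>x. a < ereal x \<Longrightarrow> ereal x < b \<Longrightarrow> isCont f x"
    and "\<And>x. a < ereal x \<Longrightarrow> ereal x < b \<Longrightarrow> 0 \<le> f x"
    and "((F \<circ> real_of_ereal) \<longlongrightarrow> A) (at_right a)"
    and "((F \<circ> real_of_ereal) \<longlongrightarrow> B) (at_left b)"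
  shows "has_bochner_integral lborel (\<lambda>x. indicator (einterval a b) x * f x) (B - A)"
  using interval_integral_FTC_nonneg[of a b F f A B] assms less_imp_le[OF assms(1)]
  by (simp add: has_bochner_integral_iff set_integrable_def set_lebesgue_integral_def
      interval_lebesgue_integral_def)

lemma FTC_einterval_integrable:
  fixes f F :: "real \<Rightarrow> real" and a b :: ereal
  assumes "a < b"
    and "\<And>x. a < ereal x \<Longrightarrow> ereal x < b \<Longrightarrow> DERIV F x :> f x"
    and "\<And>x. a < ereal x \<Longrightarrow> ereal x < b \<Longrightarrow> isCont f x"
    and "integrable lborel (\<lambda>x. indicator (einterval a b) x * f x)"
    and "((F \<circ> real_of_ereal) \<longlongrightarrow> A) (at_right a)"
    and "((F \<circ> real_of_ereal) \<longlongrightarrow> B) (at_left b)"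
  shows "has_bochner_integral lborel (\<lambda>x. indicator (einterval a b) x * f x) (B - A)"
  using interval_integral_FTC_integrable[of a b F f A B] assms less_imp_le[OF assms(1)]
  by (simp add: has_bochner_integral_iff set_integrable_def set_lebesgue_integral_def
      interval_lebesgue_integral_def has_real_derivative_iff_has_vector_derivative)

lemma FTC_UNIV_nonneg:
  fixes f F :: "real \<Rightarrow> real"
  assumes "\<And>x. DERIV F x :> f x" "\<And>x. isCont f x" "\<And>x. 0 \<le> f x"
    "(F \<longlongrightarrow> A) at_bot" "(F \<longlongrightarrow> B) at_top"
  shows "has_bochner_integral lborel f (B - A)"
  using FTC_einterval_nonneg[of "-\<infinity>" "\<infinity>" F f A B] assms by (simp add: ereal_tendsto_simps)

lemma FTC_UNIV_integrable:
  fixes f F :: "real \<Rightarrow> real"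
  assumes "\<And>x. DERIV F x :> f x" "\<And>x. isCont f x" "integrable lborel f"
    "(F \<longlongrightarrow> A) at_bot" "(F \<longlongrightarrow> B) at_top"
  shows "has_bochner_integral lborel f (B - A)"
  using FTC_einterval_integrable[of "-\<infinity>" "\<infinity>" F f A B] assms by (simp add: ereal_tendsto_simps)

lemma has_bochner_integral_arctan:
  assumes "a > 0"
  shows "has_bochner_integral lborel (\<lambda>x::real. 1 / ((x + c)\<^sup>2 + a\<^sup>2)) (pi / a)"
proof -
  have pos: "(x + c)\<^sup>2 + a\<^sup>2 > 0" for x using assms by (simp add: add_nonneg_pos)
  have "has_bochner_integral lborel (\<lambda>x::real. 1 / ((x + c)\<^sup>2 + a\<^sup>2)) (pi / 2 / a - (- pi / 2 / a))"
  proof (rule FTC_UNIV_nonneg)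
    fix x
    show "((\<lambda>x. arctan ((x + c) / a) / a) has_real_derivative 1 / ((x + c)\<^sup>2 + a\<^sup>2)) (at x)"
      using assms pos[of x]
      by (auto intro!: derivative_eq_intros simp: divide_simps)
         (simp_all add: algebra_simps power2_eq_square)
    show "isCont (\<lambda>x. 1 / ((x + c)\<^sup>2 + a\<^sup>2)) x" 
      using pos[of x] by (intro continuous_intros) auto
    show "0 \<le> 1 / ((x + c)\<^sup>2 + a\<^sup>2)" using pos[of x] by simp
  next
    show "((\<lambda>x. arctan ((x + c) / a) / a) \<longlongrightarrow> - pi / 2 / a) at_bot" using assms by real_asymp (simp add: field_simps)
    show "((\<lambda>x. arctan ((x + c) / a) / a) \<longlongrightarrow> pi / 2 / a) at_top" using assms by real_asymp (simp add: field_simps)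
  qed
  thus ?thesis by simp
qed

text \<open>The integral of a rational function with two pairs of simple conjugate poles, decaying like
  \<open>1/s\<^sup>2\<close>, from its partial fraction decomposition.\<close>

lemma has_bochner_integral_partial_fractions:
  fixes p q r A B x :: real
  defines "f \<equiv> \<lambda>s. (p * s + q) / (s\<^sup>2 + B\<^sup>2) + (r - p * (s + x)) / ((s + x)\<^sup>2 + A\<^sup>2)"
  assumes "A > 0" "B > 0" "integrable lborel f"
  shows "has_bochner_integral lborel f (pi * (q / B + r / A))"
proof -
  have pos: "(s + x)\<^sup>2 + A\<^sup>2 > 0" "s\<^sup>2 + B\<^sup>2 > 0" for s using assms by (simp_all add: add_nonneg_pos)
  let ?F = "\<lambda>s. p / 2 * ln ((s\<^sup>2 + B\<^sup>2) / ((s + x)\<^sup>2 + A\<^sup>2)) + q / B * arctan (s / B) + r / A * arctan ((s + x) / A)"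
  have "has_bochner_integral lborel f ((q / B * (pi / 2) + r / A * (pi / 2)) - (q / B * (- pi / 2) + r / A * (- pi / 2)))"
  proof (rule FTC_UNIV_integrable)
    fix s
    have "(?F has_real_derivative (p / 2 * (2 * s / (s\<^sup>2 + B\<^sup>2) - 2 * (s + x) / ((s + x)\<^sup>2 + A\<^sup>2)) +
       q / B * (inverse (1 + (s / B)\<^sup>2) * (1 / B)) + r / A * (inverse (1 + ((s + x) / A)\<^sup>2) * (1 / A)))) (at s)"
      using assms(2,3) pos[of s] 
      by (auto intro!: derivative_eq_intros simp: divide_simps) (simp add: algebra_simps power2_eq_square)?
    moreover have "q / B * (inverse (1 + (s / B)\<^sup>2) * (1 / B)) = q / (s\<^sup>2 + B\<^sup>2)"
      using assms(3) pos[of s] by (simp add: field_simps power2_eq_square)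
    moreover have "r / A * (inverse (1 + ((s + x) / A)\<^sup>2) * (1 / A)) = r / ((s + x)\<^sup>2 + A\<^sup>2)"
      using assms(2) pos[of s] by (simp add: field_simps power2_eq_square)
    ultimately show "(?F has_real_derivative f s) (at s)"
      by (simp add: f_def add_divide_distrib diff_divide_distrib right_diff_distrib algebra_simps)
    show "isCont f s" unfolding f_def using pos[of s] by (intro continuous_intros) auto
  next
    show "(?F \<longlongrightarrow> q / B * (- pi / 2) + r / A * (- pi / 2)) at_bot" using assms(2,3) by real_asymp
    show "(?F \<longlongrightarrow> q / B * (pi / 2) + r / A * (pi / 2)) at_top" using assms(2,3) by real_asymp
  qed (fact assms(4))
  thus ?thesis by (simp add: algebra_simps)
qed


text \<open>The resultant of (s + x)^2 + A^2 and s^2 + B^2 as polynomials in s, hence the common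
  denominator of the partial fraction coefficients below.\<close>

definition poisson_denominator :: "real \<Rightarrow> real \<Rightarrow> real \<Rightarrow> real"
  where "poisson_denominator A B x = (x\<^sup>2 + (A + B)\<^sup>2) * (x\<^sup>2 + (A - B)\<^sup>2)"

lemma partial_fractions_1:
  fixes A B x s :: real
  defines "D \<equiv> poisson_denominator A B x"
  assumes "A > 0" "B > 0" "D \<noteq> 0"
  shows "1 / (((s + x)\<^sup>2 + A\<^sup>2) * (s\<^sup>2 + B\<^sup>2)) =
    (- 2 * x / D * s + (x\<^sup>2 + A\<^sup>2 - B\<^sup>2) / D) / (s\<^sup>2 + B\<^sup>2) +
    ((x\<^sup>2 + B\<^sup>2 - A\<^sup>2) / D - - 2 * x / D * (s + x)) / ((s + x)\<^sup>2 + A\<^sup>2)"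
proof -
  have pos: "(s + x)\<^sup>2 + A\<^sup>2 \<noteq> 0" "s\<^sup>2 + B\<^sup>2 \<noteq> 0" using assms by (simp_all add: add_nonneg_pos less_imp_neq[symmetric])
  have D: "D = (x\<^sup>2 + A\<^sup>2 - B\<^sup>2 - 2 * x * s) * ((s + x)\<^sup>2 + A\<^sup>2) + (x\<^sup>2 + B\<^sup>2 - A\<^sup>2 + 2 * x * (s + x)) * (s\<^sup>2 + B\<^sup>2)"
    unfolding D_def poisson_denominator_def by (simp add: algebra_simps power2_eq_square)
  have *: "1 / (u * v) = (M / D) / v + (N / D) / u" if "D = M * u + N * v" "u \<noteq> 0" "v \<noteq> 0" for u v M N :: real
    using that \<open>D \<noteq> 0\<close> by (simp add: divide_simps mult.commute) 
  show ?thesis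
    by (subst *[OF D pos]) (simp add: diff_divide_distrib add_divide_distrib)
qed

lemma partial_fractions_s:
  fixes A B x s :: real
  defines "D \<equiv> poisson_denominator A B x"
  assumes "A > 0" "B > 0" "D \<noteq> 0"
  shows "s / (((s + x)\<^sup>2 + A\<^sup>2) * (s\<^sup>2 + B\<^sup>2)) =
    ((x\<^sup>2 + A\<^sup>2 - B\<^sup>2) / D * s + 2 * x * B\<^sup>2 / D) / (s\<^sup>2 + B\<^sup>2) +
    (- x * (x\<^sup>2 + A\<^sup>2 + B\<^sup>2) / D - (x\<^sup>2 + A\<^sup>2 - B\<^sup>2) / D * (s + x)) / ((s + x)\<^sup>2 + A\<^sup>2)"
proof -
  have pos: "(s + x)\<^sup>2 + A\<^sup>2 \<noteq> 0" "s\<^sup>2 + B\<^sup>2 \<noteq> 0" using assms by (simp_all add: add_nonneg_pos less_imp_neq[symmetric])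
  have D: "D * s = ((x\<^sup>2 + A\<^sup>2 - B\<^sup>2) * s + 2 * x * B\<^sup>2) * ((s + x)\<^sup>2 + A\<^sup>2) +
      (- x * (x\<^sup>2 + A\<^sup>2 + B\<^sup>2) - (x\<^sup>2 + A\<^sup>2 - B\<^sup>2) * (s + x)) * (s\<^sup>2 + B\<^sup>2)"
    unfolding D_def poisson_denominator_def by (simp add: algebra_simps power2_eq_square)
  have *: "s / (u * v) = (M / D) / v + (N / D) / u" if "D * s = M * u + N * v" "u \<noteq> 0" "v \<noteq> 0" for u v M N :: real
    using that \<open>D \<noteq> 0\<close> by (simp add: divide_simps mult.commute) 
  have "(K * s + L) / D = K / D * s + L / D" "(L - K * t) / D = L / D - K / D * t" for K L t :: real
    by (simp_all add: add_divide_distrib diff_divide_distrib)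
  thus ?thesis
    by (simp only: *[OF D pos])
qed

lemma poisson_denominator_pos:
  assumes "A > 0" "B > 0" "x \<noteq> 0 \<or> A \<noteq> B"
  shows "poisson_denominator A B x > 0"
  using assms unfolding poisson_denominator_def
  by (intro mult_pos_pos) (auto intro: add_pos_nonneg add_nonneg_pos)

lemma integrable_1_div:
  fixes A B x :: real
  assumes "A > 0" "B > 0"
  shows "integrable lborel (\<lambda>s. 1 / (((s + x)\<^sup>2 + A\<^sup>2) * (s\<^sup>2 + B\<^sup>2)))"
proof (rule Bochner_Integration.integrable_bound)
  show "integrable lborel (\<lambda>s. 1 / B\<^sup>2 * (1 / ((s + x)\<^sup>2 + A\<^sup>2)))"
    using has_bochner_integral_arctan[OF assms(1), of x]
    by (intro integrable_mult_right) (simp add: has_bochner_integral_iff)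
  show "AE s in lborel. norm (1 / (((s + x)\<^sup>2 + A\<^sup>2) * (s\<^sup>2 + B\<^sup>2))) \<le> norm (1 / B\<^sup>2 * (1 / ((s + x)\<^sup>2 + A\<^sup>2)))"
  proof (rule AE_I2)
    fix s
    have "1 / (s\<^sup>2 + B\<^sup>2) \<le> 1 / B\<^sup>2" using assms by (intro divide_left_mono) (auto intro!: mult_pos_pos add_nonneg_pos)
    from mult_right_mono[OF this, of "1 / ((s + x)\<^sup>2 + A\<^sup>2)"]
    show "norm (1 / (((s + x)\<^sup>2 + A\<^sup>2) * (s\<^sup>2 + B\<^sup>2))) \<le> norm (1 / B\<^sup>2 * (1 / ((s + x)\<^sup>2 + A\<^sup>2)))"
      by (simp add: mult.commute)
  qed
qed simp

lemma integrable_s_div: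
  fixes A B x :: real
  assumes "A > 0" "B > 0"
  shows "integrable lborel (\<lambda>s. s / (((s + x)\<^sup>2 + A\<^sup>2) * (s\<^sup>2 + B\<^sup>2)))"
proof (rule Bochner_Integration.integrable_bound)
  show "integrable lborel (\<lambda>s. 1 / B * (1 / ((s + x)\<^sup>2 + A\<^sup>2)))"
    using has_bochner_integral_arctan[OF assms(1), of x]
    by (intro integrable_mult_right) (simp add: has_bochner_integral_iff)
  show "AE s in lborel. norm (s / (((s + x)\<^sup>2 + A\<^sup>2) * (s\<^sup>2 + B\<^sup>2))) \<le> norm (1 / B * (1 / ((s + x)\<^sup>2 + A\<^sup>2)))"
  proof (rule AE_I2)
    fix s
    have "0 \<le> (\<bar>s\<bar> - B)\<^sup>2" by simp
    hence "2 * (\<bar>s\<bar> * B) \<le> s\<^sup>2 + B\<^sup>2" by (simp add: power2_diff)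
    moreover have "0 \<le> \<bar>s\<bar> * B" using assms by simp
    ultimately have "\<bar>s\<bar> * B \<le> s\<^sup>2 + B\<^sup>2" by linarith
    hence "\<bar>s\<bar> / (s\<^sup>2 + B\<^sup>2) \<le> 1 / B"
      using assms by (simp add: divide_simps add_nonneg_pos)
    from mult_right_mono[OF this, of "1 / ((s + x)\<^sup>2 + A\<^sup>2)"]
    show "norm (s / (((s + x)\<^sup>2 + A\<^sup>2) * (s\<^sup>2 + B\<^sup>2))) \<le> norm (1 / B * (1 / ((s + x)\<^sup>2 + A\<^sup>2)))"
      using assms by (simp add: mult.commute abs_mult)
  qed
qed simp

text \<open>The semigroup law of the Poisson kernel: up to normalisation, the convolution of the
  kernels of heights A and B is the kernel of height A + B. The factor x^2 + (A - B)^2 of the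
  resultant cancels.\<close>

lemma has_bochner_integral_1_div:
  fixes A B x :: real
  assumes AB: "A > 0" "B > 0" and x: "x \<noteq> 0 \<or> A \<noteq> B"
  shows "has_bochner_integral lborel (\<lambda>s. 1 / (((s + x)\<^sup>2 + A\<^sup>2) * (s\<^sup>2 + B\<^sup>2)))
    (pi * (A + B) / (A * B * (x\<^sup>2 + (A + B)\<^sup>2)))"
proof -
  define D where "D = poisson_denominator A B x"
  have D: "D > 0" unfolding D_def by (rule poisson_denominator_pos[OF assms])
  have S: "x\<^sup>2 + (A - B)\<^sup>2 > 0" using x by (auto intro: add_pos_nonneg add_nonneg_pos)
  have S': "x\<^sup>2 + (A + B)\<^sup>2 > 0" using AB by (auto intro: add_nonneg_pos)
  note pf = partial_fractions_1[OF AB, of x, folded D_def]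
  have "has_bochner_integral lborel (\<lambda>s. 1 / (((s + x)\<^sup>2 + A\<^sup>2) * (s\<^sup>2 + B\<^sup>2)))
     (pi * ((x\<^sup>2 + A\<^sup>2 - B\<^sup>2) / D / B + (x\<^sup>2 + B\<^sup>2 - A\<^sup>2) / D / A))"
    using has_bochner_integral_partial_fractions[OF AB, of "- 2 * x / D" "(x\<^sup>2 + A\<^sup>2 - B\<^sup>2) / D" "(x\<^sup>2 + B\<^sup>2 - A\<^sup>2) / D" x]
       integrable_1_div[OF AB, of x] D
    unfolding pf[OF less_imp_neq[OF D, symmetric]] by blast
  also have "(x\<^sup>2 + A\<^sup>2 - B\<^sup>2) / D / B + (x\<^sup>2 + B\<^sup>2 - A\<^sup>2) / D / A =
     ((A + B) * (x\<^sup>2 + (A - B)\<^sup>2)) / (D * (A * B))"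
    using AB D by (simp add: divide_simps) (simp add: algebra_simps power2_eq_square)
  also have "\<dots> = (A + B) / (A * B * (x\<^sup>2 + (A + B)\<^sup>2))"
    using AB S S' x unfolding D_def poisson_denominator_def by (simp add: mult.commute mult.left_commute)
  finally show ?thesis by simp
qed

text \<open>The companion of the semigroup law: the Poisson kernel of height A convolved with the
  conjugate kernel of height B is the conjugate kernel of height A + B.\<close>

lemma has_bochner_integral_s_div:
  fixes A B x :: real
  assumes AB: "A > 0" "B > 0" and x: "x \<noteq> 0 \<or> A \<noteq> B"
  shows "has_bochner_integral lborel (\<lambda>s. s / (((s + x)\<^sup>2 + A\<^sup>2) * (s\<^sup>2 + B\<^sup>2)))
    (- (pi * x / (A * (x\<^sup>2 + (A + B)\<^sup>2))))"
proof -
  define D where "D = poisson_denominator A B x"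
  have D: "D > 0" unfolding D_def by (rule poisson_denominator_pos[OF assms])
  have S: "x\<^sup>2 + (A - B)\<^sup>2 > 0" using x by (auto intro: add_pos_nonneg add_nonneg_pos)
  have S': "x\<^sup>2 + (A + B)\<^sup>2 > 0" using AB by (auto intro: add_nonneg_pos)
  note pf = partial_fractions_s[OF AB, of x, folded D_def]
  have "has_bochner_integral lborel (\<lambda>s. s / (((s + x)\<^sup>2 + A\<^sup>2) * (s\<^sup>2 + B\<^sup>2)))
     (pi * (2 * x * B\<^sup>2 / D / B + - x * (x\<^sup>2 + A\<^sup>2 + B\<^sup>2) / D / A))"
    using has_bochner_integral_partial_fractions[OF AB, of "(x\<^sup>2 + A\<^sup>2 - B\<^sup>2) / D" "2 * x * B\<^sup>2 / D" "- x * (x\<^sup>2 + A\<^sup>2 + B\<^sup>2) / D" x]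
       integrable_s_div[OF AB, of x] D
    unfolding pf[OF less_imp_neq[OF D, symmetric]] by blast
  also have "2 * x * B\<^sup>2 / D / B + - x * (x\<^sup>2 + A\<^sup>2 + B\<^sup>2) / D / A =
     - (x * (x\<^sup>2 + (A - B)\<^sup>2)) / (D * A)"
    using AB D by (simp add: divide_simps) (simp add: algebra_simps power2_eq_square)
  also have "\<dots> = - (x / (A * (x\<^sup>2 + (A + B)\<^sup>2)))"
    using AB S S' x unfolding D_def poisson_denominator_def by (simp add: mult.commute mult.left_commute)
  finally show ?thesis by simp
qed

lemma has_bochner_integral_s'_div:
  fixes A B x :: real
  assumes AB: "A > 0" "B > 0" and x: "x \<noteq> 0 \<or> A \<noteq> B"
  shows "has_bochner_integral lborel (\<lambda>s. (s + x) / (((s + x)\<^sup>2 + A\<^sup>2) * (s\<^sup>2 + B\<^sup>2)))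
    (pi * x / (B * (x\<^sup>2 + (A + B)\<^sup>2)))"
proof -
  have "has_bochner_integral lborel (\<lambda>s. (s + x) / (((s + x)\<^sup>2 + A\<^sup>2) * (s\<^sup>2 + B\<^sup>2)))
     (- (pi * x / (A * (x\<^sup>2 + (A + B)\<^sup>2))) + x * (pi * (A + B) / (A * B * (x\<^sup>2 + (A + B)\<^sup>2))))"
    using has_bochner_integral_add[OF has_bochner_integral_s_div[OF assms]
      has_bochner_integral_mult_right[OF has_bochner_integral_1_div[OF assms], of x]]
    by (simp add: add_divide_distrib)
  also have "- (pi * x / (A * (x\<^sup>2 + (A + B)\<^sup>2))) + x * (pi * (A + B) / (A * B * (x\<^sup>2 + (A + B)\<^sup>2))) =
     pi * x / (B * (x\<^sup>2 + (A + B)\<^sup>2))"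
  proof -
    have "x\<^sup>2 + (A + B)\<^sup>2 > 0" using AB by (auto intro: add_nonneg_pos)
    thus ?thesis using AB by (simp add: divide_simps) (simp add: algebra_simps)
  qed
  finally show ?thesis .
qed

lemma has_bochner_integral_three_poles:
  fixes a b c :: real
  assumes abc: "a > 0" "b > 0" "c > 0" "a \<noteq> b" "b \<noteq> c" "a \<noteq> c"
  shows "has_bochner_integral lborel (\<lambda>x. x\<^sup>2 / ((x\<^sup>2 + a\<^sup>2) * (x\<^sup>2 + b\<^sup>2) * (x\<^sup>2 + c\<^sup>2)))
    (pi / ((a + b) * (a + c) * (b + c)))"
proof -
  have ne: "a\<^sup>2 \<noteq> b\<^sup>2" "b\<^sup>2 \<noteq> c\<^sup>2" "a\<^sup>2 \<noteq> c\<^sup>2" using abc by (auto simp: power2_eq_iff)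
  \<comment> \<open>The coefficients of the partial fractions with respect to the variable
    x^2.\<close>
  define \<alpha> where "\<alpha> = (\<lambda>a b c :: real. - a\<^sup>2 / ((b\<^sup>2 - a\<^sup>2) * (c\<^sup>2 - a\<^sup>2)))"
  have pf: "x\<^sup>2 / ((x\<^sup>2 + a\<^sup>2) * (x\<^sup>2 + b\<^sup>2) * (x\<^sup>2 + c\<^sup>2)) =
     \<alpha> a b c * (1 / ((x + 0)\<^sup>2 + a\<^sup>2)) + \<alpha> b a c * (1 / ((x + 0)\<^sup>2 + b\<^sup>2)) + \<alpha> c a b * (1 / ((x + 0)\<^sup>2 + c\<^sup>2))" for x
  proof -
    have *: "X / ((X + P) * (X + Q) * (X + R)) = - P / ((Q - P) * (R - P)) * (1 / (X + P))
       + - Q / ((P - Q) * (R - Q)) * (1 / (X + Q)) + - R / ((P - R) * (Q - R)) * (1 / (X + R))"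
      if "X + P \<noteq> 0" "X + Q \<noteq> 0" "X + R \<noteq> 0" "P \<noteq> Q" "Q \<noteq> R" "P \<noteq> R" for X P Q R :: real
      using that by (simp add: divide_simps) (simp add: algebra_simps)
    show ?thesis unfolding \<alpha>_def using ne abc
      by (subst *) (auto simp: add_nonneg_eq_0_iff)
  qed
  have "has_bochner_integral lborel (\<lambda>x. x\<^sup>2 / ((x\<^sup>2 + a\<^sup>2) * (x\<^sup>2 + b\<^sup>2) * (x\<^sup>2 + c\<^sup>2)))
     (\<alpha> a b c * (pi / a) + \<alpha> b a c * (pi / b) + \<alpha> c a b * (pi / c))"
    unfolding pf by (intro has_bochner_integral_add has_bochner_integral_mult_right has_bochner_integral_arctan abc)
  also have "\<alpha> a b c * (pi / a) + \<alpha> b a c * (pi / b) + \<alpha> c a b * (pi / c) = pi / ((a + b) * (a + c) * (b + c))"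
  proof -
    have f: "b\<^sup>2 - a\<^sup>2 = (b - a) * (a + b)" "c\<^sup>2 - a\<^sup>2 = (c - a) * (a + c)" "a\<^sup>2 - b\<^sup>2 = - ((b - a) * (a + b))"
        "c\<^sup>2 - b\<^sup>2 = (c - b) * (b + c)" "a\<^sup>2 - c\<^sup>2 = - ((c - a) * (a + c))" "b\<^sup>2 - c\<^sup>2 = - ((c - b) * (b + c))"
      by (simp_all add: algebra_simps power2_eq_square)
    have "b - a \<noteq> 0" "c - a \<noteq> 0" "c - b \<noteq> 0" "a + b \<noteq> 0" "a + c \<noteq> 0" "b + c \<noteq> 0" using abc by auto
    thus ?thesis unfolding \<alpha>_def f using abc
      by (simp add: divide_simps) (simp add: algebra_simps power2_eq_square)
  qed
  finally show ?thesis .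
qed

section \<open>The sign of the two-wheel with spokes to the boundary\<close>

lemma Fubini_lborel:
  fixes f :: "'a::euclidean_space \<times> 'b::euclidean_space \<Rightarrow> real"
  assumes "integrable lborel f"
  shows "AE x in lborel. integrable lborel (\<lambda>y. f (x, y))"
    and "integrable lborel (\<lambda>x. \<integral>y. f (x, y) \<partial>lborel)"
    and "(\<integral>x. \<integral>y. f (x, y) \<partial>lborel \<partial>lborel) = (\<integral>q. f q \<partial>lborel)"
proof -
  have f: "integrable (lborel \<Otimes>\<^sub>M lborel) f" using assms by (simp add: lborel_prod)
  show "AE x in lborel. integrable lborel (\<lambda>y. f (x, y))"
    by (rule lborel_pair.AE_integrable_fst'[OF f])
  show "integrable lborel (\<lambda>x. \<integral>y. f (x, y) \<partial>lborel)"
    by (rule lborel_pair.integrable_fst'[OF f])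
  show "(\<integral>x. \<integral>y. f (x, y) \<partial>lborel \<partial>lborel) = (\<integral>q. f q \<partial>lborel)"
    using lborel_pair.integral_fst'[OF f] by (simp add: lborel_prod)
qed

text \<open>Lets a strict sign pass through an iterated integral. It is applied to both heights and
  to the horizontal distance after folding the line at 0.\<close>

lemma integral_neg_if_AE:
  fixes f :: "real \<Rightarrow> real"
  assumes "integrable lborel f" and "AE x in lborel. (x > 0 \<longrightarrow> f x < 0) \<and> (x \<le> 0 \<longrightarrow> f x = 0)"
  shows "(\<integral>x. f x \<partial>lborel) < 0"
proof -
  have le: "AE x in lborel. 0 \<le> - f x" using assms(2) by eventually_elim (auto simp: not_less intro: less_imp_le)
  have "(\<integral>x. - f x \<partial>lborel) \<noteq> 0"
  proof
    assume "(\<integral>x. - f x \<partial>lborel) = 0"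
    hence "AE x in lborel. - f x = 0"
      using assms(1) le by (subst integral_nonneg_eq_0_iff_AE[symmetric]) auto
    with assms(2) have "AE x in lborel. \<not> (x::real) > 0" by eventually_elim auto
    hence "AE x in lborel. x \<notin> {0<..<1::real}" by eventually_elim auto
    hence "{0<..<1::real} \<in> null_sets lborel" by (subst AE_iff_null_sets) auto
    thus False by (auto simp: null_sets_def)
  qed
  moreover have "(\<integral>x. - f x \<partial>lborel) \<ge> 0" using le by (rule integral_nonneg_AE)
  ultimately show ?thesis by simp
qed

lemma nn_integral_has_bochner:
  assumes "has_bochner_integral M f v" "\<And>x. f x \<ge> 0"
  shows "(\<integral>\<^sup>+x. ennreal (f x) \<partial>M) = ennreal v"
  using assms by (subst nn_integral_eq_integral) (auto simp: has_bochner_integral_iff)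

text \<open>The integrand is, up to a factor, the product of the Poisson kernels of the boundary points
  \<open>0\<close> and \<open>\<delta>\<close>.\<close>

lemma nn_integral_poisson_kernels_finite:
  fixes \<delta> C :: real
  assumes \<delta>: "\<delta>\<^sup>2 = 1" and C: "C \<ge> 0"
  shows "(\<integral>\<^sup>+y. \<integral>\<^sup>+x. ennreal (if y > 0 then C * y / ((x\<^sup>2 + y\<^sup>2) * ((x - \<delta>)\<^sup>2 + y\<^sup>2)) else 0) \<partial>lborel \<partial>lborel) < \<infinity>"
proof -
  have \<delta>0: "\<delta> \<noteq> 0" using \<delta> by auto
  have "(\<integral>\<^sup>+x. ennreal (if y > 0 then C * y / ((x\<^sup>2 + y\<^sup>2) * ((x - \<delta>)\<^sup>2 + y\<^sup>2)) else 0) \<partial>lborel) \<le>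
     ennreal (pi * C / 2 * (1 / ((y + 0)\<^sup>2 + (1 / 2)\<^sup>2)))" for y
  proof (cases "y > 0")
    case y: True
    have "has_bochner_integral lborel (\<lambda>s. C * y * (1 / (((s + - \<delta>)\<^sup>2 + y\<^sup>2) * (s\<^sup>2 + y\<^sup>2))))
       (C * y * (pi * (y + y) / (y * y * ((- \<delta>)\<^sup>2 + (y + y)\<^sup>2))))"
      by (intro has_bochner_integral_mult_right has_bochner_integral_1_div) (use y \<delta>0 in auto)
    hence "(\<integral>\<^sup>+x. ennreal (C * y * (1 / (((x + - \<delta>)\<^sup>2 + y\<^sup>2) * (x\<^sup>2 + y\<^sup>2)))) \<partial>lborel) =
        ennreal (C * y * (pi * (y + y) / (y * y * ((- \<delta>)\<^sup>2 + (y + y)\<^sup>2))))"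
      by (rule nn_integral_has_bochner) (use y C in auto)
    also have "C * y * (pi * (y + y) / (y * y * ((- \<delta>)\<^sup>2 + (y + y)\<^sup>2))) = pi * C / 2 * (1 / ((y + 0)\<^sup>2 + (1 / 2)\<^sup>2))"
    proof -
      have "1 + 4 * y\<^sup>2 > 0" by (simp add: add_pos_nonneg)
      thus ?thesis using y \<delta> by (simp add: divide_simps)
    qed
    finally show ?thesis using y by (simp add: mult.commute)
  qed (use C in auto)
  hence "(\<integral>\<^sup>+y. \<integral>\<^sup>+x. ennreal (if y > 0 then C * y / ((x\<^sup>2 + y\<^sup>2) * ((x - \<delta>)\<^sup>2 + y\<^sup>2)) else 0) \<partial>lborel \<partial>lborel)
      \<le> (\<integral>\<^sup>+y. ennreal (pi * C / 2 * (1 / ((y + 0)\<^sup>2 + (1 / 2)\<^sup>2))) \<partial>lborel)"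
    by (intro nn_integral_mono)
  also have "\<dots> = ennreal (pi * C / 2 * (pi / (1 / 2)))"
    by (intro nn_integral_has_bochner has_bochner_integral_mult_right has_bochner_integral_arctan) (use C in auto)
  also have "\<dots> < \<infinity>" by simp
  finally show ?thesis .
qed

text \<open>The rim density in the coordinates of \<open>pair_config\<close>, extended by 0 below
  the real axis so that all integrals run over the whole of R^4.\<close>

definition two_wheel :: "complex \<Rightarrow> complex \<Rightarrow> real4 \<Rightarrow> real"
  where "two_wheel a b = (\<lambda>(y, y', x, s). if y > 0 \<and> y' > 0 then
    wheel (spoke a (Complex (s + x) y)) (spoke b (Complex s y')) (Complex (s + x) y) (Complex s y') else 0)"

lemma borel_measurable_two_wheel [measurable]: "two_wheel a b \<in> borel_measurable borel"
  unfolding two_wheel_def wheel_def spoke_eq split_beta by (simp only: fst_conv snd_conv complex.sel) measurable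

text \<open>For a real target the two mirror terms of a spoke coincide. The bracket in
  \<open>wheel\<close> then loses its dependence on \<open>s\<close>, which survives only in the
  product of two Poisson denominators.\<close>

lemma two_wheel_real:
  assumes "y > 0" "y' > 0"
  shows "two_wheel (of_real a) (of_real b) (y, y', x, s) =
    - (16 * (a - b) * y * y' * x / ((x\<^sup>2 + (y - y')\<^sup>2) * (x\<^sup>2 + (y + y')\<^sup>2))) *
      (1 / (((s + x - a)\<^sup>2 + y\<^sup>2) * ((s - b)\<^sup>2 + y'\<^sup>2)))"
proof -
  define p q where "p = 1 / ((s + x - a)\<^sup>2 + y\<^sup>2)" and "q = 1 / ((s - b)\<^sup>2 + y'\<^sup>2)"
  have sp: "spoke (of_real a) (Complex (s + x) y) = (2 * (s + x - a) * p, 2 * y * p)"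
     "spoke (of_real b) (Complex s y') = (2 * (s - b) * q, 2 * y' * q)"
    by (simp_all add: spoke_eq p_def q_def)
  have "two_wheel (of_real a) (of_real b) (y, y', x, s) = - (16 * (a - b) * y * y' * x / ((x\<^sup>2 + (y - y')\<^sup>2) * (x\<^sup>2 + (y + y')\<^sup>2))) * (p * q)"
    using assms by (simp add: two_wheel_def wheel_def sp) (simp add: algebra_simps)
  thus ?thesis by (simp add: p_def q_def)
qed

lemma has_bochner_integral_two_wheel_s:
  assumes y: "y > 0" "y' > 0" "y \<noteq> y'"
  shows "has_bochner_integral lborel (\<lambda>s. two_wheel (of_real a) (of_real b) (y, y', x, s))
    (- (16 * pi * (a - b) * x * (y + y') / ((x\<^sup>2 + (y - y')\<^sup>2) * (x\<^sup>2 + (y + y')\<^sup>2) * ((x - (a - b))\<^sup>2 + (y + y')\<^sup>2))))"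
  (is "has_bochner_integral _ _ ?V")
proof -
  let ?c = "- (16 * (a - b) * y * y' * x / ((x\<^sup>2 + (y - y')\<^sup>2) * (x\<^sup>2 + (y + y')\<^sup>2)))"
  have "has_bochner_integral lborel (\<lambda>s. 1 / (((s + (x - (a - b)))\<^sup>2 + y\<^sup>2) * (s\<^sup>2 + y'\<^sup>2)))
    (pi * (y + y') / (y * y' * ((x - (a - b))\<^sup>2 + (y + y')\<^sup>2)))"
    using y by (intro has_bochner_integral_1_div) auto
  hence "has_bochner_integral lborel (\<lambda>s. 1 / (((- b + 1 * s + (x - (a - b)))\<^sup>2 + y\<^sup>2) * ((- b + 1 * s)\<^sup>2 + y'\<^sup>2)))
    (pi * (y + y') / (y * y' * ((x - (a - b))\<^sup>2 + (y + y')\<^sup>2)) /\<^sub>R \<bar>1\<bar>)"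
    by (intro lborel_has_bochner_integral_real_affine_iff[of 1 _ _ "- b", THEN iffD1]) auto
  hence "has_bochner_integral lborel (\<lambda>s. ?c * (1 / (((s + x - a)\<^sup>2 + y\<^sup>2) * ((s - b)\<^sup>2 + y'\<^sup>2))))
    (?c * (pi * (y + y') / (y * y' * ((x - (a - b))\<^sup>2 + (y + y')\<^sup>2))))"
    by (intro has_bochner_integral_mult_right) (simp add: algebra_simps)
  also have "?c * (pi * (y + y') / (y * y' * ((x - (a - b))\<^sup>2 + (y + y')\<^sup>2))) = ?V"
  proof -
    have "- (16 * (a - b) * y * y' * x / P) * (pi * Y / (y * y' * Q)) = - (16 * pi * (a - b) * x * Y / (P * Q))" for P Q Y
      using y by simp
    thus ?thesis .
  qed
  finally show ?thesis using y by (simp add: two_wheel_real)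
qed


lemma nn_integral_arctan_affine:
  fixes Y x :: real
  assumes "x \<noteq> 0"
  shows "(\<integral>\<^sup>+t. ennreal (1 / (x\<^sup>2 + (Y - 2 * t)\<^sup>2)) \<partial>lborel) = ennreal (pi / (2 * \<bar>x\<bar>))"
proof -
  have "has_bochner_integral lborel (\<lambda>t. 1 / 4 * (1 / ((t + - (Y / 2))\<^sup>2 + (\<bar>x\<bar> / 2)\<^sup>2))) (1 / 4 * (pi / (\<bar>x\<bar> / 2)))"
    by (intro has_bochner_integral_mult_right has_bochner_integral_arctan) (use assms in auto)
  also have "(\<lambda>t. 1 / 4 * (1 / ((t + - (Y / 2))\<^sup>2 + (\<bar>x\<bar> / 2)\<^sup>2))) = (\<lambda>t. 1 / (x\<^sup>2 + (Y - 2 * t)\<^sup>2))"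
    by (auto simp: fun_eq_iff power2_eq_square field_simps)
  finally have "(\<integral>\<^sup>+t. ennreal (1 / (x\<^sup>2 + (Y - 2 * t)\<^sup>2)) \<partial>lborel) = ennreal (1 / 4 * (pi / (\<bar>x\<bar> / 2)))"
    by (rule nn_integral_has_bochner) auto
  thus ?thesis by simp
qed

text \<open>For fixed heights and distance the integrand has constant sign in \<open>s\<close>, so
  the integral of its absolute value over \<open>s\<close> is known in closed form. In the variable
  Y = y + y' the integral over \<open>y'\<close> contributes 1/|x|, which cancels the factor |x|,
  and a product of two Poisson kernels remains.\<close>

lemma integrable_two_wheel:
  assumes ab: "(a - b)\<^sup>2 = 1"
  shows "integrable lborel (two_wheel (of_real a) (of_real b))"
proof (rule integrableI_bounded)
  let ?g = "two_wheel (of_real a) (of_real b)"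
  define \<delta> where "\<delta> = a - b"
  have \<delta>: "\<delta>\<^sup>2 = 1" "\<bar>\<delta>\<bar> = 1" using ab by (auto simp: \<delta>_def abs_square_eq_1 power2_eq_1_iff)
  \<comment> \<open>What remains after the \<open>s\<close> integration apart from the factor that
    depends on the difference of the heights.\<close>
  define K where "K Y x = (if Y > 0 then 16 * pi * \<bar>x\<bar> * Y / ((x\<^sup>2 + Y\<^sup>2) * ((x - \<delta>)\<^sup>2 + Y\<^sup>2)) else 0)" for Y x :: real
  have K0: "K Y x \<ge> 0" for Y x by (simp add: K_def)
  have [measurable]: "(\<lambda>q. K (f q) (g q)) \<in> borel_measurable M" if [measurable]: "f \<in> borel_measurable M" "g \<in> borel_measurable M" for f g and M :: "'z measure"
    unfolding K_def by measurable
  have s: "(\<integral>\<^sup>+s. norm (?g (y, y', x, s)) \<partial>lborel) \<le> ennreal (K (y' + y) x * (1 / (x\<^sup>2 + (y' + y - 2 * y')\<^sup>2)))" 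
    if ne: "y' \<noteq> y" for y y' x
  proof (cases "y > 0 \<and> y' > 0")
    case True
    let ?V = "- (16 * pi * (a - b) * x * (y + y') / ((x\<^sup>2 + (y - y')\<^sup>2) * (x\<^sup>2 + (y + y')\<^sup>2) * ((x - (a - b))\<^sup>2 + (y + y')\<^sup>2)))"
    have sg: "norm (?g (y, y', x, s)) = - sgn ((a - b) * x) * ?g (y, y', x, s)" for s
    proof -
      define c where "c = 16 * y * y' / ((x\<^sup>2 + (y - y')\<^sup>2) * (x\<^sup>2 + (y + y')\<^sup>2)) * (1 / (((s + x - a)\<^sup>2 + y\<^sup>2) * ((s - b)\<^sup>2 + y'\<^sup>2)))"
      have c: "c \<ge> 0" using True by (simp add: c_def)
      have "?g (y, y', x, s) = - ((a - b) * x) * c"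
        using True by (simp add: two_wheel_real c_def mult.commute mult.left_commute)
      thus ?thesis using c by (cases "c = 0") (simp_all add: abs_mult sgn_mult abs_sgn mult.assoc)
    qed
    have "has_bochner_integral lborel (\<lambda>s. - sgn ((a - b) * x) * ?g (y, y', x, s)) (- sgn ((a - b) * x) * ?V)"
      using True ne by (intro has_bochner_integral_mult_right has_bochner_integral_two_wheel_s) auto
    hence "(\<integral>\<^sup>+s. norm (?g (y, y', x, s)) \<partial>lborel) = ennreal (- sgn ((a - b) * x) * ?V)"
      unfolding sg by (rule nn_integral_has_bochner) (unfold sg[symmetric], rule norm_ge_zero)
    also have "- sgn ((a - b) * x) * ?V = K (y' + y) x * (1 / (x\<^sup>2 + (y' + y - 2 * y')\<^sup>2))"
    proof -
      have "sgn (\<delta> * x) * (16 * pi * \<delta> * x * Y / (P * Q * R)) = 16 * pi * \<bar>x\<bar> * Y / (Q * R) * (1 / P)" for P Q R Y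
      proof -
        have "sgn (\<delta> * x) * (\<delta> * x) = \<bar>x\<bar>" using \<delta> by (metis abs_mult abs_sgn mult.commute mult_1)
        hence "sgn (\<delta> * x) * (16 * pi * \<delta> * x * Y / (P * Q * R)) = 16 * pi * \<bar>x\<bar> * Y / (P * Q * R)"
          by (metis (no_types, opaque_lifting) mult.assoc mult.left_commute times_divide_eq_right)
        thus ?thesis by (simp add: mult.commute mult.left_commute)
      qed
      thus ?thesis using True by (simp add: K_def \<delta>_def add.commute)
    qed
    finally show ?thesis by simp
  next
    case False
    hence "?g (y, y', x, s) = 0" for s by (auto simp: two_wheel_def)
    thus ?thesis by simp
  qed
  \<comment> \<open>The integral over \<open>y'\<close> extends over the whole line, which only
    enlarges it and makes it an arctangent integral. At x = 0 the kernel \<open>K\<close> is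
    0.\<close>
  have inner: "(\<integral>\<^sup>+y'. ennreal (K Y x * (1 / (x\<^sup>2 + (Y - 2 * y')\<^sup>2))) \<partial>lborel) \<le>
       ennreal (if Y > 0 then 8 * pi\<^sup>2 * Y / ((x\<^sup>2 + Y\<^sup>2) * ((x - \<delta>)\<^sup>2 + Y\<^sup>2)) else 0)" for Y x
  proof (cases "x = 0")
    case False
    have "(\<integral>\<^sup>+y'. ennreal (K Y x * (1 / (x\<^sup>2 + (Y - 2 * y')\<^sup>2))) \<partial>lborel) =
       (\<integral>\<^sup>+y'. ennreal (K Y x) * ennreal (1 / (x\<^sup>2 + (Y - 2 * y')\<^sup>2)) \<partial>lborel)"
      by (intro nn_integral_cong ennreal_mult) (auto simp: K0)
    also have "\<dots> = ennreal (K Y x) * ennreal (pi / (2 * \<bar>x\<bar>))"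
      by (subst nn_integral_cmult) (simp_all add: nn_integral_arctan_affine[OF False])
    also have "\<dots> = ennreal (K Y x * (pi / (2 * \<bar>x\<bar>)))"
      by (intro ennreal_mult[symmetric] K0) simp
    also have "K Y x * (pi / (2 * \<bar>x\<bar>)) = (if Y > 0 then 8 * pi\<^sup>2 * Y / ((x\<^sup>2 + Y\<^sup>2) * ((x - \<delta>)\<^sup>2 + Y\<^sup>2)) else 0)"
    proof -
      have "16 * pi * \<bar>x\<bar> * Y / D * (pi / (2 * \<bar>x\<bar>)) = 8 * pi\<^sup>2 * Y / D" for D
        using False by (simp add: power2_eq_square)
      thus ?thesis by (cases "Y > 0") (simp_all only: K_def if_True if_False mult_zero_left)
    qed
    finally show ?thesis by simp
  qed (simp add: K_def)
  have "(\<integral>\<^sup>+q. norm (?g q) \<partial>lborel) = (\<integral>\<^sup>+y. \<integral>\<^sup>+y'. \<integral>\<^sup>+x. \<integral>\<^sup>+s. norm (?g (y, y', x, s)) \<partial>lborel \<partial>lborel \<partial>lborel \<partial>lborel)"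
    by (rule nn_integral_real4) measurable
  also have "\<dots> \<le> (\<integral>\<^sup>+y. \<integral>\<^sup>+y'. \<integral>\<^sup>+x. ennreal (K (y' + y) x * (1 / (x\<^sup>2 + (y' + y - 2 * y')\<^sup>2))) \<partial>lborel \<partial>lborel \<partial>lborel)"
  proof (rule nn_integral_mono, rule nn_integral_mono_AE)
    fix y
    show "AE y' in lborel. (\<integral>\<^sup>+x. \<integral>\<^sup>+s. norm (?g (y, y', x, s)) \<partial>lborel \<partial>lborel) \<le>
       (\<integral>\<^sup>+x. ennreal (K (y' + y) x * (1 / (x\<^sup>2 + (y' + y - 2 * y')\<^sup>2))) \<partial>lborel)"
      using AE_lborel_singleton[of y] by eventually_elim (intro nn_integral_mono s)
  qed
  also have "\<dots> = (\<integral>\<^sup>+y'. \<integral>\<^sup>+y. \<integral>\<^sup>+x. ennreal (K (y' + y) x * (1 / (x\<^sup>2 + (y' + y - 2 * y')\<^sup>2))) \<partial>lborel \<partial>lborel \<partial>lborel)"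
    by (rule lborel_pair.Fubini') measurable
  also have "\<dots> = (\<integral>\<^sup>+y'. \<integral>\<^sup>+Y. \<integral>\<^sup>+x. ennreal (K Y x * (1 / (x\<^sup>2 + (Y - 2 * y')\<^sup>2))) \<partial>lborel \<partial>lborel \<partial>lborel)"
    by (intro nn_integral_cong nn_integral_shift[symmetric]) measurable
  also have "\<dots> = (\<integral>\<^sup>+Y. \<integral>\<^sup>+y'. \<integral>\<^sup>+x. ennreal (K Y x * (1 / (x\<^sup>2 + (Y - 2 * y')\<^sup>2))) \<partial>lborel \<partial>lborel \<partial>lborel)"
    by (rule lborel_pair.Fubini') measurable
  also have "\<dots> = (\<integral>\<^sup>+Y. \<integral>\<^sup>+x. \<integral>\<^sup>+y'. ennreal (K Y x * (1 / (x\<^sup>2 + (Y - 2 * y')\<^sup>2))) \<partial>lborel \<partial>lborel \<partial>lborel)"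
    by (intro nn_integral_cong lborel_pair.Fubini') measurable
  also have "\<dots> \<le> (\<integral>\<^sup>+Y. \<integral>\<^sup>+x. ennreal (if Y > 0 then 8 * pi\<^sup>2 * Y / ((x\<^sup>2 + Y\<^sup>2) * ((x - \<delta>)\<^sup>2 + Y\<^sup>2)) else 0) \<partial>lborel \<partial>lborel)"
    by (intro nn_integral_mono inner)
  also have "\<dots> < \<infinity>" by (rule nn_integral_poisson_kernels_finite) (auto simp: \<delta>)
  finally show "(\<integral>\<^sup>+q. norm (?g q) \<partial>lborel) < \<infinity>" .
qed measurable

text \<open>Positive and negative \<open>x\<close> contribute with opposite signs, but the Poisson kernel of the point
  \<open>a - b\<close> is larger on its own side.\<close>

lemma integral_two_wheel_neg:
  assumes ab: "(a - b)\<^sup>2 = 1"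
  shows "(\<integral>q. two_wheel (of_real a) (of_real b) q \<partial>lborel) < 0"
proof -
  let ?g = "two_wheel (of_real a) (of_real b)"
  note int = integrable_two_wheel[OF ab]
  define h where "h y y' x = - (16 * pi * (a - b) * x * (y + y') / ((x\<^sup>2 + (y - y')\<^sup>2) * (x\<^sup>2 + (y + y')\<^sup>2) * ((x - (a - b))\<^sup>2 + (y + y')\<^sup>2)))"
    for y y' x :: real
  have z: "?g (y, y', x, s) = 0" if "y \<le> 0 \<or> y' \<le> 0" for y y' x s
    using that by (auto simp: two_wheel_def)
  \<comment> \<open>Folding at x = 0: the odd factor changes sign, and the difference of the two
    kernel values is a positive multiple of (a - b) x, so the total is minus a square times positive
    factors.\<close>
  have hneg: "h y y' x + h y y' (- x) < 0" if "y > 0" "y' > 0" "x \<noteq> 0" "y \<noteq> y'" for y y' x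
  proof -
    define P Q where "P = (x\<^sup>2 + (y - y')\<^sup>2) * (x\<^sup>2 + (y + y')\<^sup>2)" "Q = ((x - (a - b))\<^sup>2 + (y + y')\<^sup>2) * ((- x - (a - b))\<^sup>2 + (y + y')\<^sup>2)"
    have pos: "P > 0" "(x - (a - b))\<^sup>2 + (y + y')\<^sup>2 > 0" "(- x - (a - b))\<^sup>2 + (y + y')\<^sup>2 > 0" "Q > 0"
      using that unfolding P_Q_def by (auto intro!: mult_pos_pos add_nonneg_pos)
    have "h y y' x + h y y' (- x) = - (16 * pi * (a - b) * x * (y + y') / P * (1 / ((x - (a - b))\<^sup>2 + (y + y')\<^sup>2) - 1 / ((- x - (a - b))\<^sup>2 + (y + y')\<^sup>2)))"
      by (simp add: h_def P_Q_def right_diff_distrib mult.assoc)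
    also have "1 / ((x - (a - b))\<^sup>2 + (y + y')\<^sup>2) - 1 / ((- x - (a - b))\<^sup>2 + (y + y')\<^sup>2) = 4 * (a - b) * x / Q"
    proof -
      have "1 / U - 1 / V = (V - U) / (U * V)" if "U > 0" "V > 0" for U V :: real
        using that by (simp add: field_simps)
      moreover have "(- x - (a - b))\<^sup>2 + (y + y')\<^sup>2 - ((x - (a - b))\<^sup>2 + (y + y')\<^sup>2) = 4 * (a - b) * x"
        by (simp add: power2_eq_square algebra_simps)
      ultimately show ?thesis using pos unfolding P_Q_def by metis
    qed
    also have "- (16 * pi * (a - b) * x * (y + y') / P * (4 * (a - b) * x / Q)) = - (64 * pi * ((a - b)\<^sup>2 * x\<^sup>2) * (y + y') / (P * Q))"
      by (simp add: power2_eq_square)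
    also have "\<dots> < 0" using that pos ab by simp
    finally show ?thesis .
  qed
  note F1 = Fubini_lborel[OF int]
  have "AE y in lborel. (y > 0 \<longrightarrow> (\<integral>r. ?g (y, r) \<partial>lborel) < 0) \<and> (y \<le> 0 \<longrightarrow> (\<integral>r. ?g (y, r) \<partial>lborel) = 0)"
    using F1(1)
  proof eventually_elim
    case (elim y)
    note F2 = Fubini_lborel[OF elim]
    have "(\<integral>y'. \<integral>r. ?g (y, y', r) \<partial>lborel \<partial>lborel) < 0" if y: "y > 0"
    proof (rule integral_neg_if_AE)
      show "integrable lborel (\<lambda>y'. \<integral>r. ?g (y, y', r) \<partial>lborel)" by (rule F2(2))
      show "AE y' in lborel. (y' > 0 \<longrightarrow> (\<integral>r. ?g (y, y', r) \<partial>lborel) < 0) \<and> (y' \<le> 0 \<longrightarrow> (\<integral>r. ?g (y, y', r) \<partial>lborel) = 0)"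
        using F2(1) AE_lborel_singleton[of y]
      proof eventually_elim
        case (elim y')
        note F3 = Fubini_lborel[OF elim(1)]
        have "(\<integral>x. \<integral>s. ?g (y, y', x, s) \<partial>lborel \<partial>lborel) < 0" if y': "y' > 0"
        proof -
          have e: "(\<integral>s. ?g (y, y', x, s) \<partial>lborel) = h y y' x" for x
            using has_bochner_integral_two_wheel_s[of y y' a b x] y y' elim(2) by (simp add: h_def has_bochner_integral_iff)
          have ih: "integrable lborel (h y y')" using F3(2) by (simp add: e)
          have ih': "integrable lborel (\<lambda>x. h y y' (- x))"
            using lborel_integrable_real_affine[OF ih, of "-1" 0] by simp
          have eq: "(\<integral>x. h y y' (- x) \<partial>lborel) = (\<integral>x. h y y' x \<partial>lborel)"
            using lborel_integral_real_affine[of "-1" "h y y'" 0] by simp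
          have "integrable lborel (\<lambda>x. indicator {0<..} x *\<^sub>R (h y y' x + h y y' (- x)))"
            by (intro integrable_mult_indicator) (use ih ih' in auto)
          also have "(\<lambda>x. indicator {0<..} x *\<^sub>R (h y y' x + h y y' (- x))) = (\<lambda>x. if x > 0 then h y y' x + h y y' (- x) else 0)"
            by auto
          finally have irest: "integrable lborel (\<lambda>x. if x > 0 then h y y' x + h y y' (- x) else 0)" .
          have "(\<integral>x. h y y' x + h y y' (- x) \<partial>lborel) = 2 * (\<integral>x. h y y' x \<partial>lborel)"
            using ih ih' by (simp add: eq)
          moreover have "(\<integral>x. (if x > 0 then h y y' x + h y y' (- x) else 0) \<partial>lborel) < 0"
          proof (rule integral_neg_if_AE)
            show "integrable lborel (\<lambda>x. if x > 0 then h y y' x + h y y' (- x) else 0)"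
              by (rule irest)
          qed (use hneg[of y y'] y y' elim(2) in auto)
          \<comment> \<open>The folded function is even and negative off 0, so discarding its values
            at negative \<open>x\<close> only increases the integral.\<close>
          moreover have "(\<integral>x. h y y' x + h y y' (- x) \<partial>lborel) \<le> (\<integral>x. (if x > 0 then h y y' x + h y y' (- x) else 0) \<partial>lborel)"
          proof (rule integral_mono_AE)
            show "integrable lborel (\<lambda>x. if x > 0 then h y y' x + h y y' (- x) else 0)"
              by (rule irest)
            show "AE x in lborel. h y y' x + h y y' (- x) \<le> (if x > 0 then h y y' x + h y y' (- x) else 0)"
              using AE_lborel_singleton[of 0] 
              by eventually_elim (use hneg[of y y'] y y' elim(2) in \<open>auto intro: less_imp_le\<close>)
          qed (use ih ih' in auto)
          ultimately show ?thesis by (simp add: e)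
        qed
        thus ?case using F3(3) z[of y y'] by (auto simp: prod.case_eq_if)
      qed
    qed
    moreover have "?g (y, r) = 0" if "y \<le> 0" for r using that z[of y] by (cases r) auto
    ultimately show ?case using F2(3) by auto
  qed
  hence "(\<integral>y. \<integral>r. ?g (y, r) \<partial>lborel \<partial>lborel) < 0"
    by (rule integral_neg_if_AE[OF F1(2)])
  thus ?thesis using F1(3) by simp
qed

section \<open>Four integrals over two heights that cancel in pairs\<close>

lemma FTC_Ioo_nonneg:
  fixes f F :: "real \<Rightarrow> real"
  assumes "a < b"
    and "\<And>x. a < x \<Longrightarrow> x < b \<Longrightarrow> DERIV F x :> f x"
    and "\<And>x. a < x \<Longrightarrow> x < b \<Longrightarrow> isCont f x"
    and "\<And>x. a < x \<Longrightarrow> x < b \<Longrightarrow> 0 \<le> f x"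
    and "(F \<longlongrightarrow> A) (at_right a)" "(F \<longlongrightarrow> B) (at_left b)"
  shows "has_bochner_integral lborel (\<lambda>x. if a < x \<and> x < b then f x else 0) (B - A)"
proof -
  have "has_bochner_integral lborel (\<lambda>x. indicator (einterval a b) x * f x) (B - A)"
    using assms by (intro FTC_einterval_nonneg[where F = F]) (auto simp: ereal_tendsto_simps)
  also have "(\<lambda>x. indicator (einterval a b) x * f x) = (\<lambda>x. if a < x \<and> x < b then f x else 0)"
    by (auto simp: einterval_def indicator_def)
  finally show ?thesis .
qed

lemma FTC_Ioo_integrable:
  fixes f F :: "real \<Rightarrow> real"
  assumes "a < b"
    and "\<And>x. a < x \<Longrightarrow> x < b \<Longrightarrow> DERIV F x :> f x"
    and "\<And>x. a < x \<Longrightarrow> x < b \<Longrightarrow> isCont f x"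
    and "integrable lborel (\<lambda>x. if a < x \<and> x < b then f x else 0)"
    and "(F \<longlongrightarrow> A) (at_right a)" "(F \<longlongrightarrow> B) (at_left b)"
  shows "has_bochner_integral lborel (\<lambda>x. if a < x \<and> x < b then f x else 0) (B - A)"
proof -
  have e: "(\<lambda>x. indicator {a<..<b} x * f x) = (\<lambda>x. if a < x \<and> x < b then f x else 0)"
    by (auto simp: indicator_def)
  have "has_bochner_integral lborel (\<lambda>x. indicator (einterval a b) x * f x) (B - A)"
    using assms by (intro FTC_einterval_integrable[where F = F]) (auto simp: ereal_tendsto_simps e)
  thus ?thesis using e by simp
qed

lemma FTC_Ioi_nonneg:
  fixes f F :: "real \<Rightarrow> real"
  assumes "\<And>x. a < x \<Longrightarrow> DERIV F x :> f x"
    and "\<And>x. a < x \<Longrightarrow> isCont f x"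
    and "\<And>x. a < x \<Longrightarrow> 0 \<le> f x"
    and "(F \<longlongrightarrow> A) (at_right a)" "(F \<longlongrightarrow> B) at_top"
  shows "has_bochner_integral lborel (\<lambda>x. if a < x then f x else 0) (B - A)"
proof -
  have "has_bochner_integral lborel (\<lambda>x. indicator (einterval a \<infinity>) x * f x) (B - A)"
    using assms by (intro FTC_einterval_nonneg[where F = F]) (auto simp: ereal_tendsto_simps)
  also have "(\<lambda>x. indicator (einterval a \<infinity>) x * f x) = (\<lambda>x. if a < x then f x else 0)"
    by (auto simp: einterval_def indicator_def)
  finally show ?thesis .
qed

lemma nn_integral_swap_lborel:
  fixes f :: "real \<times> real \<Rightarrow> ennreal"
  assumes [measurable]: "f \<in> borel_measurable borel"
  shows "(\<integral>\<^sup>+q. f q \<partial>lborel) = (\<integral>\<^sup>+b. \<integral>\<^sup>+a. f (a, b) \<partial>lborel \<partial>lborel)"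
  by (subst nn_integral_lborel_prod, measurable) (rule lborel_pair.Fubini', measurable)

context
  fixes \<eta> :: real
  assumes \<eta>: "\<eta> > 0"
begin

text \<open>Up to a constant factor, the function of the heights a > b left by the horizontal
  integrations of a wheel around the point of height \<eta> is \<open>T1\<close> - \<open>T2\<close>
  - \<open>T3\<close> + \<open>T4\<close>. \<open>T1\<close> lives everywhere, \<open>T2\<close>
  where both heights exceed \<eta>, \<open>T3\<close> where the lower one is below \<eta>, and
  \<open>T4\<close> where both are.\<close>

definition T1 :: "real \<times> real \<Rightarrow> real"
  where "T1 = (\<lambda>(a, b). if 0 < b \<and> b < a then 1 / (a * (a + \<eta>) * (a + b + \<eta>)) else 0)"

definition T2 :: "real \<times> real \<Rightarrow> real"
  where "T2 = (\<lambda>(a, b). if \<eta> < b \<and> b < a then 1 / (a * (a - \<eta>) * (a + b - \<eta>)) else 0)"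

definition T3 :: "real \<times> real \<Rightarrow> real"
  where "T3 = (\<lambda>(a, b). if 0 < b \<and> b < a \<and> b < \<eta> then 1 / (a * (a + \<eta>) * (a - b + \<eta>)) else 0)"

definition T4 :: "real \<times> real \<Rightarrow> real"
  where "T4 = (\<lambda>(a, b). if 0 < b \<and> b < a \<and> a < \<eta> then 2 * b / (a * \<eta> * (\<eta>\<^sup>2 - b\<^sup>2)) else 0)"

lemma T_measurable [measurable]:
  "T1 \<in> borel_measurable borel" "T2 \<in> borel_measurable borel"
  "T3 \<in> borel_measurable borel" "T4 \<in> borel_measurable borel"
  unfolding T1_def T2_def T3_def T4_def split_beta by measurable

lemma T_nonneg: "T1 q \<ge> 0" "T2 q \<ge> 0" "T3 q \<ge> 0" "T4 q \<ge> 0"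
proof -
  have "b\<^sup>2 < \<eta>\<^sup>2" if "0 < b" "b < \<eta>" for b using that by (simp add: power_strict_mono)
  thus "T4 q \<ge> 0" using \<eta> by (auto simp: T4_def split_beta intro!: divide_nonneg_nonneg mult_nonneg_nonneg less_imp_le)
qed (use \<eta> in \<open>auto simp: T1_def T2_def T3_def split_beta intro!: mult_nonneg_nonneg\<close>)

text \<open>A bound that is constant in \<open>b\<close>, integrated over 0 < b < a, gains a factor
  \<open>a\<close> which removes the pole at a = 0 and leaves an arctangent integral.\<close>

lemma nn_integral_T1: "(\<integral>\<^sup>+q. T1 q \<partial>lborel) < \<infinity>"
proof -
  have "(\<integral>\<^sup>+q. T1 q \<partial>lborel) = (\<integral>\<^sup>+a. \<integral>\<^sup>+b. T1 (a, b) \<partial>lborel \<partial>lborel)"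
    by (rule nn_integral_lborel_prod) measurable
  also have "\<dots> \<le> (\<integral>\<^sup>+a. ennreal (1 / ((a + 0)\<^sup>2 + \<eta>\<^sup>2)) \<partial>lborel)"
  proof (rule nn_integral_mono)
    fix a :: real
    show "(\<integral>\<^sup>+b. T1 (a, b) \<partial>lborel) \<le> ennreal (1 / ((a + 0)\<^sup>2 + \<eta>\<^sup>2))"
    proof (cases "a > 0")
      case a: True
      have "(\<integral>\<^sup>+b. T1 (a, b) \<partial>lborel) \<le> (\<integral>\<^sup>+b. ennreal (1 / (a * (a\<^sup>2 + \<eta>\<^sup>2))) * indicator {0<..<a} b \<partial>lborel)"
      proof (rule nn_integral_mono)
        fix b
        show "ennreal (T1 (a, b)) \<le> ennreal (1 / (a * (a\<^sup>2 + \<eta>\<^sup>2))) * indicator {0<..<a} b"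
        proof (cases "0 < b \<and> b < a")
          case True
          have "a\<^sup>2 + \<eta>\<^sup>2 \<le> (a + \<eta>) * (a + b + \<eta>)" using True a \<eta> by (simp add: power2_eq_square algebra_simps)
          hence "a * (a\<^sup>2 + \<eta>\<^sup>2) \<le> a * ((a + \<eta>) * (a + b + \<eta>))" using a by simp
          hence "T1 (a, b) \<le> 1 / (a * (a\<^sup>2 + \<eta>\<^sup>2))"
            using True a \<eta> unfolding T1_def by (auto simp: mult.assoc intro!: divide_left_mono mult_pos_pos add_pos_pos)
          thus ?thesis using True by (simp add: ennreal_leI)
        qed (auto simp: T1_def)
      qed
      also have "\<dots> = ennreal (1 / (a * (a\<^sup>2 + \<eta>\<^sup>2))) * ennreal a"
        using a by (subst nn_integral_cmult_indicator) auto
      also have "\<dots> = ennreal (1 / (a\<^sup>2 + \<eta>\<^sup>2))"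
        using a \<eta> by (subst ennreal_mult[symmetric]) auto
      finally show ?thesis by simp
    next
      case False
      hence "T1 (a, b) = 0" for b by (auto simp: T1_def)
      thus ?thesis by simp
    qed
  qed
  also have "\<dots> = ennreal (pi / \<eta>)"
    by (intro nn_integral_has_bochner has_bochner_integral_arctan \<eta>) auto
  also have "\<dots> < \<infinity>" by simp
  finally show ?thesis .
qed

text \<open>Translating both heights by \<eta> carries \<open>T2\<close> to
  \<open>T1\<close>.\<close>

lemma nn_integral_T2: "(\<integral>\<^sup>+q. T2 q \<partial>lborel) = (\<integral>\<^sup>+q. T1 q \<partial>lborel)"
proof -
  have "(\<integral>\<^sup>+q. T2 q \<partial>lborel) = (\<integral>\<^sup>+a. \<integral>\<^sup>+b. T2 (a, b) \<partial>lborel \<partial>lborel)"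
    by (rule nn_integral_lborel_prod) measurable
  also have "\<dots> = (\<integral>\<^sup>+a. \<integral>\<^sup>+b. T2 (\<eta> + a, b) \<partial>lborel \<partial>lborel)"
    by (rule nn_integral_shift) measurable
  also have "\<dots> = (\<integral>\<^sup>+a. \<integral>\<^sup>+b. T2 (\<eta> + a, \<eta> + b) \<partial>lborel \<partial>lborel)"
    by (intro nn_integral_cong nn_integral_shift) measurable
  also have "\<dots> = (\<integral>\<^sup>+a. \<integral>\<^sup>+b. T1 (a, b) \<partial>lborel \<partial>lborel)"
    by (intro nn_integral_cong arg_cong[of _ _ ennreal]) (auto simp: T1_def T2_def algebra_simps)
  also have "\<dots> = (\<integral>\<^sup>+q. T1 q \<partial>lborel)"
    by (rule nn_integral_lborel_prod[symmetric]) measurable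
  finally show ?thesis .
qed

text \<open>\<open>t3\<close> and \<open>t4\<close> are the integrals of \<open>T3\<close> and
  \<open>T4\<close> over the larger height.\<close>

definition t3 :: "real \<Rightarrow> real"
  where "t3 b = - (ln (b / \<eta>) / (\<eta> * (\<eta> - b)) + ln (1 + b / \<eta>) / (\<eta> * b))"

definition t4 :: "real \<Rightarrow> real"
  where "t4 b = - (2 * b * ln (b / \<eta>) / (\<eta> * (\<eta>\<^sup>2 - b\<^sup>2)))"

lemma has_bochner_integral_T3:
  assumes "0 < b" "b < \<eta>"
  shows "has_bochner_integral lborel (\<lambda>a. T3 (a, b)) (t3 b)"
proof -
  let ?F = "\<lambda>a. ln (a / \<eta>) / (\<eta> * (\<eta> - b)) + ln ((a + \<eta>) / \<eta>) / (\<eta> * b) - ln ((a - b + \<eta>) / \<eta>) / (b * (\<eta> - b))"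
  have "has_bochner_integral lborel (\<lambda>a. if b < a then 1 / (a * (a + \<eta>) * (a - b + \<eta>)) else 0) (0 - ?F b)"
  proof (rule FTC_Ioi_nonneg)
    fix a assume a: "b < a"
    show "DERIV ?F a :> 1 / (a * (a + \<eta>) * (a - b + \<eta>))"
    proof -
      have "DERIV ?F a :> 1 / a / (\<eta> * (\<eta> - b)) + 1 / (a + \<eta>) / (\<eta> * b) - 1 / (a - b + \<eta>) / (b * (\<eta> - b))"
        using a assms by (auto intro!: derivative_eq_intros)
      also have "1 / a / (\<eta> * (\<eta> - b)) + 1 / (a + \<eta>) / (\<eta> * b) - 1 / (a - b + \<eta>) / (b * (\<eta> - b)) = 1 / (a * (a + \<eta>) * (a - b + \<eta>))"
      proof -
        have "a \<noteq> 0" "a + \<eta> \<noteq> 0" "a - b + \<eta> \<noteq> 0" "b \<noteq> 0" "\<eta> - b \<noteq> 0" "\<eta> \<noteq> 0" using a assms by auto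
        thus ?thesis by (simp add: divide_simps) (simp add: algebra_simps)
      qed
      finally show ?thesis .
    qed
    show "isCont (\<lambda>a. 1 / (a * (a + \<eta>) * (a - b + \<eta>))) a"
      using a assms by (intro continuous_intros) auto
    show "0 \<le> 1 / (a * (a + \<eta>) * (a - b + \<eta>))" using a assms by auto
  next
    have "isCont ?F b" using assms by (intro continuous_intros) auto
    thus "(?F \<longlongrightarrow> ?F b) (at_right b)" by (simp add: isCont_def filterlim_at_split)
    \<comment> \<open>The coefficients of the three logarithms add up to 0, so the primitive stays
      bounded and tends to 0 at infinity.\<close>
    have c: "1 / (\<eta> * (\<eta> - b)) + 1 / (\<eta> * b) - 1 / (b * (\<eta> - b)) = 0"
      using assms by (simp add: divide_simps)
    have "((\<lambda>a. ln (a / \<eta>) * (1 / (\<eta> * (\<eta> - b)) + 1 / (\<eta> * b) - 1 / (b * (\<eta> - b))) 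
       + (ln ((a + \<eta>) / \<eta>) - ln (a / \<eta>)) / (\<eta> * b) - (ln ((a - b + \<eta>) / \<eta>) - ln (a / \<eta>)) / (b * (\<eta> - b))) \<longlongrightarrow> 0 + 0 / (\<eta> * b) - 0 / (b * (\<eta> - b))) at_top"
      unfolding c mult_zero_right 
      by (intro tendsto_intros) (use \<eta> assms in \<open>auto, (real_asymp)+\<close>)
    thus "(?F \<longlongrightarrow> 0) at_top" by (simp add: diff_divide_distrib algebra_simps)
  qed
  also have "0 - ?F b = t3 b"
    using assms by (simp add: t3_def add_divide_distrib add.commute)
  also have "(\<lambda>a. if b < a then 1 / (a * (a + \<eta>) * (a - b + \<eta>)) else 0) = (\<lambda>a. T3 (a, b))"
    using assms by (auto simp: T3_def)
  finally show ?thesis .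
qed

lemma has_bochner_integral_T4:
  assumes "0 < b" "b < \<eta>"
  shows "has_bochner_integral lborel (\<lambda>a. T4 (a, b)) (t4 b)"
proof -
  have sq: "b\<^sup>2 < \<eta>\<^sup>2" using assms by (simp add: power_strict_mono)
  let ?c = "2 * b / (\<eta> * (\<eta>\<^sup>2 - b\<^sup>2))"
  have "has_bochner_integral lborel (\<lambda>a. ?c * (if b < a \<and> a < \<eta> then 1 / a else 0)) (?c * (ln \<eta> - ln b))"
  proof (intro has_bochner_integral_mult_right FTC_Ioo_nonneg)
    fix a assume a: "b < a" "a < \<eta>"
    show "DERIV ln a :> 1 / a" "isCont (\<lambda>a. 1 / a) a" "0 \<le> 1 / a" 
      using a assms by (auto intro!: derivative_eq_intros continuous_intros)
  next
    have "isCont ln b" "isCont ln \<eta>" using assms by (auto intro!: continuous_intros)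
    thus "(ln \<longlongrightarrow> ln b) (at_right b)" "(ln \<longlongrightarrow> ln \<eta>) (at_left \<eta>)" by (simp_all add: isCont_def filterlim_at_split)
  qed (use assms in auto)
  also have "?c * (ln \<eta> - ln b) = t4 b"
    using assms by (simp add: t4_def ln_div right_diff_distrib diff_divide_distrib)
  also have "(\<lambda>a. ?c * (if b < a \<and> a < \<eta> then 1 / a else 0)) = (\<lambda>a. T4 (a, b))"
    using assms by (auto simp: T4_def)
  finally show ?thesis .
qed

text \<open>The integrand is the derivative of ln(b/\<eta>) ln(1 + b/\<eta>) / \<eta>. This product
  vanishes at both ends: at \<eta> through the first factor, at 0 because the second factor is of
  order b.\<close>

lemma integrable_t4_minus_t3:
  "has_bochner_integral lborel (\<lambda>b. if 0 < b \<and> b < \<eta> then ln (b / \<eta>) / (\<eta> * (\<eta> + b)) + ln (1 + b / \<eta>) / (\<eta> * b) else 0) 0"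
proof -
  let ?f = "\<lambda>b. ln (b / \<eta>) / (\<eta> * (\<eta> + b)) + ln (1 + b / \<eta>) / (\<eta> * b)"
  have ln_int: "has_bochner_integral lborel (\<lambda>b. if 0 < b \<and> b < \<eta> then - ln (b / \<eta>) else 0) (\<eta> - 0)"
  proof (rule FTC_Ioo_nonneg)
    fix b assume b: "0 < b" "b < \<eta>"
    show "DERIV (\<lambda>b. b - b * ln (b / \<eta>)) b :> - ln (b / \<eta>)"
      using b by (auto intro!: derivative_eq_intros)
    show "isCont (\<lambda>b. - ln (b / \<eta>)) b" using b by (intro continuous_intros) auto
    show "0 \<le> - ln (b / \<eta>)" using b by simp
  next
    show "((\<lambda>b. b - b * ln (b / \<eta>)) \<longlongrightarrow> 0) (at_right 0)" using \<eta> by real_asymp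
    have "isCont (\<lambda>b. b - b * ln (b / \<eta>)) \<eta>" using \<eta> by (intro continuous_intros) auto
    hence "((\<lambda>b. b - b * ln (b / \<eta>)) \<longlongrightarrow> \<eta> - \<eta> * ln (\<eta> / \<eta>)) (at_left \<eta>)" by (simp add: isCont_def filterlim_at_split)
    thus "((\<lambda>b. b - b * ln (b / \<eta>)) \<longlongrightarrow> \<eta>) (at_left \<eta>)" using \<eta> by simp
  qed (use \<eta> in auto)
  have int: "integrable lborel (\<lambda>b. if 0 < b \<and> b < \<eta> then ?f b else 0)"
  proof (rule Bochner_Integration.integrable_bound)
    show "integrable lborel (\<lambda>b. (if 0 < b \<and> b < \<eta> then - ln (b / \<eta>) else 0) * (1 / \<eta>\<^sup>2) + indicator {0<..<\<eta>} b * (1 / \<eta>\<^sup>2))"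
      using ln_int by (intro Bochner_Integration.integrable_add integrable_mult_left integrable_real_indicator)
        (use \<eta> in \<open>auto simp: has_bochner_integral_iff less_imp_le\<close>)
    show "AE b in lborel. norm (if 0 < b \<and> b < \<eta> then ?f b else 0)
       \<le> norm ((if 0 < b \<and> b < \<eta> then - ln (b / \<eta>) else 0) * (1 / \<eta>\<^sup>2) + indicator {0<..<\<eta>} b * (1 / \<eta>\<^sup>2))"
    proof (rule AE_I2)
      fix b
      show "norm (if 0 < b \<and> b < \<eta> then ?f b else 0)
       \<le> norm ((if 0 < b \<and> b < \<eta> then - ln (b / \<eta>) else 0) * (1 / \<eta>\<^sup>2) + indicator {0<..<\<eta>} b * (1 / \<eta>\<^sup>2))"
      proof (cases "0 < b \<and> b < \<eta>")
        case True
        have l: "- ln (b / \<eta>) \<ge> 0" using True by simp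
        have "\<bar>ln (b / \<eta>) / (\<eta> * (\<eta> + b))\<bar> = - ln (b / \<eta>) * (1 / (\<eta> * (\<eta> + b)))"
          using l True \<eta> by (simp add: abs_divide)
        also have "\<dots> \<le> - ln (b / \<eta>) * (1 / \<eta>\<^sup>2)"
          using True \<eta> l by (intro mult_left_mono divide_left_mono) (auto simp: power2_eq_square)
        finally have 1: "\<bar>ln (b / \<eta>) / (\<eta> * (\<eta> + b))\<bar> \<le> - ln (b / \<eta>) * (1 / \<eta>\<^sup>2)" .
        have "0 \<le> ln (1 + b / \<eta>)" using True \<eta> by simp
        moreover have "ln (1 + b / \<eta>) / (\<eta> * b) \<le> (b / \<eta>) / (\<eta> * b)"
          using True \<eta> by (intro divide_right_mono ln_add_one_self_le_self) auto
        ultimately have 2: "\<bar>ln (1 + b / \<eta>) / (\<eta> * b)\<bar> \<le> 1 / \<eta>\<^sup>2"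
          using True \<eta> by (simp add: abs_divide power2_eq_square)
        have "0 \<le> - ln (b / \<eta>) * (1 / \<eta>\<^sup>2)" using l by (intro mult_nonneg_nonneg) auto
        note p = this
        have "norm (- ln (b / \<eta>) * (1 / \<eta>\<^sup>2) + 1 / \<eta>\<^sup>2) = - ln (b / \<eta>) * (1 / \<eta>\<^sup>2) + 1 / \<eta>\<^sup>2"
          unfolding real_norm_def by (rule abs_of_nonneg, rule add_nonneg_nonneg[OF p]) simp
        moreover have "norm (?f b) \<le> - ln (b / \<eta>) * (1 / \<eta>\<^sup>2) + 1 / \<eta>\<^sup>2"
          unfolding real_norm_def using 1 2 by linarith
        ultimately show ?thesis using True by simp
      qed auto
    qed
  qed simp
  have "has_bochner_integral lborel (\<lambda>b. if 0 < b \<and> b < \<eta> then ?f b else 0) (0 - 0)"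
  proof (rule FTC_Ioo_integrable)
    let ?F = "\<lambda>b. 1 / \<eta> * (ln (b / \<eta>) * ln (1 + b / \<eta>))"
    fix b assume b: "0 < b" "b < \<eta>"
    have "0 < 1 + b / \<eta>" using b by (simp add: add_pos_pos)
    hence "DERIV ?F b :> 1 / \<eta> * (1 / b * ln (1 + b / \<eta>) + ln (b / \<eta>) * (1 / \<eta> / (1 + b / \<eta>)))"
      using b by (auto intro!: derivative_eq_intros)
    moreover have "1 / \<eta> / (1 + b / \<eta>) = 1 / (\<eta> + b)" using b by (simp add: divide_simps)
    ultimately show "DERIV ?F b :> ?f b" by (simp add: algebra_simps)
    show "isCont ?f b" using b \<open>0 < 1 + b / \<eta>\<close> by (intro continuous_intros) auto
  next
    show "((\<lambda>b. 1 / \<eta> * (ln (b / \<eta>) * ln (1 + b / \<eta>))) \<longlongrightarrow> 0) (at_right 0)" using \<eta> by real_asymp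
    have "isCont (\<lambda>b. 1 / \<eta> * (ln (b / \<eta>) * ln (1 + b / \<eta>))) \<eta>" using \<eta> by (intro continuous_intros) auto
    hence "((\<lambda>b. 1 / \<eta> * (ln (b / \<eta>) * ln (1 + b / \<eta>))) \<longlongrightarrow> 1 / \<eta> * (ln (\<eta> / \<eta>) * ln (1 + \<eta> / \<eta>))) (at_left \<eta>)"
      by (simp add: isCont_def filterlim_at_split)
    thus "((\<lambda>b. 1 / \<eta> * (ln (b / \<eta>) * ln (1 + b / \<eta>))) \<longlongrightarrow> 0) (at_left \<eta>)" using \<eta> by simp
  qed (use \<eta> int in auto)
  thus ?thesis by simp
qed

lemma t4_minus_t3:
  assumes "0 < b" "b < \<eta>"
  shows "t4 b - t3 b = ln (b / \<eta>) / (\<eta> * (\<eta> + b)) + ln (1 + b / \<eta>) / (\<eta> * b)"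
proof -
  have f: "\<eta>\<^sup>2 - b\<^sup>2 = (\<eta> - b) * (\<eta> + b)" by (simp add: algebra_simps power2_eq_square)
  have "\<eta> - b \<noteq> 0" "\<eta> + b \<noteq> 0" "\<eta> \<noteq> 0" using assms by auto
  hence "L / (\<eta> * (\<eta> - b)) - 2 * b * L / (\<eta> * ((\<eta> - b) * (\<eta> + b))) = L / (\<eta> * (\<eta> + b))" for L
    by (simp add: divide_simps) (simp add: algebra_simps)
  from this[of "ln (b / \<eta>)"] show ?thesis by (simp add: t3_def t4_def f)
qed

lemma t4_bounds:
  assumes "0 < b" "b < \<eta>"
  shows "0 \<le> t4 b" "t4 b \<le> 2 / \<eta>\<^sup>2"
proof -
  have f: "\<eta>\<^sup>2 - b\<^sup>2 = (\<eta> - b) * (\<eta> + b)" by (simp add: algebra_simps power2_eq_square)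
  have l0: "- ln (b / \<eta>) \<ge> 0" using assms by simp
  \<comment> \<open>The estimate ln z \<le> z - 1 at z = \<eta>/b yields a factor \<eta> - b that
    cancels the apparent pole at b = \<eta>.\<close>
  have "- ln (b / \<eta>) = ln (\<eta> / b)" using assms by (simp add: ln_div)
  also have "\<dots> \<le> \<eta> / b - 1" using assms by (intro ln_le_minus_one) auto
  finally have l1: "- ln (b / \<eta>) \<le> (\<eta> - b) / b" using assms by (simp add: diff_divide_distrib)
  have t4: "t4 b = 2 * b / (\<eta> * ((\<eta> - b) * (\<eta> + b))) * (- ln (b / \<eta>))"
    by (simp add: t4_def f)
  have c: "0 \<le> 2 * b / (\<eta> * ((\<eta> - b) * (\<eta> + b)))" using assms by simp
  show "0 \<le> t4 b" unfolding t4 using c l0 by (rule mult_nonneg_nonneg)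
  have "t4 b \<le> 2 * b / (\<eta> * ((\<eta> - b) * (\<eta> + b))) * ((\<eta> - b) / b)"
    unfolding t4 using l1 c by (rule mult_left_mono)
  also have "\<dots> = 2 / (\<eta> * (\<eta> + b))" using assms by (simp add: divide_simps)
  also have "\<dots> \<le> 2 / \<eta>\<^sup>2" using assms \<eta> by (intro divide_left_mono) (auto simp: power2_eq_square)
  finally show "t4 b \<le> 2 / \<eta>\<^sup>2" .
qed

lemma integrable_t4: "integrable lborel (\<lambda>b. if 0 < b \<and> b < \<eta> then t4 b else 0)"
proof (rule Bochner_Integration.integrable_bound)
  show "integrable lborel (\<lambda>b. indicator {0<..<\<eta>} b * (2 / \<eta>\<^sup>2))"
    by (intro integrable_mult_left integrable_real_indicator) (use \<eta> in \<open>auto simp: less_imp_le\<close>)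
  show "(\<lambda>b. if 0 < b \<and> b < \<eta> then t4 b else 0) \<in> borel_measurable lborel"
    unfolding t4_def by measurable
qed (use t4_bounds in auto)

lemma has_bochner_integral_t34:
  "has_bochner_integral lborel (\<lambda>b. if 0 < b \<and> b < \<eta> then t4 b else 0) (\<integral>b. (if 0 < b \<and> b < \<eta> then t4 b else 0) \<partial>lborel)"
  "has_bochner_integral lborel (\<lambda>b. if 0 < b \<and> b < \<eta> then t3 b else 0) (\<integral>b. (if 0 < b \<and> b < \<eta> then t4 b else 0) \<partial>lborel)"
proof -
  show *: "has_bochner_integral lborel (\<lambda>b. if 0 < b \<and> b < \<eta> then t4 b else 0) (\<integral>b. (if 0 < b \<and> b < \<eta> then t4 b else 0) \<partial>lborel)"
    using integrable_t4 by (simp add: has_bochner_integral_iff)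
  have "has_bochner_integral lborel (\<lambda>b. (if 0 < b \<and> b < \<eta> then t4 b else 0)
     - (if 0 < b \<and> b < \<eta> then ln (b / \<eta>) / (\<eta> * (\<eta> + b)) + ln (1 + b / \<eta>) / (\<eta> * b) else 0))
     ((\<integral>b. (if 0 < b \<and> b < \<eta> then t4 b else 0) \<partial>lborel) - 0)"
    by (intro has_bochner_integral_diff * integrable_t4_minus_t3)
  also have "(\<lambda>b. (if 0 < b \<and> b < \<eta> then t4 b else 0)
     - (if 0 < b \<and> b < \<eta> then ln (b / \<eta>) / (\<eta> * (\<eta> + b)) + ln (1 + b / \<eta>) / (\<eta> * b) else 0))
     = (\<lambda>b. if 0 < b \<and> b < \<eta> then t3 b else 0)"
    by (auto simp: fun_eq_iff t4_minus_t3[symmetric])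
  finally show "has_bochner_integral lborel (\<lambda>b. if 0 < b \<and> b < \<eta> then t3 b else 0) (\<integral>b. (if 0 < b \<and> b < \<eta> then t4 b else 0) \<partial>lborel)"
    by simp
qed

lemma nn_integral_T34:
  "(\<integral>\<^sup>+q. T3 q \<partial>lborel) = (\<integral>\<^sup>+q. T4 q \<partial>lborel)" "(\<integral>\<^sup>+q. T4 q \<partial>lborel) < \<infinity>"
proof -
  have t3: "t3 b \<ge> 0" if "0 < b" "b < \<eta>" for b
  proof -
    have "0 \<le> (\<integral>a. T3 (a, b) \<partial>lborel)" by (rule integral_nonneg_AE) (simp add: T_nonneg)
    thus ?thesis using has_bochner_integral_integral_eq[OF has_bochner_integral_T3[OF that]] by simp
  qed
  have "(\<integral>\<^sup>+a. T3 (a, b) \<partial>lborel) = ennreal (if 0 < b \<and> b < \<eta> then t3 b else 0)" for b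
  proof (cases "0 < b \<and> b < \<eta>")
    case True
    thus ?thesis using nn_integral_has_bochner[OF has_bochner_integral_T3[of b]] T_nonneg(3) by simp
  next
    case False
    hence "T3 (a, b) = 0" for a by (auto simp: T3_def)
    thus ?thesis using False by auto
  qed
  moreover have "(\<integral>\<^sup>+q. T3 q \<partial>lborel) = (\<integral>\<^sup>+b. \<integral>\<^sup>+a. T3 (a, b) \<partial>lborel \<partial>lborel)"
    by (rule nn_integral_swap_lborel) measurable
  ultimately have "(\<integral>\<^sup>+q. T3 q \<partial>lborel) = (\<integral>\<^sup>+b. ennreal (if 0 < b \<and> b < \<eta> then t3 b else 0) \<partial>lborel)"
    by simp
  also have "\<dots> = ennreal (\<integral>b. (if 0 < b \<and> b < \<eta> then t4 b else 0) \<partial>lborel)"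
    by (intro nn_integral_has_bochner has_bochner_integral_t34) (use t3 in auto)
  finally have 3: "(\<integral>\<^sup>+q. T3 q \<partial>lborel) = ennreal (\<integral>b. (if 0 < b \<and> b < \<eta> then t4 b else 0) \<partial>lborel)" .
  have "(\<integral>\<^sup>+a. T4 (a, b) \<partial>lborel) = ennreal (if 0 < b \<and> b < \<eta> then t4 b else 0)" for b
  proof (cases "0 < b \<and> b < \<eta>")
    case True
    thus ?thesis using nn_integral_has_bochner[OF has_bochner_integral_T4[of b]] T_nonneg(4) by simp
  next
    case False
    hence "T4 (a, b) = 0" for a by (auto simp: T4_def)
    thus ?thesis using False by auto
  qed
  moreover have "(\<integral>\<^sup>+q. T4 q \<partial>lborel) = (\<integral>\<^sup>+b. \<integral>\<^sup>+a. T4 (a, b) \<partial>lborel \<partial>lborel)"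
    by (rule nn_integral_swap_lborel) measurable
  ultimately have "(\<integral>\<^sup>+q. T4 q \<partial>lborel) = (\<integral>\<^sup>+b. ennreal (if 0 < b \<and> b < \<eta> then t4 b else 0) \<partial>lborel)"
    by simp
  also have "\<dots> = ennreal (\<integral>b. (if 0 < b \<and> b < \<eta> then t4 b else 0) \<partial>lborel)"
    by (intro nn_integral_has_bochner has_bochner_integral_t34) (use t4_bounds in auto)
  finally have 4: "(\<integral>\<^sup>+q. T4 q \<partial>lborel) = ennreal (\<integral>b. (if 0 < b \<and> b < \<eta> then t4 b else 0) \<partial>lborel)" .
  show "(\<integral>\<^sup>+q. T3 q \<partial>lborel) = (\<integral>\<^sup>+q. T4 q \<partial>lborel)" "(\<integral>\<^sup>+q. T4 q \<partial>lborel) < \<infinity>"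
    unfolding 3 4 by simp_all
qed

definition rim_total :: "real \<times> real \<Rightarrow> real"
  where "rim_total q = T1 q - T2 q - T3 q + T4 q"

text \<open>\<open>T1\<close> cancels against \<open>T2\<close>, and \<open>T3\<close> against
  \<open>T4\<close>. Finiteness of the nonnegative integrals makes the subtraction
  legitimate.\<close>

lemma has_bochner_integral_rim_total: "has_bochner_integral lborel rim_total 0"
proof -
  have i: "integrable lborel T1" "integrable lborel T2" "integrable lborel T3" "integrable lborel T4"
    using nn_integral_T1 nn_integral_T2 nn_integral_T34
    by (auto intro!: integrableI_nonneg simp: T_nonneg)
  have e: "integral\<^sup>L lborel T1 = integral\<^sup>L lborel T2" "integral\<^sup>L lborel T3 = integral\<^sup>L lborel T4"
    by (simp_all add: integral_eq_nn_integral T_nonneg nn_integral_T2 nn_integral_T34)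
  show ?thesis
    unfolding rim_total_def has_bochner_integral_iff using i e by auto
qed

end

section \<open>The two-wheel with both spokes to an interior point\<close>

context
  fixes \<eta> :: real
  assumes \<eta>: "\<eta> > 0"
begin

text \<open>\<open>g\<close> and \<open>h\<close> are heights of the spoke target or of its mirror
  image in the real axis. The signs arise when (y - g) and (y' - h) are divided by their absolute
  values in the integration over \<open>s\<close>.\<close>

definition wheel_coeff :: "real \<Rightarrow> real \<Rightarrow> real \<Rightarrow> real \<Rightarrow> real"
  where "wheel_coeff y y' g h = g * sgn (y' - h) + h * sgn (y - g)"

lemma sum_pm: "(\<Sum>g\<in>{\<eta>, - \<eta>}. F g) = F \<eta> + (F (- \<eta>) :: real)"
  using \<eta> by simp

text \<open>Each spoke is the sum of a term for the target and one for its mirror image, which gives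
  four products. Writing x as (s + x) - s in the bracket of \<open>wheel\<close> cancels the terms
  quadratic in the spokes' vertical parts and leaves the two numerators \<open>s\<close> and
  \<open>s + x\<close>.\<close>

lemma two_wheel_interior:
  assumes "y > 0" "y' > 0"
  shows "two_wheel (Complex 0 \<eta>) (Complex 0 \<eta>) (y, y', x, s) =
    (\<Sum>g\<in>{\<eta>, - \<eta>}. \<Sum>h\<in>{\<eta>, - \<eta>}. - 4 * x / ((x\<^sup>2 + (y - y')\<^sup>2) * (x\<^sup>2 + (y + y')\<^sup>2)) *
      (h * (y - g) * (s / (((s + x)\<^sup>2 + \<bar>y - g\<bar>\<^sup>2) * (s\<^sup>2 + \<bar>y' - h\<bar>\<^sup>2)))
       - g * (y' - h) * ((s + x) / (((s + x)\<^sup>2 + \<bar>y - g\<bar>\<^sup>2) * (s\<^sup>2 + \<bar>y' - h\<bar>\<^sup>2)))))"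
proof -
  define u1 u2 v1 v2 where uv: "u1 = 1 / ((s + x)\<^sup>2 + (y - \<eta>)\<^sup>2)" "u2 = 1 / ((s + x)\<^sup>2 + (y + \<eta>)\<^sup>2)"
     "v1 = 1 / (s\<^sup>2 + (y' - \<eta>)\<^sup>2)" "v2 = 1 / (s\<^sup>2 + (y' + \<eta>)\<^sup>2)"
  define D where "D = (x\<^sup>2 + (y - y')\<^sup>2) * (x\<^sup>2 + (y + y')\<^sup>2)"
  have sp: "spoke (Complex 0 \<eta>) (Complex (s + x) y) = ((s + x) * u1 + (s + x) * u2, (y - \<eta>) * u1 + (y + \<eta>) * u2)"
      "spoke (Complex 0 \<eta>) (Complex s y') = (s * v1 + s * v2, (y' - \<eta>) * v1 + (y' + \<eta>) * v2)"
    by (simp_all add: spoke_eq uv)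
  have f: "a / (((s + x)\<^sup>2 + \<bar>y - \<eta>\<bar>\<^sup>2) * (s\<^sup>2 + \<bar>y' - \<eta>\<bar>\<^sup>2)) = a * (u1 * v1)"
     "a / (((s + x)\<^sup>2 + \<bar>y - - \<eta>\<bar>\<^sup>2) * (s\<^sup>2 + \<bar>y' - \<eta>\<bar>\<^sup>2)) = a * (u2 * v1)"
     "a / (((s + x)\<^sup>2 + \<bar>y - \<eta>\<bar>\<^sup>2) * (s\<^sup>2 + \<bar>y' - - \<eta>\<bar>\<^sup>2)) = a * (u1 * v2)"
     "a / (((s + x)\<^sup>2 + \<bar>y - - \<eta>\<bar>\<^sup>2) * (s\<^sup>2 + \<bar>y' - - \<eta>\<bar>\<^sup>2)) = a * (u2 * v2)" for a
    by (simp_all add: uv)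
  have L: "two_wheel (Complex 0 \<eta>) (Complex 0 \<eta>) (y, y', x, s) = - 4 * x / D *
    (((y - \<eta>) * u1 + (y + \<eta>) * u2) * ((y' - \<eta>) * v1 + (y' + \<eta>) * v2) * x
     + ((y - \<eta>) * u1 + (y + \<eta>) * u2) * (s * v1 + s * v2) * y'
     - ((s + x) * u1 + (s + x) * u2) * ((y' - \<eta>) * v1 + (y' + \<eta>) * v2) * y)"
    using assms by (simp add: two_wheel_def wheel_def sp D_def)
  have ne: "\<eta> \<noteq> - \<eta>" using \<eta> by simp
  show ?thesis
    unfolding sum_pm f D_def[symmetric] L by (simp add: algebra_simps)
qed

lemma has_bochner_integral_two_wheel_interior_s:
  assumes y: "y > 0" "y' > 0" "y \<noteq> \<eta>" "y' \<noteq> \<eta>" and x: "x \<noteq> 0"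
  shows "has_bochner_integral lborel (\<lambda>s. two_wheel (Complex 0 \<eta>) (Complex 0 \<eta>) (y, y', x, s))
    (\<Sum>g\<in>{\<eta>, - \<eta>}. \<Sum>h\<in>{\<eta>, - \<eta>}. 4 * pi * wheel_coeff y y' g h *
      (x\<^sup>2 / ((x\<^sup>2 + \<bar>y - y'\<bar>\<^sup>2) * (x\<^sup>2 + (y + y')\<^sup>2) * (x\<^sup>2 + (\<bar>y - g\<bar> + \<bar>y' - h\<bar>)\<^sup>2))))"
proof -
  have "has_bochner_integral lborel
     (\<lambda>s. - 4 * x / ((x\<^sup>2 + (y - y')\<^sup>2) * (x\<^sup>2 + (y + y')\<^sup>2)) *
      (h * (y - g) * (s / (((s + x)\<^sup>2 + \<bar>y - g\<bar>\<^sup>2) * (s\<^sup>2 + \<bar>y' - h\<bar>\<^sup>2)))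
       - g * (y' - h) * ((s + x) / (((s + x)\<^sup>2 + \<bar>y - g\<bar>\<^sup>2) * (s\<^sup>2 + \<bar>y' - h\<bar>\<^sup>2)))))
     (4 * pi * wheel_coeff y y' g h *
      (x\<^sup>2 / ((x\<^sup>2 + \<bar>y - y'\<bar>\<^sup>2) * (x\<^sup>2 + (y + y')\<^sup>2) * (x\<^sup>2 + (\<bar>y - g\<bar> + \<bar>y' - h\<bar>)\<^sup>2))))"
    if gh: "g \<in> {\<eta>, - \<eta>}" "h \<in> {\<eta>, - \<eta>}" for g h
  proof -
    have A: "\<bar>y - g\<bar> > 0" and B: "\<bar>y' - h\<bar> > 0" using gh y \<eta> by auto
    let ?C = "x\<^sup>2 + (\<bar>y - g\<bar> + \<bar>y' - h\<bar>)\<^sup>2" and ?D = "(x\<^sup>2 + (y - y')\<^sup>2) * (x\<^sup>2 + (y + y')\<^sup>2)"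
    have "has_bochner_integral lborel
     (\<lambda>s. - 4 * x / ?D *
      (h * (y - g) * (s / (((s + x)\<^sup>2 + \<bar>y - g\<bar>\<^sup>2) * (s\<^sup>2 + \<bar>y' - h\<bar>\<^sup>2)))
       - g * (y' - h) * ((s + x) / (((s + x)\<^sup>2 + \<bar>y - g\<bar>\<^sup>2) * (s\<^sup>2 + \<bar>y' - h\<bar>\<^sup>2)))))
      (- 4 * x / ?D * (h * (y - g) * (- (pi * x / (\<bar>y - g\<bar> * ?C))) - g * (y' - h) * (pi * x / (\<bar>y' - h\<bar> * ?C))))"
      by (intro has_bochner_integral_mult_right has_bochner_integral_diff
           has_bochner_integral_s_div[OF A B] has_bochner_integral_s'_div[OF A B]) (use x in auto)
    also have "- 4 * x / ?D * (h * (y - g) * (- (pi * x / (\<bar>y - g\<bar> * ?C))) - g * (y' - h) * (pi * x / (\<bar>y' - h\<bar> * ?C))) =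
       4 * pi * wheel_coeff y y' g h * (x\<^sup>2 / ((x\<^sup>2 + \<bar>y - y'\<bar>\<^sup>2) * (x\<^sup>2 + (y + y')\<^sup>2) * ?C))"
    proof -
      have sg: "z / \<bar>z\<bar> = sgn z" for z :: real by (simp add: sgn_if)
      have e: "c * z * (d / (\<bar>z\<bar> * E)) = c * d / E * sgn z" for c z d E :: real
        unfolding sg[symmetric] by (simp add: mult.commute mult.left_commute)
      have "h * (y - g) * (- (pi * x / (\<bar>y - g\<bar> * ?C))) - g * (y' - h) * (pi * x / (\<bar>y' - h\<bar> * ?C)) =
         - (h * (pi * x) / ?C * sgn (y - g)) - g * (pi * x) / ?C * sgn (y' - h)"
        using e[of h "y - g" "pi * x" ?C] e[of g "y' - h" "pi * x" ?C] by simp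
      also have "\<dots> = - (pi * x / ?C * wheel_coeff y y' g h)"
        by (simp add: wheel_coeff_def add_divide_distrib algebra_simps)
      finally have "- 4 * x / ?D * (h * (y - g) * (- (pi * x / (\<bar>y - g\<bar> * ?C))) - g * (y' - h) * (pi * x / (\<bar>y' - h\<bar> * ?C))) =
        - 4 * x / ?D * (- (pi * x / ?C * wheel_coeff y y' g h))" by simp
      also have "\<dots> = 4 * pi * wheel_coeff y y' g h * (x\<^sup>2 / (?D * ?C))"
        by (simp add: power2_eq_square mult.commute mult.left_commute)
      finally show ?thesis by simp
    qed
    finally show ?thesis .
  qed
  thus ?thesis
    unfolding two_wheel_interior[OF y(1,2)] by (intro has_bochner_integral_sum)
qed

definition wheel_sum :: "real \<Rightarrow> real \<Rightarrow> real"
  where "wheel_sum y y' = (\<Sum>g\<in>{\<eta>, - \<eta>}. \<Sum>h\<in>{\<eta>, - \<eta>}. wheel_coeff y y' g h /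
     ((\<bar>y - y'\<bar> + (y + y')) * (\<bar>y - y'\<bar> + (\<bar>y - g\<bar> + \<bar>y' - h\<bar>)) * (y + y' + (\<bar>y - g\<bar> + \<bar>y' - h\<bar>))))"

text \<open>Each summand is an instance of \<open>has_bochner_integral_three_poles\<close> with
  poles at the distance of the heights, their sum, and the distance accumulated by the two
  spokes.\<close>

lemma has_bochner_integral_two_wheel_interior_x:
  assumes y: "y > 0" "y' > 0" "y \<noteq> \<eta>" "y' \<noteq> \<eta>" "y \<noteq> y'" "y' \<noteq> \<eta> - y"
  shows "has_bochner_integral lborel (\<lambda>x. \<Sum>g\<in>{\<eta>, - \<eta>}. \<Sum>h\<in>{\<eta>, - \<eta>}. 4 * pi * wheel_coeff y y' g h *
      (x\<^sup>2 / ((x\<^sup>2 + \<bar>y - y'\<bar>\<^sup>2) * (x\<^sup>2 + (y + y')\<^sup>2) * (x\<^sup>2 + (\<bar>y - g\<bar> + \<bar>y' - h\<bar>)\<^sup>2))))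
    (4 * pi\<^sup>2 * wheel_sum y y')"
proof -
  have "has_bochner_integral lborel (\<lambda>x. 4 * pi * wheel_coeff y y' g h *
      (x\<^sup>2 / ((x\<^sup>2 + \<bar>y - y'\<bar>\<^sup>2) * (x\<^sup>2 + (y + y')\<^sup>2) * (x\<^sup>2 + (\<bar>y - g\<bar> + \<bar>y' - h\<bar>)\<^sup>2))))
      (4 * pi\<^sup>2 * (wheel_coeff y y' g h / ((\<bar>y - y'\<bar> + (y + y')) * (\<bar>y - y'\<bar> + (\<bar>y - g\<bar> + \<bar>y' - h\<bar>)) * (y + y' + (\<bar>y - g\<bar> + \<bar>y' - h\<bar>)))))"
    if gh: "g \<in> {\<eta>, - \<eta>}" "h \<in> {\<eta>, - \<eta>}" for g h
  \<comment> \<open>Two of the poles coincide for some positions of the heights relative to \<eta>,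
    but under the assumptions only in terms whose coefficient is 0.\<close>
  proof (cases "wheel_coeff y y' g h = 0")
    case False
    have d: "\<bar>y - y'\<bar> > 0" "y + y' > 0" "\<bar>y - g\<bar> + \<bar>y' - h\<bar> > 0" "\<bar>y - y'\<bar> \<noteq> y + y'"
      using y gh \<eta> by auto
    have "\<bar>y - y'\<bar> \<noteq> \<bar>y - g\<bar> + \<bar>y' - h\<bar>" "y + y' \<noteq> \<bar>y - g\<bar> + \<bar>y' - h\<bar>"
      using gh y \<eta> False by (auto simp: wheel_coeff_def sgn_if abs_if split: if_splits)
    hence "has_bochner_integral lborel (\<lambda>x. 4 * pi * wheel_coeff y y' g h *
      (x\<^sup>2 / ((x\<^sup>2 + \<bar>y - y'\<bar>\<^sup>2) * (x\<^sup>2 + (y + y')\<^sup>2) * (x\<^sup>2 + (\<bar>y - g\<bar> + \<bar>y' - h\<bar>)\<^sup>2))))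
      (4 * pi * wheel_coeff y y' g h * (pi / ((\<bar>y - y'\<bar> + (y + y')) * (\<bar>y - y'\<bar> + (\<bar>y - g\<bar> + \<bar>y' - h\<bar>)) * (y + y' + (\<bar>y - g\<bar> + \<bar>y' - h\<bar>)))))"
      using d by (intro has_bochner_integral_mult_right has_bochner_integral_three_poles) auto
    moreover have "4 * pi * w * (pi / Z) = 4 * pi\<^sup>2 * (w / Z)" for w Z
      by (simp add: power2_eq_square)
    ultimately show ?thesis by (simp only:)
  qed auto
  thus ?thesis
    unfolding wheel_sum_def sum_distrib_left by (intro has_bochner_integral_sum)
qed

lemma wheel_sum_commute: "wheel_sum y y' = wheel_sum y' y"
  unfolding wheel_sum_def 
  by (subst sum.swap) (simp add: wheel_coeff_def abs_minus_commute add.commute mult.commute add.left_commute)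

text \<open>The position of \<eta> relative to the two heights fixes all absolute values and signs,
  and with them which of the four terms survive; the three cases are the ranges on which
  \<open>T2\<close>, \<open>T3\<close> and \<open>T4\<close> are switched on or off.\<close>

lemma wheel_sum_eq_rim_total:
  assumes b: "b > 0" "b < a" "a \<noteq> \<eta>" "b \<noteq> \<eta>"
  shows "wheel_sum a b = - (\<eta> / 4) * rim_total \<eta> (a, b)"
proof -
  have p: "\<bar>a - b\<bar> = a - b" "\<bar>a - - \<eta>\<bar> = a + \<eta>" "\<bar>b - - \<eta>\<bar> = b + \<eta>" "sgn (a - - \<eta>) = 1" "sgn (b - - \<eta>) = 1"
    using assms \<eta> by auto
  have k: "2 * \<eta> / (2 * a * (2 * u) * (2 * v)) = \<eta> / 4 * (1 / (a * u * v))"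
    "- 2 * \<eta> / (2 * a * (2 * u) * (2 * v)) = - (\<eta> / 4) * (1 / (a * u * v))" for u v by simp_all
  have k': "1 / (a * (a - b + \<eta>) * (a + \<eta>)) = 1 / (a * (a + \<eta>) * (a - b + \<eta>))" by simp
  consider "\<eta> < b" | "b < \<eta>" "\<eta> < a" | "a < \<eta>" using assms by linarith
  thus ?thesis
  proof cases
    case 1
    have q: "\<bar>a - \<eta>\<bar> = a - \<eta>" "\<bar>b - \<eta>\<bar> = b - \<eta>" "sgn (a - \<eta>) = 1" "sgn (b - \<eta>) = 1" using 1 assms by auto
    have r: "a - b + (a + b) = 2 * a" "a - b + (a - \<eta> + (b - \<eta>)) = 2 * (a - \<eta>)" "a + b + (a - \<eta> + (b - \<eta>)) = 2 * (a + b - \<eta>)"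
       "a - b + (a + \<eta> + (b + \<eta>)) = 2 * (a + \<eta>)" "a + b + (a + \<eta> + (b + \<eta>)) = 2 * (a + b + \<eta>)"
      by simp_all
    have "wheel_sum a b = 2 * \<eta> / (2 * a * (2 * (a - \<eta>)) * (2 * (a + b - \<eta>))) + - 2 * \<eta> / (2 * a * (2 * (a + \<eta>)) * (2 * (a + b + \<eta>)))"
      unfolding wheel_sum_def sum_pm wheel_coeff_def p q r by simp
    also have "\<dots> = - (\<eta> / 4) * rim_total \<eta> (a, b)"
      unfolding k using 1 assms \<eta> by (simp only: rim_total_def T1_def T2_def T3_def T4_def prod.case) (simp add: right_diff_distrib)
    finally show ?thesis .
  next
    case 2
    have q: "\<bar>a - \<eta>\<bar> = a - \<eta>" "\<bar>b - \<eta>\<bar> = \<eta> - b" "sgn (a - \<eta>) = 1" "sgn (b - \<eta>) = -1" using 2 assms by auto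
    have r: "a - b + (a + b) = 2 * a" "a - b + (a + \<eta> + (\<eta> - b)) = 2 * (a - b + \<eta>)" "a + b + (a + \<eta> + (\<eta> - b)) = 2 * (a + \<eta>)"
       "a - b + (a + \<eta> + (b + \<eta>)) = 2 * (a + \<eta>)" "a + b + (a + \<eta> + (b + \<eta>)) = 2 * (a + b + \<eta>)"
      by simp_all
    have "wheel_sum a b = 2 * \<eta> / (2 * a * (2 * (a - b + \<eta>)) * (2 * (a + \<eta>))) + - 2 * \<eta> / (2 * a * (2 * (a + \<eta>)) * (2 * (a + b + \<eta>)))"
      unfolding wheel_sum_def sum_pm wheel_coeff_def p q r by simp
    also have "\<dots> = - (\<eta> / 4) * rim_total \<eta> (a, b)"
      unfolding k k' using 2 assms \<eta> by (simp only: rim_total_def T1_def T2_def T3_def T4_def prod.case) (simp add: right_diff_distrib)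
    finally show ?thesis .
  next
    case 3
    have q: "\<bar>a - \<eta>\<bar> = \<eta> - a" "\<bar>b - \<eta>\<bar> = \<eta> - b" "sgn (a - \<eta>) = -1" "sgn (b - \<eta>) = -1" using 3 assms by auto
    have r: "a - b + (a + b) = 2 * a" "a - b + (\<eta> - a + (\<eta> - b)) = 2 * (\<eta> - b)" "a + b + (\<eta> - a + (\<eta> - b)) = 2 * \<eta>"
       "a - b + (\<eta> - a + (b + \<eta>)) = 2 * \<eta>" "a + b + (\<eta> - a + (b + \<eta>)) = 2 * (\<eta> + b)"
       "a - b + (a + \<eta> + (\<eta> - b)) = 2 * (a - b + \<eta>)" "a + b + (a + \<eta> + (\<eta> - b)) = 2 * (a + \<eta>)"
       "a - b + (a + \<eta> + (b + \<eta>)) = 2 * (a + \<eta>)" "a + b + (a + \<eta> + (b + \<eta>)) = 2 * (a + b + \<eta>)"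
      by simp_all
    have "wheel_sum a b = - 2 * \<eta> / (2 * a * (2 * (\<eta> - b)) * (2 * \<eta>)) + 2 * \<eta> / (2 * a * (2 * \<eta>) * (2 * (\<eta> + b)))
       + 2 * \<eta> / (2 * a * (2 * (a - b + \<eta>)) * (2 * (a + \<eta>))) + - 2 * \<eta> / (2 * a * (2 * (a + \<eta>)) * (2 * (a + b + \<eta>)))"
      unfolding wheel_sum_def sum_pm wheel_coeff_def p q r by simp
    also have "- 2 * \<eta> / (2 * a * (2 * (\<eta> - b)) * (2 * \<eta>)) + 2 * \<eta> / (2 * a * (2 * \<eta>) * (2 * (\<eta> + b))) =
       - (\<eta> / 4) * (2 * b / (a * \<eta> * (\<eta>\<^sup>2 - b\<^sup>2)))"
    proof -
      have e: "- 2 * \<eta> / (2 * a * (2 * u) * (2 * \<eta>)) + 2 * \<eta> / (2 * a * (2 * \<eta>) * (2 * v)) = - (\<eta> / 4) * ((v - u) / (a * \<eta> * (u * v)))"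
        if "u \<noteq> 0" "v \<noteq> 0" for u v
        using that assms \<eta> by (simp add: divide_simps)
      have s: "\<eta>\<^sup>2 - b\<^sup>2 = (\<eta> - b) * (\<eta> + b)" by (simp add: algebra_simps power2_eq_square)
      have t: "2 * b = \<eta> + b - (\<eta> - b)" by simp
      have "\<eta> - b \<noteq> 0" "\<eta> + b \<noteq> 0" using 3 assms \<eta> by auto
      from e[OF this] show ?thesis unfolding s t .
    qed
    also have "- (\<eta> / 4) * (2 * b / (a * \<eta> * (\<eta>\<^sup>2 - b\<^sup>2))) + 2 * \<eta> / (2 * a * (2 * (a - b + \<eta>)) * (2 * (a + \<eta>)))
       + - 2 * \<eta> / (2 * a * (2 * (a + \<eta>)) * (2 * (a + b + \<eta>))) = - (\<eta> / 4) * rim_total \<eta> (a, b)"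
          proof -
      have e: "- (\<eta> / 4) * Z + \<eta> / 4 * Y + - (\<eta> / 4) * X = - (\<eta> / 4) * (X - 0 - Y + Z)" for X Y Z
        by (simp add: algebra_simps add_divide_distrib diff_divide_distrib)
      have "rim_total \<eta> (a, b) = 1 / (a * (a + \<eta>) * (a + b + \<eta>)) - 0 - 1 / (a * (a + \<eta>) * (a - b + \<eta>)) + 2 * b / (a * \<eta> * (\<eta>\<^sup>2 - b\<^sup>2))"
        using 3 assms by (simp add: rim_total_def T1_def T2_def T3_def T4_def)
      thus ?thesis by (simp only: k k' e)
    qed
    finally show ?thesis .
  qed
qed

text \<open>Integrating over \<open>s\<close>, then \<open>x\<close>, leaves a multiple of
  \<open>rim_total\<close> in the two heights, whose integral is 0. The integrand \<Phi> may differ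
  from \<open>two_wheel\<close> at height \<eta>, a null set: there configurations can collide with
  the apex.\<close>

lemma integral_two_wheel_interior:
  fixes \<Phi> :: "real4 \<Rightarrow> real"
  assumes \<Phi>: "\<And>y y' x s. y \<noteq> \<eta> \<Longrightarrow> y' \<noteq> \<eta> \<Longrightarrow> \<Phi> (y, y', x, s) = two_wheel (Complex 0 \<eta>) (Complex 0 \<eta>) (y, y', x, s)"
    and int: "integrable lborel \<Phi>"
  shows "integral\<^sup>L lborel \<Phi> = 0"
proof -
  have [measurable]: "rim_total \<eta> \<in> borel_measurable borel"
    using borel_measurable_has_bochner_integral[OF has_bochner_integral_rim_total[OF \<eta>]] by simp
  \<comment> \<open>One summand for each order of the heights; the constant is 4 pi^2 times
    -\<eta>/4.\<close>
  define \<Psi> where "\<Psi> q = - (pi\<^sup>2 * \<eta>) * (rim_total \<eta> q + rim_total \<eta> (snd q, fst q))" for q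
  note F1 = Fubini_lborel[OF int]
  have "AE y in lborel. (\<integral>r. \<Phi> (y, r) \<partial>lborel) = (\<integral>y'. \<Psi> (y, y') \<partial>lborel)"
    using F1(1) AE_lborel_singleton[of \<eta>]
  proof eventually_elim
    case (elim y)
    note F2 = Fubini_lborel[OF elim(1)]
    note ney = elim(2)
    have "AE y' in lborel. (\<integral>r. \<Phi> (y, y', r) \<partial>lborel) = \<Psi> (y, y')"
      using F2(1) AE_lborel_singleton[of \<eta>] AE_lborel_singleton[of y] AE_lborel_singleton[of "\<eta> - y"] AE_lborel_singleton[of 0]
    proof eventually_elim
      case (elim y')
      note F3 = Fubini_lborel[OF elim(1)]
      show ?case
      proof (cases "y > 0 \<and> y' > 0")
        case True
        have "AE x in lborel. (\<integral>s. \<Phi> (y, y', x, s) \<partial>lborel) = (\<Sum>g\<in>{\<eta>, - \<eta>}. \<Sum>h\<in>{\<eta>, - \<eta>}. 4 * pi * wheel_coeff y y' g h *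
            (x\<^sup>2 / ((x\<^sup>2 + \<bar>y - y'\<bar>\<^sup>2) * (x\<^sup>2 + (y + y')\<^sup>2) * (x\<^sup>2 + (\<bar>y - g\<bar> + \<bar>y' - h\<bar>)\<^sup>2))))"
          using AE_lborel_singleton[of 0]
        proof eventually_elim
          case x: (elim x)
          have "\<Phi> (y, y', x, s) = two_wheel (Complex 0 \<eta>) (Complex 0 \<eta>) (y, y', x, s)" for s
            by (rule \<Phi>[OF ney elim(2)])
          thus ?case
            using has_bochner_integral_integral_eq[OF has_bochner_integral_two_wheel_interior_s[of y y' x]] True x elim(2) ney
            by presburger
        qed
        note ax = this
        have hb: "has_bochner_integral lborel (\<lambda>x. \<Sum>g\<in>{\<eta>, - \<eta>}. \<Sum>h\<in>{\<eta>, - \<eta>}. 4 * pi * wheel_coeff y y' g h *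
            (x\<^sup>2 / ((x\<^sup>2 + \<bar>y - y'\<bar>\<^sup>2) * (x\<^sup>2 + (y + y')\<^sup>2) * (x\<^sup>2 + (\<bar>y - g\<bar> + \<bar>y' - h\<bar>)\<^sup>2))))
          (4 * pi\<^sup>2 * wheel_sum y y')"
          using True elim ney by (intro has_bochner_integral_two_wheel_interior_x) auto
        have "(\<integral>x. \<integral>s. \<Phi> (y, y', x, s) \<partial>lborel \<partial>lborel) = 4 * pi\<^sup>2 * wheel_sum y y'"
          unfolding has_bochner_integral_integral_eq[OF hb, symmetric]
          by (rule integral_cong_AE[OF _ _ ax])
             (rule borel_measurable_integrable[OF F3(2)], rule borel_measurable_has_bochner_integral[OF hb])
        also have "\<dots> = \<Psi> (y, y')"
        proof (cases "y' < y")
          case y': True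
          have "rim_total \<eta> (y', y) = 0" using y' \<eta> by (simp add: rim_total_def T1_def T2_def T3_def T4_def)
          thus ?thesis using True y' elim ney by (simp add: \<Psi>_def wheel_sum_eq_rim_total)
        next
          case False
          hence y': "y < y'" using elim by auto
          have "rim_total \<eta> (y, y') = 0" using y' \<eta> by (simp add: rim_total_def T1_def T2_def T3_def T4_def)
          thus ?thesis using True y' elim ney by (simp add: \<Psi>_def wheel_sum_commute[of y] wheel_sum_eq_rim_total)
        qed
        finally show ?thesis using F3(3) by simp
      next
        case False
        hence "\<Phi> (y, y', r) = 0" for r using \<Phi>[of y y'] elim ney by (cases r) (auto simp: two_wheel_def)
        moreover have "\<Psi> (y, y') = 0" using False \<eta> by (auto simp: \<Psi>_def rim_total_def T1_def T2_def T3_def T4_def)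
        ultimately show ?thesis by simp
      qed
    qed
    hence "(\<integral>y'. \<integral>r. \<Phi> (y, y', r) \<partial>lborel \<partial>lborel) = (\<integral>y'. \<Psi> (y, y') \<partial>lborel)"
      using F2(2) by (intro integral_cong_AE) (auto simp: \<Psi>_def)
    thus ?case using F2(3) by simp
  qed
  note ae = this
  note rt = has_bochner_integral_rim_total[OF \<eta>]
  have sw: "integrable lborel (\<lambda>q. rim_total \<eta> (snd q, fst q))" "(\<integral>q. rim_total \<eta> (snd q, fst q) \<partial>lborel) = 0"
  proof -
    have i: "integrable (lborel \<Otimes>\<^sub>M lborel) (rim_total \<eta>)"
      using rt by (simp add: has_bochner_integral_iff lborel_prod)
    have e: "(\<lambda>(x, y). rim_total \<eta> (y, x)) = (\<lambda>q. rim_total \<eta> (snd q, fst q))" by auto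
    show "integrable lborel (\<lambda>q. rim_total \<eta> (snd q, fst q))"
      using lborel_pair.integrable_product_swap[OF i] by (simp add: lborel_prod e)
    have "(\<integral>q. rim_total \<eta> (snd q, fst q) \<partial>lborel) = (\<integral>q. rim_total \<eta> q \<partial>lborel)"
      using lborel_pair.integral_product_swap[of "rim_total \<eta>"] i by (simp add: lborel_prod e)
    thus "(\<integral>q. rim_total \<eta> (snd q, fst q) \<partial>lborel) = 0"
      using rt by (simp add: has_bochner_integral_iff)
  qed
  have \<Psi>: "has_bochner_integral lborel \<Psi> 0"
    using rt sw unfolding \<Psi>_def by (auto simp: has_bochner_integral_iff)
  note F\<Psi> = Fubini_lborel[of \<Psi>]
  have "(\<integral>y. \<integral>r. \<Phi> (y, r) \<partial>lborel \<partial>lborel) = (\<integral>y. \<integral>y'. \<Psi> (y, y') \<partial>lborel \<partial>lborel)"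
    using ae F1(2) F\<Psi>(2) \<Psi> by (intro integral_cong_AE) (auto simp: has_bochner_integral_iff)
  thus ?thesis using F1(3) F\<Psi>(3) \<Psi> by (simp add: has_bochner_integral_iff)
qed

end

section \<open>Weights of the graphs that matter\<close>

lemma sets_configurations [measurable]: "configurations N \<in> sets (PiC {..<N})"
proof -
  have "configurations N = {p \<in> space (PiC {..<N}). (\<forall>k\<in>{..<N}. Im (p k) > 0) \<and>
      (\<forall>k\<in>{..<N}. \<forall>l\<in>{..<N}. k \<noteq> l \<longrightarrow> p k \<noteq> p l)}"
    by (auto simp: configurations_def space_PiM inj_on_def PiE_iff)
  also have "\<dots> \<in> sets (PiC {..<N})"
  proof (intro sets.sets_Collect_conj sets.sets_Collect_finite_All sets.sets_Collect_imp sets.sets_Collect_const finite_lessThan)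
    fix k l assume kl: "k \<in> {..<N}"
    have kb[measurable]: "(\<lambda>p. p k) \<in> borel_measurable (PiC {..<N})"
      using kl measurable_component_singleton[of k "{..<N}" "\<lambda>_. lborel :: complex measure"] by simp
    show "{p \<in> space (PiC {..<N}). 0 < Im (p k)} \<in> sets (PiC {..<N})" by measurable
    assume "l \<in> {..<N}"
    hence lb: "(\<lambda>p. p l) \<in> borel_measurable (PiC {..<N})"
      using measurable_component_singleton[of l "{..<N}" "\<lambda>_. lborel :: complex measure"] by simp
    show "{p \<in> space (PiC {..<N}). p k \<noteq> p l} \<in> sets (PiC {..<N})"
    proof -
      have "(\<lambda>p. p k - p l) -` (- {0}) \<inter> space (PiC {..<N}) \<in> sets (PiC {..<N})"
        by (rule measurable_sets[OF borel_measurable_diff[OF kb lb]]) auto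
      also have "(\<lambda>p. p k - p l) -` (- {0}) \<inter> space (PiC {..<N}) = {p \<in> space (PiC {..<N}). p k \<noteq> p l}" by auto
      finally show ?thesis .
    qed
  qed
  finally show ?thesis .
qed

text \<open>The density is positive on the upper half plane and integrable as a multiple of a
  product of Poisson kernels; exchanging the two edges reverses the orientation.\<close>

lemma kweight_1:
  "\<exists>w > 0. \<forall>\<Gamma> l. l < 2 \<longrightarrow> \<Gamma> (0, l) = VL \<longrightarrow> \<Gamma> (0, 1 - l) = VR \<longrightarrow> kweight 1 \<Gamma> = (-1) ^ l * w"
proof -
  define h where "h z = (if Im z > 0 then ground_density z else 0)" for z
  have h: "h z \<ge> 0" for z by (simp add: h_def ground_density_def)
  have [measurable]: "h \<in> borel_measurable borel"
    unfolding h_def ground_density_def by measurable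
  have "(\<integral>\<^sup>+z. ennreal (h z) \<partial>lborel) = (\<integral>\<^sup>+y. \<integral>\<^sup>+x. ennreal (h (Complex x y)) \<partial>lborel \<partial>lborel)"
    by (rule nn_integral_complex) measurable
  also have "\<dots> = (\<integral>\<^sup>+y. \<integral>\<^sup>+x. ennreal (if y > 0 then 4 * y / ((x\<^sup>2 + y\<^sup>2) * ((x - 1)\<^sup>2 + y\<^sup>2)) else 0) \<partial>lborel \<partial>lborel)"
    by (intro nn_integral_cong arg_cong[of _ _ ennreal]) (auto simp: h_def ground_density_def)
  also have "\<dots> < \<infinity>" by (rule nn_integral_poisson_kernels_finite) auto
  finally have int: "integrable lborel h" by (intro integrableI_nonneg) (auto simp: h)
  have pos: "(\<integral>z. h z \<partial>lborel) > 0"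
  proof -
    have "(\<integral>z. h z \<partial>lborel) \<noteq> 0"
    proof
      assume "(\<integral>z. h z \<partial>lborel) = 0"
      hence "AE z in lborel. h z = 0"
        using int h by (subst integral_nonneg_eq_0_iff_AE[symmetric]) auto
      \<comment> \<open>Any box inside the upper half plane would do; it has positive measure and
        the density is positive on it.\<close>
      hence "AE z in lborel. z \<notin> box \<i> (1 + 2 * \<i>)"
      proof eventually_elim
        case (elim z)
        show ?case
        proof
          assume z: "z \<in> box \<i> (1 + 2 * \<i>)"
          hence "Im z > 0" by (auto simp: in_box_complex_iff)
          hence "h z > 0" by (auto simp: h_def ground_density_def intro!: divide_pos_pos mult_pos_pos add_nonneg_pos)
          thus False using elim by simp
        qed
      qed
      hence "box \<i> (1 + 2 * \<i>) \<in> null_sets lborel" by (subst AE_iff_null_sets) auto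
      thus False by (auto simp: null_sets_def emeasure_lborel_box_eq Basis_complex_def)
    qed
    moreover have "(\<integral>z. h z \<partial>lborel) \<ge> 0" by (intro integral_nonneg_AE) (auto simp: h)
    ultimately show ?thesis by simp
  qed
  define w where "w = 1 / (fact 1 * (2 * pi) ^ (2 * 1)) * (\<integral>z. h z \<partial>lborel)"
  have "kweight 1 \<Gamma> = (-1) ^ l * w" if l: "l < 2" "\<Gamma> (0, l) = VL" "\<Gamma> (0, 1 - l) = VR" for \<Gamma> l
  proof -
    have "set_lebesgue_integral (PiC {..<1}) (configurations 1) (weight_density 1 \<Gamma>) = (\<integral>p. (-1) ^ l * h (p 0) \<partial>PiC {..<1})"
      unfolding set_lebesgue_integral_def
    proof (rule Bochner_Integration.integral_cong[OF refl])
      fix p assume p: "p \<in> space (PiC {..<1})"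
      show "indicator (configurations 1) p *\<^sub>R weight_density 1 \<Gamma> p = (-1) ^ l * h (p 0)"
      proof (cases "p \<in> configurations 1")
        case True
        thus ?thesis using weight_density_1[OF True, of \<Gamma> l] l configurations_Im[OF True, of 0] by (simp add: h_def)
      next
        case False
        hence "\<not> Im (p 0) > 0" using p by (auto simp: configurations_def space_PiM PiE_iff inj_on_def)
        thus ?thesis using False by (simp add: h_def)
      qed
    qed
    also have "\<dots> = (-1) ^ l * (\<integral>p. h (p 0) \<partial>PiC {0})" by (simp add: lessThan_Suc)
    also have "(\<integral>p. h (p 0) \<partial>PiC {0}) = (\<integral>z. h z \<partial>lborel)"
      by (rule cprod.product_integral_singleton) measurable
    finally show ?thesis unfolding kweight_def w_def by simp
  qed
  moreover have "w > 0" using pos by (simp add: w_def)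
  ultimately show ?thesis by (intro exI[of _ w] conjI allI impI)
qed

text \<open>The order of the edges at a vertex affects only the sign of the density. Both ways of
  attaching the spokes to 0 and 1 satisfy (a - b)^2 = 1, so \<open>integral_two_wheel_neg\<close>
  applies to each.\<close>

lemma kweight_2:
  assumes st: "{s, t} = {VL, VR}"
  shows "\<exists>w < 0. \<forall>\<Gamma> i j. i < 2 \<longrightarrow> j < 2 \<longrightarrow> \<Gamma> (0, i) = Vertex 1 \<longrightarrow> \<Gamma> (0, 1 - i) = s \<longrightarrow>
    \<Gamma> (1, j) = Vertex 0 \<longrightarrow> \<Gamma> (1, 1 - j) = t \<longrightarrow> kweight 2 \<Gamma> = (-1) ^ (i + j) * w"
proof -
  have st': "s \<in> {VL, VR}" "t \<in> {VL, VR}" using st by auto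
  \<comment> \<open>L and R have fixed positions, so any configuration, even
    \<open>undefined\<close>, may be inserted.\<close>
  define g where "g = two_wheel (position undefined s) (position undefined t)"
  have posn: "position p s = position undefined s" "position p t = position undefined t" for p
    using st' by auto
  have neg: "(\<integral>q. g q \<partial>lborel) < 0"
    using st integral_two_wheel_neg[of 0 1] integral_two_wheel_neg[of 1 0]
    by (auto simp: g_def doubleton_eq_iff)
  define w where "w = 1 / (fact 2 * (2 * pi) ^ (2 * 2)) * (\<integral>q. g q \<partial>lborel)"
  have "kweight 2 \<Gamma> = (-1) ^ (i + j) * w"
    if ij: "i < 2" "j < 2" and \<Gamma>: "\<Gamma> (0, i) = Vertex 1" "\<Gamma> (0, 1 - i) = s" "\<Gamma> (1, j) = Vertex 0" "\<Gamma> (1, 1 - j) = t"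
    for \<Gamma> i j
  proof -
    define F where "F p = (if Im (p 0) > 0 \<and> Im (p 1) > 0 then (-1) ^ (i + j) *
      wheel (spoke (position undefined s) (p 0)) (spoke (position undefined t) (p 1)) (p 0) (p 1) else 0)" for p :: "nat \<Rightarrow> complex"
    have [measurable]: "F \<in> borel_measurable (PiC {..<2})"
      unfolding F_def wheel_def spoke_eq by (simp only: fst_conv snd_conv) measurable
    have "set_lebesgue_integral (PiC {..<2}) (configurations 2) (weight_density 2 \<Gamma>) = (\<integral>p. F p \<partial>PiC {..<2})"
      unfolding set_lebesgue_integral_def
    proof (rule Bochner_Integration.integral_cong[OF refl])
      fix p assume p: "p \<in> space (PiC {..<2})"
      show "indicator (configurations 2) p *\<^sub>R weight_density 2 \<Gamma> p = F p"
      proof (cases "p \<in> configurations 2")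
        case True
        thus ?thesis using weight_density_2[OF True \<Gamma> ij st'] configurations_Im[OF True, of 0] configurations_Im[OF True, of 1]
          by (simp add: F_def posn[of p])
      next
        case False
        hence "\<not> Im (p 0) > 0 \<or> \<not> Im (p 1) > 0 \<or> p 0 = p 1"
          using p by (auto simp: configurations_def space_PiM PiE_iff inj_on_def less_2_cases_iff)
        thus ?thesis using False by (auto simp: F_def wheel_def)
      qed
    qed
    also have "\<dots> = (\<integral>p. F p \<partial>distr lborel (PiC {..<2}) pair_config)" by (simp only: distr_pair_config)
    also have "\<dots> = (\<integral>q. F (pair_config q) \<partial>lborel)" by (rule integral_distr) measurable
    also have "\<dots> = (\<integral>q. (-1) ^ (i + j) * g q \<partial>lborel)"
      by (intro Bochner_Integration.integral_cong refl) (auto simp: F_def pair_config_def g_def two_wheel_def)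
    finally show ?thesis by (simp add: kweight_def w_def)
  qed
  moreover have "w < 0" using neg by (simp add: w_def divide_neg_pos)
  ultimately show ?thesis by (intro exI[of _ w] conjI allI impI)
qed

lemma two_wheel_translate: 
  "wheel (spoke a (Complex (Re a + s + x) y)) (spoke a (Complex (Re a + s) y')) (Complex (Re a + s + x) y) (Complex (Re a + s) y') =
   wheel (spoke (Complex 0 (Im a)) (Complex (s + x) y)) (spoke (Complex 0 (Im a)) (Complex s y')) (Complex (s + x) y) (Complex s y')"
  by (simp add: wheel_def spoke_eq)

text \<open>The density is the ground density of the apex times a rim density; integrating over the
  rim first, with the apex fixed, gives 0 by \<open>integral_two_wheel_interior\<close>.\<close>

lemma kweight_3_eq_0:
  assumes k: "k < 3" and uv: "u = (if k = 0 then 1 else 0)" "v = (if k = 2 then 1 else 2)"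
     and \<Gamma>: "\<Gamma> (u, i) = Vertex v" "\<Gamma> (u, 1 - i) = Vertex k" 
     "\<Gamma> (v, j) = Vertex u" "\<Gamma> (v, 1 - j) = Vertex k"
     "\<Gamma> (k, l) = VL" "\<Gamma> (k, 1 - l) = VR"
     and ijl: "i < 2" "j < 2" "l < 2"
  shows "kweight 3 \<Gamma> = 0"
proof -
  have kuv: "distinct [k, u, v]" "{..<3} = {k, u, v}" using k uv by (auto split: if_splits)
  define F where "F p = (if p \<in> configurations 3 then (-1) ^ (i + j + l) * ground_density (p k) *
     wheel (spoke (p k) (p u)) (spoke (p k) (p v)) (p u) (p v) else 0)" for p
  have kuvm: "k \<in> {..<3}" "u \<in> {..<3}" "v \<in> {..<3}" using kuv by auto
  have Fm: "F \<in> borel_measurable (PiC {..<3})"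
  proof -
    have [measurable]: "(\<lambda>p. p k) \<in> PiC {..<3} \<rightarrow>\<^sub>M borel" "(\<lambda>p. p u) \<in> PiC {..<3} \<rightarrow>\<^sub>M borel" "(\<lambda>p. p v) \<in> PiC {..<3} \<rightarrow>\<^sub>M borel"
      using kuvm by (auto intro: measurable_component_singleton[of _ _ "\<lambda>_. lborel", simplified])
    show ?thesis
      unfolding F_def wheel_def spoke_eq ground_density_def fst_conv snd_conv by measurable
  qed
  have "set_lebesgue_integral (PiC {..<3}) (configurations 3) (weight_density 3 \<Gamma>) = (\<integral>p. F p \<partial>PiC {..<3})"
    unfolding set_lebesgue_integral_def
    by (rule Bochner_Integration.integral_cong[OF refl]) (use weight_density_3[OF _ k uv \<Gamma> ijl] in \<open>auto simp: F_def\<close>)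
  also have "\<dots> = 0"
  \<comment> \<open>A function that is not integrable has Bochner integral 0 by definition, so both
    cases end in the same value.\<close>
  proof (cases "integrable (PiC {..<3}) F")
    case True
    hence "integrable (distr lborel (PiC {..<3}) (triple_config k u v)) F" by (simp only: distr_triple_config[OF kuv])
    hence int: "integrable lborel (\<lambda>q. F (triple_config k u v q))"
      using measurable_triple_config[OF kuv] Fm by (subst (asm) integrable_distr_eq) auto
    have "(\<integral>p. F p \<partial>PiC {..<3}) = (\<integral>p. F p \<partial>distr lborel (PiC {..<3}) (triple_config k u v))" by (simp only: distr_triple_config[OF kuv])
    also have "\<dots> = (\<integral>q. F (triple_config k u v q) \<partial>lborel)"
      using measurable_triple_config[OF kuv] Fm by (intro integral_distr) auto
    also have "\<dots> = (\<integral>a. \<integral>q. F (triple_config k u v (a, q)) \<partial>lborel \<partial>lborel)"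
      using Fubini_lborel(3)[OF int] by simp
    also have "\<dots> = (\<integral>a. 0 \<partial>(lborel :: complex measure))"
    proof (rule integral_cong_AE)
      show "AE a in lborel. (\<integral>q. F (triple_config k u v (a, q)) \<partial>lborel) = 0"
        using Fubini_lborel(1)[OF int]
      proof eventually_elim
        case (elim a)
        define G where "G = (-1) ^ (i + j + l) * ground_density a"
        \<comment> \<open>Away from the height of the apex, distinctness of the three points reduces
          to distinctness of the rim points, and at their collision the factor x makes
          \<open>wheel\<close> vanish.\<close>
        have e: "F (triple_config k u v (a, y, y', x, s)) = G * two_wheel (Complex 0 (Im a)) (Complex 0 (Im a)) (y, y', x, s)"
          if "Im a > 0" "y \<noteq> Im a" "y' \<noteq> Im a" for y y' x s
        proof -
          let ?p = "triple_config k u v (a, y, y', x, s)"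
          have p: "?p k = a" "?p u = Complex (Re a + s + x) y" "?p v = Complex (Re a + s) y'"
            using kuv by (auto simp: triple_config_def)
          have ext: "?p \<in> extensional {..<3}" using kuv(2) by (auto simp: extensional_def triple_config_def)
          have c: "?p \<in> configurations 3 \<longleftrightarrow> y > 0 \<and> y' > 0 \<and> \<not> (x = 0 \<and> y = y')"
          proof -
            have "?p \<in> configurations 3 \<longleftrightarrow> (\<forall>j\<in>{k, u, v}. Im (?p j) > 0) \<and> inj_on ?p {k, u, v}"
              using ext by (auto simp: configurations_def PiE_iff kuv(2)) 
            also have "\<dots> \<longleftrightarrow> y > 0 \<and> y' > 0 \<and> \<not> (x = 0 \<and> y = y')"
              using kuv(1) that by (auto simp: p inj_on_def complex_eq_iff)
            finally show ?thesis .
          qed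
          show ?thesis
            unfolding F_def c p two_wheel_translate two_wheel_def G_def by (auto simp: wheel_def)
        qed
        show "(\<integral>q. F (triple_config k u v (a, q)) \<partial>lborel) = 0"
        proof (cases "Im a > 0")
          case True
          define c where "c = (if G = 0 then 1 else G)"
          show ?thesis
          proof (cases "G = 0")
            case False
            have "(\<integral>q. F (triple_config k u v (a, q)) / G \<partial>lborel) = 0"
              by (rule integral_two_wheel_interior[OF True]) (use e[OF True] False elim in auto)
            thus ?thesis using False by simp
          next
            case G0: True
            have "ground_density a > 0" using True by (auto simp: ground_density_def intro!: divide_pos_pos mult_pos_pos add_nonneg_pos)
            thus ?thesis using G0 by (simp add: G_def)
          qed
        next
          case False
          have "F (triple_config k u v (a, q)) = 0" for q
          proof -
            have "triple_config k u v (a, q) k = a" using kuv by (auto simp: triple_config_def split_beta)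
            thus ?thesis using False configurations_Im[of "triple_config k u v (a, q)" 3 k] k by (auto simp: F_def)
          qed
          thus ?thesis by simp
        qed
      qed
    qed (use borel_measurable_integrable[OF Fubini_lborel(2)[OF int]] in auto)
    finally show ?thesis by simp
  qed (rule not_integrable_integral_eq)
  finally show ?thesis by (simp add: kweight_def)
qed

section \<open>Symmetry of mixed derivatives and closure properties of smooth functions\<close>

lemma second_difference:
  fixes F :: "real \<Rightarrow> real \<Rightarrow> real"
  assumes 1: "\<And>s t. ((\<lambda>s. F s t) has_real_derivative F1 s t) (at s)"
    and 12: "\<And>s t. ((\<lambda>t. F1 s t) has_real_derivative F12 s t) (at t)"
    and h: "h > 0"
  shows "\<exists>\<sigma> \<tau>. s < \<sigma> \<and> \<sigma> < s + h \<and> t < \<tau> \<and> \<tau> < t + h \<and>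
    F (s + h) (t + h) - F (s + h) t - F s (t + h) + F s t = h * h * F12 \<sigma> \<tau>"
proof -
  have "\<exists>\<sigma>>s. \<sigma> < s + h \<and> (F (s + h) (t + h) - F (s + h) t) - (F s (t + h) - F s t) = (s + h - s) * (F1 \<sigma> (t + h) - F1 \<sigma> t)"
    by (rule MVT2) (use h in \<open>auto intro!: derivative_eq_intros 1\<close>)
  then obtain \<sigma> where \<sigma>: "s < \<sigma>" "\<sigma> < s + h"
    "(F (s + h) (t + h) - F (s + h) t) - (F s (t + h) - F s t) = h * (F1 \<sigma> (t + h) - F1 \<sigma> t)" by auto
  have "\<exists>\<tau>>t. \<tau> < t + h \<and> F1 \<sigma> (t + h) - F1 \<sigma> t = (t + h - t) * F12 \<sigma> \<tau>"
    by (rule MVT2) (use h in \<open>auto intro!: 12\<close>)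
  then obtain \<tau> where "t < \<tau>" "\<tau> < t + h" "F1 \<sigma> (t + h) - F1 \<sigma> t = h * F12 \<sigma> \<tau>" by auto
  with \<sigma> show ?thesis by (intro exI[of _ \<sigma>] exI[of _ \<tau>]) (simp add: algebra_simps)
qed

text \<open>The second difference over a small square, divided by its area, is a value of
  \<open>F12\<close> and also a value of \<open>F21\<close> at points of the square. Continuity
  forces the two to agree in the limit.\<close>

lemma mixed_derivatives_eq:
  fixes F :: "real \<Rightarrow> real \<Rightarrow> real"
  assumes "\<And>s t. ((\<lambda>s. F s t) has_real_derivative F1 s t) (at s)"
    and "\<And>s t. ((\<lambda>t. F s t) has_real_derivative F2 s t) (at t)"
    and "\<And>s t. ((\<lambda>t. F1 s t) has_real_derivative F12 s t) (at t)"
    and "\<And>s t. ((\<lambda>s. F2 s t) has_real_derivative F21 s t) (at s)"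
    and c12: "continuous_on UNIV (\<lambda>(s, t). F12 s t)" and c21: "continuous_on UNIV (\<lambda>(s, t). F21 s t)"
  shows "F12 s t = F21 s t"
proof (rule ccontr)
  assume "F12 s t \<noteq> F21 s t"
  hence e: "\<bar>F12 s t - F21 s t\<bar> / 2 > 0" (is "?e > 0") by simp
  have "isCont (\<lambda>(s, t). F12 s t) (s, t)" "isCont (\<lambda>(s, t). F21 s t) (s, t)"
    using c12 c21 by (auto simp: continuous_on_eq_continuous_at)
  then obtain d1 d2 where d1: "d1 > 0" "\<And>q. dist q (s, t) < d1 \<Longrightarrow> dist (case q of (s, t) \<Rightarrow> F12 s t) (F12 s t) < ?e"
    and d2: "d2 > 0" "\<And>q. dist q (s, t) < d2 \<Longrightarrow> dist (case q of (s, t) \<Rightarrow> F21 s t) (F21 s t) < ?e"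
    using e unfolding continuous_at_eps_delta by (metis (no_types, lifting) case_prod_conv)
  define h where "h = min d1 d2 / 2"
  have h: "h > 0" "2 * h \<le> d1" "2 * h \<le> d2" using d1 d2 by (auto simp: h_def)
  have near: "dist (\<sigma>, \<tau>) (s, t) < 2 * h" if "s < \<sigma>" "\<sigma> < s + h" "t < \<tau>" "\<tau> < t + h" for \<sigma> \<tau>
  proof -
    have "dist (\<sigma>, \<tau>) (s, t) \<le> dist \<sigma> s + dist \<tau> t"
      by (simp add: dist_prod_def sqrt_sum_squares_le_sum)
    thus ?thesis using that by (simp add: dist_real_def)
  qed
  obtain \<sigma> \<tau> where 1: "s < \<sigma>" "\<sigma> < s + h" "t < \<tau>" "\<tau> < t + h"
      "F (s + h) (t + h) - F (s + h) t - F s (t + h) + F s t = h * h * F12 \<sigma> \<tau>"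
    using second_difference[OF assms(1,3) h(1)] by metis
  obtain \<tau>' \<sigma>' where 2: "s < \<sigma>'" "\<sigma>' < s + h" "t < \<tau>'" "\<tau>' < t + h"
      "F (s + h) (t + h) - F s (t + h) - F (s + h) t + F s t = h * h * F21 \<sigma>' \<tau>'"
    using second_difference[of "\<lambda>t s. F s t" "\<lambda>t s. F2 s t" "\<lambda>t s. F21 s t", OF assms(2,4) h(1), of t s] by metis
  have "h * h * F12 \<sigma> \<tau> = h * h * F21 \<sigma>' \<tau>'" using 1(5) 2(5) by linarith
  hence "F12 \<sigma> \<tau> = F21 \<sigma>' \<tau>'" using h(1) by simp
  moreover have "dist (F12 \<sigma> \<tau>) (F12 s t) < ?e" using d1(2)[of "(\<sigma>, \<tau>)"] near[OF 1(1-4)] h by simp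
  moreover have "dist (F21 \<sigma>' \<tau>') (F21 s t) < ?e" using d2(2)[of "(\<sigma>', \<tau>')"] near[OF 2(1-4)] h by simp
  moreover have "dist (F12 s t) (F21 s t) \<le> dist c (F12 s t) + dist c (F21 s t)" for c
    by (rule dist_triangle3)
  moreover have "\<bar>F12 s t - F21 s t\<bar> = dist (F12 s t) (F21 s t)" by (simp add: dist_real_def)
  ultimately show False by (metis add_strict_mono field_sum_of_halves not_le)
qed

abbreviation E :: "nat \<Rightarrow> (nat \<Rightarrow> real) set"
  where "E n \<equiv> topspace (Euclidean_space n)"

lemma E_upd [intro]: "x \<in> E n \<Longrightarrow> i < n \<Longrightarrow> x(i := t) \<in> E n"
  by (auto simp: topspace_Euclidean_space)

lemma zero_in_E [simp]: "(\<lambda>_. 0) \<in> E n"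
  by (simp add: topspace_Euclidean_space)

lemma continuous_map_E_iff:
  "continuous_map (Euclidean_space n) euclidean f \<longleftrightarrow> continuous_on (E n) f"
proof -
  have "Euclidean_space n = top_of_set (E n)"
    by (simp add: Euclidean_space_def euclidean_product_topology topspace_subtopology)
  thus ?thesis by (metis continuous_map_iff_continuous)
qed

definition regular :: "nat \<Rightarrow> ((nat \<Rightarrow> real) \<Rightarrow> 'a::real_normed_vector) \<Rightarrow> bool"
  where "regular n f \<longleftrightarrow> continuous_on (E n) f \<and>
    (\<forall>i<n. \<forall>x\<in>E n. (\<lambda>t. f (x(i := t))) differentiable (at (x i)))"

lemma smooth_fun_iff: "smooth_fun n f \<longleftrightarrow> (\<forall>I\<in>lists {..<n}. regular n (pderivs I f))"
  unfolding smooth_fun_def regular_def continuous_map_E_iff ..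

lemma pderivs_Nil [simp]: "pderivs [] f = f"
  and pderivs_Cons: "pderivs (i # I) f = pderiv_coord i (pderivs I f)"
  and pderivs_append: "pderivs (I @ J) f = pderivs I (pderivs J f)"
  by (simp_all add: pderivs_def)

lemma pderivs_snoc: "pderivs (I @ [i]) f = pderivs I (pderiv_coord i f)"
  by (simp add: pderivs_def)

text \<open>A coordinate line in a direction below \<open>n\<close> through a point of the carrier
  stays in the carrier, so values elsewhere do not influence the derivative.\<close>

lemma pderiv_coord_cong:
  assumes "\<And>x. x \<in> E n \<Longrightarrow> f x = g x" "i < n" "x \<in> E n"
  shows "pderiv_coord i f x = pderiv_coord i g x"
proof -
  have "(\<lambda>t. f (x(i := t))) = (\<lambda>t. g (x(i := t)))" using assms by (auto intro: E_upd)
  thus ?thesis by (simp add: pderiv_coord_def)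
qed

lemma pderivs_cong:
  assumes "\<And>x. x \<in> E n \<Longrightarrow> f x = g x" "I \<in> lists {..<n}" "x \<in> E n"
  shows "pderivs I f x = pderivs I g x"
  using assms(2,3)
proof (induction I arbitrary: x)
  case (Cons i I)
  thus ?case unfolding pderivs_Cons by (intro pderiv_coord_cong[of n]) auto
qed (use assms(1) in auto)

lemma regular_cong:
  assumes "\<And>x. x \<in> E n \<Longrightarrow> f x = g x" "regular n f"
  shows "regular n g"
proof -
  have "(\<lambda>t. f (x(i := t))) = (\<lambda>t. g (x(i := t)))" if "i < n" "x \<in> E n" for i x
    using assms(1) that by (auto intro: E_upd)
  moreover have "continuous_on (E n) g" using assms continuous_on_cong[of "E n" "E n" f g] by (auto simp: regular_def)
  ultimately show ?thesis using assms(2) by (simp add: regular_def)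
qed

lemma smooth_fun_cong:
  assumes "\<And>x. x \<in> E n \<Longrightarrow> f x = g x" "smooth_fun n f"
  shows "smooth_fun n g"
  unfolding smooth_fun_iff
proof
  fix I assume I: "I \<in> lists {..<n}"
  show "regular n (pderivs I g)"
    by (rule regular_cong[of n "pderivs I f"]) (use assms I pderivs_cong[OF assms(1) I] in \<open>auto simp: smooth_fun_iff\<close>)
qed

lemma smooth_regular: "smooth_fun n f \<Longrightarrow> regular n f"
  unfolding smooth_fun_iff by (metis pderivs_Nil lists.Nil)

lemma smooth_pderiv_coord: "smooth_fun n f \<Longrightarrow> i < n \<Longrightarrow> smooth_fun n (pderiv_coord i f)"
  unfolding smooth_fun_iff by (auto simp: pderivs_snoc[symmetric])

lemma smooth_pderivs: "smooth_fun n f \<Longrightarrow> I \<in> lists {..<n} \<Longrightarrow> smooth_fun n (pderivs I f)"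
  by (induction I) (auto simp: pderivs_Cons smooth_pderiv_coord)

lemma regular_has_derivative:
  assumes "regular n f" "i < n" "x \<in> E n"
  shows "((\<lambda>t. f (x(i := t))) has_vector_derivative pderiv_coord i f (x(i := s))) (at s)"
proof -
  have "x(i := s) \<in> E n" using assms by auto
  hence "(\<lambda>t. f ((x(i := s))(i := t))) differentiable (at ((x(i := s)) i))"
    using assms unfolding regular_def by blast
  thus ?thesis by (simp add: pderiv_coord_def vector_derivative_works)
qed

lemma regular_continuous: "regular n f \<Longrightarrow> continuous_on (E n) f"
  by (simp add: regular_def)

lemma regularI:
  assumes "continuous_on (E n) f"
    and "\<And>i x. i < n \<Longrightarrow> x \<in> E n \<Longrightarrow> ((\<lambda>t. f (x(i := t))) has_vector_derivative D i x) (at (x i))"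
  shows "regular n f"
  using assms unfolding regular_def by (blast intro: differentiableI_vector)

lemma pderiv_coord_eqI:
  "((\<lambda>t. f (x(i := t))) has_vector_derivative D) (at (x i)) \<Longrightarrow> pderiv_coord i f x = D"
  by (simp add: pderiv_coord_def vector_derivative_at)

text \<open>A class of functions is smooth as soon as it is closed under partial derivatives up to
  equality on the carrier.\<close>

lemma smooth_fun_coinduct:
  assumes "P f" and reg: "\<And>f. P f \<Longrightarrow> regular n f"
    and step: "\<And>f i. P f \<Longrightarrow> i < n \<Longrightarrow> \<exists>g. P g \<and> (\<forall>x\<in>E n. pderiv_coord i f x = g x)"
  shows "smooth_fun n f"
proof -
  have "\<exists>g. P g \<and> (\<forall>x\<in>E n. pderivs I f x = g x)" if "I \<in> lists {..<n}" for I
    using that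
  proof (induction I)
    case (Cons i I)
    then obtain g where g: "P g" "\<forall>x\<in>E n. pderivs I f x = g x" by auto
    obtain g' where g': "P g'" "\<forall>x\<in>E n. pderiv_coord i g x = g' x" using step[OF g(1), of i] Cons by auto
    have "pderivs (i # I) f x = g' x" if "x \<in> E n" for x
      using pderiv_coord_cong[of n "pderivs I f" g i x] g g' that Cons by (simp add: pderivs_Cons)
    thus ?case using g' by blast
  qed (use assms(1) in auto)
  thus ?thesis unfolding smooth_fun_iff using reg by (metis (no_types, lifting) regular_cong)
qed

lemma regular_linear:
  assumes "bounded_linear L" "regular n f"
  shows "regular n (\<lambda>x. L (f x))" 
    "i < n \<Longrightarrow> x \<in> E n \<Longrightarrow> pderiv_coord i (\<lambda>x. L (f x)) x = L (pderiv_coord i f x)"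
proof -
  have d: "((\<lambda>t. L (f (x(i := t)))) has_vector_derivative L (pderiv_coord i f x)) (at (x i))" if "i < n" "x \<in> E n" for i x
    using bounded_linear.has_vector_derivative[OF assms(1) regular_has_derivative[OF assms(2) that, of "x i"]] by simp
  show "regular n (\<lambda>x. L (f x))"
    by (rule regularI[OF bounded_linear.continuous_on[OF assms(1) regular_continuous[OF assms(2)]] d])
  show "i < n \<Longrightarrow> x \<in> E n \<Longrightarrow> pderiv_coord i (\<lambda>x. L (f x)) x = L (pderiv_coord i f x)"
    by (intro pderiv_coord_eqI d)
qed

lemma smooth_linear:
  assumes L: "bounded_linear L" and f: "smooth_fun n f"
  shows "smooth_fun n (\<lambda>x. L (f x))"
proof (rule smooth_fun_coinduct[where P = "\<lambda>g. \<exists>f. smooth_fun n f \<and> g = (\<lambda>x. L (f x))"])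
  fix g i assume "\<exists>f. smooth_fun n f \<and> g = (\<lambda>x. L (f x))" "i < n"
  thus "\<exists>h. (\<exists>f. smooth_fun n f \<and> h = (\<lambda>x. L (f x))) \<and> (\<forall>x\<in>E n. pderiv_coord i g x = h x)"
    by (metis regular_linear(2)[OF L] smooth_regular smooth_pderiv_coord)
next
  fix g assume "\<exists>f. smooth_fun n f \<and> g = (\<lambda>x. L (f x))"
  thus "regular n g" by (auto intro: regular_linear(1)[OF L] smooth_regular)
qed (use f in auto)

lemma pderivs_linear:
  assumes L: "bounded_linear L" and f: "smooth_fun n f" and "I \<in> lists {..<n}" "x \<in> E n"
  shows "pderivs I (\<lambda>x. L (f x)) x = L (pderivs I f x)"
  using assms(3,4)
proof (induction I arbitrary: x)
  case (Cons i I)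
  hence "pderivs (i # I) (\<lambda>x. L (f x)) x = pderiv_coord i (\<lambda>x. L (pderivs I f x)) x"
    unfolding pderivs_Cons by (intro pderiv_coord_cong[of n]) auto
  also have "\<dots> = L (pderivs (i # I) f x)"
    unfolding pderivs_Cons using Cons by (intro regular_linear(2)[OF L smooth_regular[OF smooth_pderivs[OF f]]]) auto
  finally show ?case .
qed simp

lemma regular_add:
  assumes "regular n f" "regular n g"
  shows "regular n (\<lambda>x. f x + g x)" 
    "i < n \<Longrightarrow> x \<in> E n \<Longrightarrow> pderiv_coord i (\<lambda>x. f x + g x) x = pderiv_coord i f x + pderiv_coord i g x"
proof -
  have d: "((\<lambda>t. f (x(i := t)) + g (x(i := t))) has_vector_derivative pderiv_coord i f x + pderiv_coord i g x) (at (x i))" if "i < n" "x \<in> E n" for i x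
    using has_vector_derivative_add[OF regular_has_derivative[OF assms(1) that, of "x i"] regular_has_derivative[OF assms(2) that, of "x i"]] by simp
  show "regular n (\<lambda>x. f x + g x)"
    by (rule regularI[OF continuous_on_add[OF assms[THEN regular_continuous]] d])
  show "i < n \<Longrightarrow> x \<in> E n \<Longrightarrow> pderiv_coord i (\<lambda>x. f x + g x) x = pderiv_coord i f x + pderiv_coord i g x"
    by (intro pderiv_coord_eqI d)
qed

lemma regular_mult:
  fixes f g :: "(nat \<Rightarrow> real) \<Rightarrow> 'a::real_normed_algebra"
  assumes "regular n f" "regular n g"
  shows "regular n (\<lambda>x. f x * g x)" 
    "i < n \<Longrightarrow> x \<in> E n \<Longrightarrow> pderiv_coord i (\<lambda>x. f x * g x) x = f x * pderiv_coord i g x + pderiv_coord i f x * g x"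
proof -
  have d: "((\<lambda>t. f (x(i := t)) * g (x(i := t))) has_vector_derivative f x * pderiv_coord i g x + pderiv_coord i f x * g x) (at (x i))" if "i < n" "x \<in> E n" for i x
    using has_vector_derivative_mult[OF regular_has_derivative[OF assms(1) that, of "x i"] regular_has_derivative[OF assms(2) that, of "x i"]] by simp
  show "regular n (\<lambda>x. f x * g x)"
    by (rule regularI[OF continuous_on_mult[OF assms[THEN regular_continuous]] d])
  show "i < n \<Longrightarrow> x \<in> E n \<Longrightarrow> pderiv_coord i (\<lambda>x. f x * g x) x = f x * pderiv_coord i g x + pderiv_coord i f x * g x"
    by (intro pderiv_coord_eqI d)
qed

lemma pderiv_coord_const [simp]: "pderiv_coord i (\<lambda>_. c) x = 0"
  by (simp add: pderiv_coord_def)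

lemma smooth_const [intro]: "smooth_fun n (\<lambda>_. c)"
proof (rule smooth_fun_coinduct[where P = "\<lambda>f. \<exists>c. f = (\<lambda>_. c)"])
  fix f :: "(nat \<Rightarrow> real) \<Rightarrow> 'a" assume "\<exists>c. f = (\<lambda>_. c)"
  thus "regular n f" by (auto intro: regularI[where D = "\<lambda>_ _. 0"])
qed auto

lemma smooth_add [intro]:
  fixes f g :: "(nat \<Rightarrow> real) \<Rightarrow> 'a::real_normed_vector"
  assumes "smooth_fun n f" "smooth_fun n g"
  shows "smooth_fun n (\<lambda>x. f x + g x)"
proof (rule smooth_fun_coinduct[where P = "\<lambda>h. \<exists>f g. smooth_fun n f \<and> smooth_fun n g \<and> h = (\<lambda>x. f x + g x)"])
  fix h :: "(nat \<Rightarrow> real) \<Rightarrow> 'a" and i assume "\<exists>f g. smooth_fun n f \<and> smooth_fun n g \<and> h = (\<lambda>x. f x + g x)" "i < n"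
  then obtain f g where fg: "smooth_fun n f" "smooth_fun n g" "h = (\<lambda>x. f x + g x)" by blast
  show "\<exists>k. (\<exists>f g. smooth_fun n f \<and> smooth_fun n g \<and> k = (\<lambda>x. f x + g x)) \<and> (\<forall>x\<in>E n. pderiv_coord i h x = k x)"
    using regular_add(2)[OF fg(1,2)[THEN smooth_regular]] fg \<open>i < n\<close>
    by (intro exI[of _ "\<lambda>x. pderiv_coord i f x + pderiv_coord i g x"] conjI exI[of _ "pderiv_coord i f"] exI[of _ "pderiv_coord i g"])
       (auto intro: smooth_pderiv_coord)
next
  fix h :: "(nat \<Rightarrow> real) \<Rightarrow> 'a" assume "\<exists>f g. smooth_fun n f \<and> smooth_fun n g \<and> h = (\<lambda>x. f x + g x)"
  thus "regular n h" by (auto intro: regular_add(1) smooth_regular)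
qed (use assms in auto)

text \<open>Products of smooth functions are not closed under differentiation, but finite sums of
  products are, by the Leibniz rule. This is the class to which \<open>smooth_fun_coinduct\<close>
  is applied.\<close>

inductive prod_sum :: "nat \<Rightarrow> ((nat \<Rightarrow> real) \<Rightarrow> 'a::real_normed_algebra) \<Rightarrow> bool" for n where
  "smooth_fun n f \<Longrightarrow> smooth_fun n g \<Longrightarrow> prod_sum n (\<lambda>x. f x * g x)"
| "prod_sum n f \<Longrightarrow> prod_sum n g \<Longrightarrow> prod_sum n (\<lambda>x. f x + g x)"

lemma smooth_mult [intro]:
  fixes f g :: "(nat \<Rightarrow> real) \<Rightarrow> 'a::real_normed_algebra"
  assumes "smooth_fun n f" "smooth_fun n g"
  shows "smooth_fun n (\<lambda>x. f x * g x)"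
proof (rule smooth_fun_coinduct[where P = "prod_sum n"])
  fix h :: "(nat \<Rightarrow> real) \<Rightarrow> 'a" assume "prod_sum n h"
  thus reg: "regular n h"
    by induction (auto intro: regular_add regular_mult smooth_regular)
next
  fix h :: "(nat \<Rightarrow> real) \<Rightarrow> 'a" and i assume "prod_sum n h" "i < n"
  hence "regular n h \<and> (\<exists>k. prod_sum n k \<and> (\<forall>x\<in>E n. pderiv_coord i h x = k x))"
  proof induction
    case (1 f g)
    have "prod_sum n (\<lambda>x. f x * pderiv_coord i g x + pderiv_coord i f x * g x)"
      using 1 by (auto intro!: prod_sum.intros smooth_pderiv_coord)
    thus ?case using 1 regular_mult[of n f g] smooth_regular by blast
  next
    case (2 f g)
    then obtain k l where kl: "prod_sum n k" "\<forall>x\<in>E n. pderiv_coord i f x = k x" "prod_sum n l" "\<forall>x\<in>E n. pderiv_coord i g x = l x" by blast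
    hence "prod_sum n (\<lambda>x. k x + l x)" by (intro prod_sum.intros)
    moreover have "\<forall>x\<in>E n. pderiv_coord i (\<lambda>x. f x + g x) x = k x + l x"
      using 2 kl regular_add(2)[of n f g] by simp
    ultimately show ?case using 2 regular_add(1)[of n f g] by blast
  qed
  thus "\<exists>k. prod_sum n k \<and> (\<forall>x\<in>E n. pderiv_coord i h x = k x)" by blast
qed (use assms in \<open>auto intro: prod_sum.intros\<close>)

lemma smooth_sum [intro]:
  "(\<And>a. a \<in> A \<Longrightarrow> smooth_fun n (f a)) \<Longrightarrow> smooth_fun n (\<lambda>x. \<Sum>a\<in>A. f a x)"
  by (induction A rule: infinite_finite_induct) auto

lemma smooth_coordinate: 
  assumes "k < n"
  shows "smooth_fun n (\<lambda>x. x k)" and "pderiv_coord i (\<lambda>x. x k) x = (if i = k then 1 else 0)"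
proof -
  have d: "((\<lambda>t. (x(i := t)) k) has_vector_derivative (if i = k then 1 else 0)) (at (x i))" for x :: "nat \<Rightarrow> real" and i
    by (auto intro!: derivative_eq_intros)
  show p: "pderiv_coord i (\<lambda>x. x k) x = (if i = k then 1 else 0)" for x i
    by (rule pderiv_coord_eqI[OF d])
  have r: "regular n (\<lambda>x. x k)"
    by (rule regularI[OF continuous_on_subset[OF continuous_on_product_coordinates] d]) auto
  show "smooth_fun n (\<lambda>x. x k)"
    by (rule smooth_fun_coinduct[where P = "\<lambda>f. f = (\<lambda>x. x k) \<or> (\<exists>c. f = (\<lambda>_. c))"])
       (use r p smooth_regular[OF smooth_const] in \<open>auto\<close>)
qed

text \<open>The function is restricted to the coordinate plane through \<open>x\<close> in the
  directions \<open>i\<close> and \<open>j\<close>, parametrised by \<open>q\<close>.\<close>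

lemma Schwarz_real:
  fixes f :: "(nat \<Rightarrow> real) \<Rightarrow> real"
  assumes f: "smooth_fun n f" and ij: "i < n" "j < n" and x: "x \<in> E n"
  shows "pderiv_coord i (pderiv_coord j f) x = pderiv_coord j (pderiv_coord i f) x"
proof (cases "i = j")
  case False
  define q where "q s t = x(i := s, j := t)" for s t
  have qE: "q s t \<in> E n" for s t using x ij by (auto simp: q_def)
  have qi: "(q s t)(i := s') = q s' t" and qj: "(q s t)(j := t') = q s t'" for s t s' t'
    using False by (auto simp: q_def fun_eq_iff)
  have di: "((\<lambda>s. g (q s t)) has_real_derivative pderiv_coord i g (q s t)) (at s)" if "smooth_fun n g" for g :: "_ \<Rightarrow> real" and s t
    using regular_has_derivative[OF smooth_regular[OF that] ij(1) qE, of 0 t s] by (simp add: qi has_real_derivative_iff_has_vector_derivative)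
  have dj: "((\<lambda>t. g (q s t)) has_real_derivative pderiv_coord j g (q s t)) (at t)" if "smooth_fun n g" for g :: "_ \<Rightarrow> real" and s t
    using regular_has_derivative[OF smooth_regular[OF that] ij(2) qE, of s 0 t] by (simp add: qj has_real_derivative_iff_has_vector_derivative)
  have cq: "continuous_on UNIV (\<lambda>(s, t). q s t)"
    unfolding q_def split_beta
  proof (rule continuous_on_coordinatewise_then_product)
    fix k
    show "continuous_on UNIV (\<lambda>p. (x(i := fst p, j := snd p)) k)"
      by (cases "k = j"; cases "k = i") (simp_all add: continuous_on_fst continuous_on_snd continuous_on_id)
  qed
  have c: "continuous_on UNIV (\<lambda>(s, t). g (q s t))" if "smooth_fun n g" for g :: "_ \<Rightarrow> real"
    using continuous_on_compose2[OF regular_continuous[OF smooth_regular[OF that]] cq] qE by (auto simp: split_beta)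
  note sf = smooth_pderiv_coord[OF f ij(1)] smooth_pderiv_coord[OF f ij(2)]
  have "pderiv_coord j (pderiv_coord i f) (q s t) = pderiv_coord i (pderiv_coord j f) (q s t)" for s t
    by (rule mixed_derivatives_eq[where F = "\<lambda>s t. f (q s t)", OF di[OF f] dj[OF f] dj[OF sf(1)] di[OF sf(2)]])
       (intro c smooth_pderiv_coord f ij)+
  moreover have "q (x i) (x j) = x" by (auto simp: q_def)
  ultimately show ?thesis by metis
qed simp

lemma Schwarz:
  fixes f :: "(nat \<Rightarrow> real) \<Rightarrow> complex"
  assumes f: "smooth_fun n f" and ij: "i < n" "j < n" and x: "x \<in> E n"
  shows "pderiv_coord i (pderiv_coord j f) x = pderiv_coord j (pderiv_coord i f) x"
proof (rule complex_eqI)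
  have R: "pderivs [i, j] (\<lambda>x. L (f x)) x = L (pderivs [i, j] f x)" "pderivs [j, i] (\<lambda>x. L (f x)) x = L (pderivs [j, i] f x)"
    if "bounded_linear L" for L :: "complex \<Rightarrow> real"
    using that f ij x by (auto intro!: pderivs_linear[of _ n])
  show "Re (pderiv_coord i (pderiv_coord j f) x) = Re (pderiv_coord j (pderiv_coord i f) x)"
    using R[OF bounded_linear_Re] Schwarz_real[OF smooth_linear[OF bounded_linear_Re f] ij x] by (simp add: pderivs_Cons)
  show "Im (pderiv_coord i (pderiv_coord j f) x) = Im (pderiv_coord j (pderiv_coord i f) x)"
    using R[OF bounded_linear_Im] Schwarz_real[OF smooth_linear[OF bounded_linear_Im f] ij x] by (simp add: pderivs_Cons)
qed

abbreviation X :: "nat \<Rightarrow> (nat \<Rightarrow> real) \<Rightarrow> complex"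
  where "X k \<equiv> \<lambda>x. complex_of_real (x k)"

lemma smooth_X [intro]: "k < n \<Longrightarrow> smooth_fun n (X k)"
  by (rule smooth_linear[OF bounded_linear_of_real smooth_coordinate(1)])

lemma pderiv_coord_X:
  "k < n \<Longrightarrow> i < n \<Longrightarrow> x \<in> E n \<Longrightarrow> pderiv_coord i (X k) x = (if i = k then 1 else 0)"
  using regular_linear(2)[OF bounded_linear_of_real[where 'a = complex] smooth_regular[OF smooth_coordinate(1)], of k n i x]
  by (simp add: smooth_coordinate(2)[of k n])

lemma regular_sum:
  assumes "\<And>a. a \<in> A \<Longrightarrow> regular n (f a)" "i < n" "x \<in> E n"
  shows "pderiv_coord i (\<lambda>x. \<Sum>a\<in>A. f a x) x = (\<Sum>a\<in>A. pderiv_coord i (f a) x)"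
proof (rule pderiv_coord_eqI, rule has_vector_derivative_sum)
  fix a assume "a \<in> A"
  thus "((\<lambda>t. f a (x(i := t))) has_vector_derivative pderiv_coord i (f a) x) (at (x i))"
    using regular_has_derivative[OF assms(1) assms(2,3), of a "x i"] by simp
qed

lemma smooth_cmult [intro]: "smooth_fun n f \<Longrightarrow> smooth_fun n (\<lambda>x. c * f x)" for c :: "'a::real_normed_algebra"
  by (intro smooth_mult smooth_const)

lemma pderivs_lincomb:
  fixes f g :: "(nat \<Rightarrow> real) \<Rightarrow> complex"
  assumes f: "smooth_fun n f" and g: "smooth_fun n g" and "I \<in> lists {..<n}" "x \<in> E n"
  shows "pderivs I (\<lambda>x. a * f x + b * g x) x = a * pderivs I f x + b * pderivs I g x"
  using assms(3,4)
proof (induction I arbitrary: x)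
  case (Cons i I)
  have sm: "regular n (pderivs I f)" "regular n (pderivs I g)" 
    using Cons by (auto intro!: smooth_regular smooth_pderivs simp: f g)
  have lin: "bounded_linear (\<lambda>z::complex. c * z)" for c by (rule bounded_linear_mult_right)
  have "pderivs (i # I) (\<lambda>x. a * f x + b * g x) x = pderiv_coord i (\<lambda>x. a * pderivs I f x + b * pderivs I g x) x"
    unfolding pderivs_Cons using Cons by (intro pderiv_coord_cong[of n]) auto
  also have "\<dots> = pderiv_coord i (\<lambda>x. a * pderivs I f x) x + pderiv_coord i (\<lambda>x. b * pderivs I g x) x"
    using Cons by (intro regular_add(2)[OF regular_linear(1)[OF lin sm(1)] regular_linear(1)[OF lin sm(2)]]) auto
  also have "\<dots> = a * pderivs (i # I) f x + b * pderivs (i # I) g x"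
    using Cons regular_linear(2)[OF lin sm(1)] regular_linear(2)[OF lin sm(2)] by (simp add: pderivs_Cons)
  finally show ?case .
qed simp

section \<open>Derivations at the origin that kill the coordinates\<close>

definition euler :: "nat \<Rightarrow> ((nat \<Rightarrow> real) \<Rightarrow> complex) \<Rightarrow> (nat \<Rightarrow> real) \<Rightarrow> complex"
  where "euler n f x = (\<Sum>i<n. X i x * pderiv_coord i f x)"

lemma smooth_euler: "smooth_fun n f \<Longrightarrow> smooth_fun n (euler n f)"
  unfolding euler_def[abs_def] by (intro smooth_sum smooth_mult smooth_X smooth_pderiv_coord) auto

text \<open>Moving one partial derivative past the Euler field produces one additional copy of that
  derivative, and there are \<open>length I\<close> of them.\<close>

lemma pderivs_euler:
  assumes f: "smooth_fun n f" and "I \<in> lists {..<n}" "x \<in> E n"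
  shows "pderivs I (euler n f) x = euler n (pderivs I f) x + of_nat (length I) * pderivs I f x"
  using assms(2,3)
proof (induction I arbitrary: x)
  case (Cons j I)
  define g where "g = pderivs I f"
  have j: "j < n" and I: "I \<in> lists {..<n}" using Cons by auto
  have g: "smooth_fun n g" unfolding g_def by (rule smooth_pderivs[OF f I])
  have "pderivs (j # I) (euler n f) x = pderiv_coord j (\<lambda>x. euler n g x + of_nat (length I) * g x) x"
    unfolding pderivs_Cons using Cons by (intro pderiv_coord_cong[of n]) (auto simp: g_def)
  also have "\<dots> = pderiv_coord j (euler n g) x + pderiv_coord j (\<lambda>x. of_nat (length I) * g x) x"
    using j Cons.prems by (intro regular_add(2)[of n] smooth_regular smooth_euler smooth_cmult g) auto
  also have "pderiv_coord j (\<lambda>x. of_nat (length I) * g x) x = of_nat (length I) * pderiv_coord j g x"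
    using j Cons.prems by (intro regular_linear(2)[OF bounded_linear_mult_right smooth_regular[OF g]]) auto
  also have "pderiv_coord j (euler n g) x = (\<Sum>i<n. pderiv_coord j (\<lambda>x. X i x * pderiv_coord i g x) x)"
    unfolding euler_def[abs_def] using j Cons.prems
    by (intro regular_sum[of _ n] smooth_regular smooth_mult smooth_X smooth_pderiv_coord g) auto
  also have "\<dots> = (\<Sum>i<n. X i x * pderiv_coord i (pderiv_coord j g) x + (if j = i then pderiv_coord j g x else 0))"
  proof (rule sum.cong[OF refl])
    fix i assume i: "i \<in> {..<n}"
    have "pderiv_coord j (\<lambda>x. X i x * pderiv_coord i g x) x =
       X i x * pderiv_coord j (pderiv_coord i g) x + pderiv_coord j (X i) x * pderiv_coord i g x"
      using i j Cons.prems by (intro regular_mult(2)[of n] smooth_regular smooth_X smooth_pderiv_coord g) auto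
    thus "pderiv_coord j (\<lambda>x. X i x * pderiv_coord i g x) x = X i x * pderiv_coord i (pderiv_coord j g) x + (if j = i then pderiv_coord j g x else 0)"
      using i j Cons.prems by (simp add: pderiv_coord_X[of _ n] Schwarz[OF g])
  qed
  also have "\<dots> = euler n (pderiv_coord j g) x + pderiv_coord j g x"
    using j by (simp add: sum.distrib euler_def)
  finally show ?case by (simp add: g_def pderivs_Cons algebra_simps)
qed simp

text \<open>Subtracting suitable multiples of Euler derivatives, on which a derivation killing the
  coordinates vanishes, removes the Taylor coefficients of \<open>f\<close> of positive degree one degree at a
  time.\<close>

fun flatten :: "nat \<Rightarrow> nat \<Rightarrow> ((nat \<Rightarrow> real) \<Rightarrow> complex) \<Rightarrow> (nat \<Rightarrow> real) \<Rightarrow> complex" where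
  "flatten n 0 f = f"
| "flatten n (Suc j) f = (\<lambda>x. 1 * flatten n j f x + (- 1 / of_nat (Suc j)) * euler n (flatten n j f) x)"

lemma smooth_flatten: "smooth_fun n f \<Longrightarrow> smooth_fun n (flatten n j f)"
proof (induction j)
  case (Suc j)
  thus ?case unfolding flatten.simps by (intro smooth_add smooth_cmult smooth_euler)
qed simp

text \<open>At the origin the Euler field multiplies a derivative of order m by m, so the factor
  added in step j + 1 is 1 - m/(j + 1). It kills order j + 1 and keeps the lower orders at
  0.\<close>

lemma pderivs_flatten:
  assumes f: "smooth_fun n f" and I: "I \<in> lists {..<n}"
  shows "1 \<le> length I \<Longrightarrow> length I \<le> j \<Longrightarrow> pderivs I (flatten n j f) (\<lambda>_. 0) = 0"
proof (induction j)
  case (Suc j)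
  have "pderivs I (flatten n (Suc j) f) (\<lambda>_. 0) =
    1 * pderivs I (flatten n j f) (\<lambda>_. 0) + (- 1 / of_nat (Suc j)) * pderivs I (euler n (flatten n j f)) (\<lambda>_. 0)"
    unfolding flatten.simps by (intro pderivs_lincomb[of n] smooth_flatten smooth_euler f I) auto
  also have "pderivs I (euler n (flatten n j f)) (\<lambda>_. 0) = of_nat (length I) * pderivs I (flatten n j f) (\<lambda>_. 0)"
    using I by (subst pderivs_euler[OF smooth_flatten[OF f]]) (auto simp: euler_def)
  finally have *: "pderivs I (flatten n (Suc j) f) (\<lambda>_. 0) = (1 - of_nat (length I) / of_nat (Suc j)) * pderivs I (flatten n j f) (\<lambda>_. 0)"
    by (simp add: algebra_simps)
  show ?case
  proof (cases "length I = Suc j")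
    case True
    thus ?thesis by (simp add: * del: of_nat_Suc flatten.simps)
  next
    case False
    thus ?thesis using Suc by (simp add: * del: flatten.simps)
  qed
qed simp

text \<open>By the Leibniz rule \<open>D\<close> vanishes on every product of a coordinate with a
  smooth function, hence on Euler derivatives, so \<open>f\<close> may be replaced by a flattened
  function whose derivatives of orders 1 to the order of \<open>D\<close> vanish at 0. Only the
  zeroth-order coefficient of \<open>D\<close> is left, and D 1 = 0 removes it.\<close>

lemma derivation_at_0_eq_0:
  fixes D :: "((nat \<Rightarrow> real) \<Rightarrow> complex) \<Rightarrow> complex"
  assumes C: "finite C" "C \<subseteq> lists {..<n}"
    and D: "\<And>f. smooth_fun n f \<Longrightarrow> D f = (\<Sum>I\<in>C. c I * pderivs I f (\<lambda>_. 0))"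
    and mult: "\<And>f g. smooth_fun n f \<Longrightarrow> smooth_fun n g \<Longrightarrow> D (\<lambda>x. f x * g x) = f (\<lambda>_. 0) * D g + D f * g (\<lambda>_. 0)"
    and DX: "\<And>i. i < n \<Longrightarrow> D (X i) = 0"
    and f: "smooth_fun n f"
  shows "D f = 0"
proof -
  have lin: "D (\<lambda>x. a * f x + b * g x) = a * D f + b * D g" if "smooth_fun n f" "smooth_fun n g" for f g a b
  proof -
    have "D (\<lambda>x. a * f x + b * g x) = (\<Sum>I\<in>C. c I * (a * pderivs I f (\<lambda>_. 0) + b * pderivs I g (\<lambda>_. 0)))"
      using that C by (subst D) (auto intro!: sum.cong smooth_add smooth_cmult simp: pderivs_lincomb[of n] subset_iff)
    also have "\<dots> = a * D f + b * D g"
      using that by (simp add: D sum_distrib_left sum.distrib algebra_simps)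
    finally show ?thesis .
  qed
  have D1: "D (\<lambda>_. 1) = 0"
    using mult[of "\<lambda>_. 1" "\<lambda>_. 1"] by auto
  have sumD: "D (\<lambda>x. \<Sum>i\<in>A. h i x) = (\<Sum>i\<in>A. D (h i))" if "finite A" "\<And>i. i \<in> A \<Longrightarrow> smooth_fun n (h i)" for A :: "nat set" and h
    using that
  proof (induction A rule: finite_induct)
    case empty
    show ?case using lin[of "\<lambda>_. 1" "\<lambda>_. 1" 0 0] by auto
  next
    case (insert i A)
    have "D (\<lambda>x. \<Sum>i\<in>insert i A. h i x) = D (\<lambda>x. 1 * h i x + 1 * (\<Sum>i\<in>A. h i x))"
      using insert by (intro arg_cong[of _ _ D]) auto
    also have "\<dots> = 1 * D (h i) + 1 * D (\<lambda>x. \<Sum>i\<in>A. h i x)"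
      using insert by (intro lin smooth_sum) auto
    finally show ?case using insert by simp
  qed
  have eul: "D (euler n g) = 0" if g: "smooth_fun n g" for g
  proof -
    have "D (euler n g) = (\<Sum>i<n. D (\<lambda>x. X i x * pderiv_coord i g x))"
      unfolding euler_def[abs_def] using g by (intro sumD smooth_mult smooth_X smooth_pderiv_coord) auto
    also have "\<dots> = 0"
      using g by (intro sum.neutral ballI) (subst mult, auto intro!: smooth_pderiv_coord simp: DX)
    finally show ?thesis .
  qed
  have fl: "D (flatten n j f) = D f" for j
  proof (induction j)
    case (Suc j)
    have "D (flatten n (Suc j) f) = 1 * D (flatten n j f) + (- 1 / of_nat (Suc j)) * D (euler n (flatten n j f))"
      unfolding flatten.simps by (intro lin smooth_flatten smooth_euler f)
    thus ?case using Suc eul[OF smooth_flatten[OF f]] by simp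
  qed simp
  \<comment> \<open>The order of the differential operator; the inserted 0 covers an empty
    \<open>C\<close>.\<close>
  define L where "L = Max (insert 0 (length ` C))"
  have L: "length I \<le> L" if "I \<in> C" for I using C that unfolding L_def by (intro Max_ge) auto
  have eq: "D g = (if [] \<in> C then c [] * g (\<lambda>_. 0) else 0)"
    if g: "smooth_fun n g" and z: "\<And>I. I \<in> C \<Longrightarrow> I \<noteq> [] \<Longrightarrow> pderivs I g (\<lambda>_. 0) = 0" for g
  proof -
    have "D g = (\<Sum>I\<in>C. if I = [] then c [] * g (\<lambda>_. 0) else 0)"
      unfolding D[OF g] by (rule sum.cong) (use z in auto)
    thus ?thesis using C by simp
  qed
  \<comment> \<open>\<open>D\<close> takes the constant function 1 to its zeroth-order coefficient,
    and a derivation takes it to 0.\<close>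
  have "(if [] \<in> C then c [] else 0) = 0"
  proof -
    have "pderivs I (\<lambda>_. 1) x = (0::complex)" if "I \<noteq> []" for I x
    proof -
      have "pderivs I (\<lambda>_. 1 :: complex) = (\<lambda>_. if I = [] then 1 else 0)" for I
      proof (induction I)
        case (Cons a I)
        show ?case by (rule ext) (simp add: pderivs_Cons Cons)
      qed simp
      thus ?thesis using that by simp
    qed
    thus ?thesis using eq[OF smooth_const, of 1] D1 by (auto split: if_splits)
  qed
  moreover have "pderivs I (flatten n L f) (\<lambda>_. 0) = 0" if "I \<in> C" "I \<noteq> []" for I
    using that C L[OF that(1)] by (intro pderivs_flatten f) (auto simp: Suc_le_eq)
  ultimately show ?thesis
    using eq[of "flatten n L f"] fl[of L] smooth_flatten[OF f] by (auto split: if_splits)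
qed

section \<open>Smoothness of star products\<close>

lemma formal_smooth_nth: "formal_smooth n F \<Longrightarrow> smooth_fun n (\<lambda>x. fps_nth (F x) k)"
  by (simp add: formal_smooth_def)

lemma formal_smooth_mult:
  fixes F G :: "(nat \<Rightarrow> real) \<Rightarrow> complex fps"
  shows "formal_smooth n F \<Longrightarrow> formal_smooth n G \<Longrightarrow> formal_smooth n (\<lambda>x. F x * G x)"
  unfolding formal_smooth_def fps_mult_nth by (intro allI smooth_sum smooth_mult) auto

lemma formal_smooth_const [simp]: "formal_smooth n (\<lambda>_. c)"
  by (auto simp: formal_smooth_def)

lemma formal_smooth_fps_const: "smooth_fun n f \<Longrightarrow> formal_smooth n (\<lambda>x. fps_const (f x))"
  unfolding formal_smooth_def
proof
  fix k assume "smooth_fun n f"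
  thus "smooth_fun n (\<lambda>x. fps_nth (fps_const (f x)) k)" by (cases k) auto
qed

lemma formal_smooth_sum:
  fixes F :: "'b \<Rightarrow> (nat \<Rightarrow> real) \<Rightarrow> complex fps"
  shows "(\<And>a. a \<in> A \<Longrightarrow> formal_smooth n (F a)) \<Longrightarrow> formal_smooth n (\<lambda>x. \<Sum>a\<in>A. F a x)"
  unfolding formal_smooth_def fps_sum_nth by (intro allI smooth_sum) auto

lemma formal_smooth_prod:
  fixes F :: "'b \<Rightarrow> (nat \<Rightarrow> real) \<Rightarrow> complex fps"
  shows "(\<And>a. a \<in> A \<Longrightarrow> formal_smooth n (F a)) \<Longrightarrow> formal_smooth n (\<lambda>x. \<Prod>a\<in>A. F a x)"
  by (induction A rule: infinite_finite_induct) (auto intro: formal_smooth_mult)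

lemma formal_smooth_pderivs: 
  "formal_smooth n F \<Longrightarrow> I \<in> lists {..<n} \<Longrightarrow> formal_smooth n (formal_pderivs I F)"
  unfolding formal_smooth_def formal_pderivs_def by (simp add: smooth_pderivs)

lemma formal_smooth_half:
  assumes "formal_bivector_field n \<pi>" "i < n" "j < n"
  shows "formal_smooth n (half_bivector \<pi> i j)"
proof -
  have "smooth_fun n (\<lambda>x. fps_nth (\<pi> i j x) k)" for k
    using assms by (auto simp: formal_bivector_field_def formal_smooth_def)
  hence "smooth_fun n (\<lambda>x. (\<lambda>t. complex_of_real (t / 2)) (fps_nth (\<pi> i j x) k))" for k
    by (rule smooth_linear[OF bounded_linear_compose[OF bounded_linear_of_real bounded_linear_divide]])
  thus ?thesis by (simp add: formal_smooth_def half_bivector_def)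
qed

lemma incoming_lists:
  "I \<in> {..<N} \<times> {..<2} \<rightarrow>\<^sub>E {..<n} \<Longrightarrow> incoming N \<Gamma> I v \<in> lists {..<n}"
  by (auto simp: incoming_def edge_list_def PiE_def Pi_def)

lemma formal_smooth_graph_operator:
  assumes "\<And>i j. i < n \<Longrightarrow> j < n \<Longrightarrow> formal_smooth n (\<alpha> i j)" "formal_smooth n f" "formal_smooth n g"
  shows "formal_smooth n (graph_operator n N \<Gamma> \<alpha> f g)"
  unfolding graph_operator_def[abs_def]
  by (intro formal_smooth_sum formal_smooth_mult formal_smooth_prod formal_smooth_pderivs assms incoming_lists)
     (auto simp: PiE_def Pi_def)

definition graph_sum ::
    "nat \<Rightarrow> nat \<Rightarrow> (nat \<Rightarrow> nat \<Rightarrow> formal_function) \<Rightarrow> formal_function \<Rightarrow> formal_function \<Rightarrow> formal_function"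
  where "graph_sum n N \<alpha> f g x =
    (\<Sum>\<Gamma>\<in>kgraphs N. fps_const (complex_of_real (kweight N \<Gamma>)) * graph_operator n N \<Gamma> \<alpha> f g x)"

lemma star_product_nth:
  "fps_nth (star_product n \<pi> f g x) K = (\<Sum>N\<le>K. fps_nth (graph_sum n N (half_bivector \<pi>) f g x) (K - N))"
  unfolding star_product_def fps_nth_Abs_fps fps_sum_nth graph_sum_def[symmetric]
  by (rule sum.cong) (simp_all add: fps_X_power_mult_nth)

lemma formal_smooth_star_product:
  assumes "formal_bivector_field n \<pi>" "formal_smooth n f" "formal_smooth n g"
  shows "formal_smooth n (star_product n \<pi> f g)"
proof -
  have "formal_smooth n (graph_sum n N (half_bivector \<pi>) f g)" for N
    unfolding graph_sum_def[abs_def] using assms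
    by (intro formal_smooth_sum formal_smooth_mult formal_smooth_const formal_smooth_graph_operator formal_smooth_half)
  thus ?thesis
    unfolding formal_smooth_def star_product_nth by (intro allI smooth_sum) (simp add: formal_smooth_def)
qed

section \<open>The Poisson structure on R^8\<close>

text \<open>Structure constants of (sl(2) semidirect R^2) + so(3). Coordinates 0, 1, 2 are e, f, h
  with [e, f] = h, [h, e] = 2e, [h, f] = -2f; 3 and 4 span the standard representation of sl(2); 5,
  6, 7 are the standard basis of so(3). Each bracket is a multiple of one basis vector, so a table
  of coefficients and one of indices suffice; the index is 0 where the coefficient is 0.\<close>

definition coeff_table :: "real list list"
  where "coeff_table =
    [[ 0,  1, -2,  0,  1,  0,  0,  0],
     [-1,  0,  2,  1,  0,  0,  0,  0],
     [ 2, -2,  0,  1, -1,  0,  0,  0],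
     [ 0, -1, -1,  0,  0,  0,  0,  0],
     [-1,  0,  1,  0,  0,  0,  0,  0],
     [ 0,  0,  0,  0,  0,  0,  1, -1],
     [ 0,  0,  0,  0,  0, -1,  0,  1],
     [ 0,  0,  0,  0,  0,  1, -1,  0]]"

definition index_table :: "nat list list"
  where "index_table =
    [[0, 2, 0, 0, 3, 0, 0, 0],
     [2, 0, 1, 4, 0, 0, 0, 0],
     [0, 1, 0, 3, 4, 0, 0, 0],
     [0, 4, 3, 0, 0, 0, 0, 0],
     [3, 0, 4, 0, 0, 0, 0, 0],
     [0, 0, 0, 0, 0, 0, 7, 6],
     [0, 0, 0, 0, 0, 7, 0, 5],
     [0, 0, 0, 0, 0, 6, 5, 0]]"

lemmas coeff_rows =
  coeff_table_def[THEN arg_cong, of "\<lambda>t. t ! 0", simplified]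
  coeff_table_def[THEN arg_cong, of "\<lambda>t. t ! 1", simplified]
  coeff_table_def[THEN arg_cong, of "\<lambda>t. t ! 2", simplified]
  coeff_table_def[THEN arg_cong, of "\<lambda>t. t ! 3", simplified]
  coeff_table_def[THEN arg_cong, of "\<lambda>t. t ! 4", simplified]
  coeff_table_def[THEN arg_cong, of "\<lambda>t. t ! 5", simplified]
  coeff_table_def[THEN arg_cong, of "\<lambda>t. t ! 6", simplified]
  coeff_table_def[THEN arg_cong, of "\<lambda>t. t ! 7", simplified]

lemmas index_rows =
  index_table_def[THEN arg_cong, of "\<lambda>t. t ! 0", simplified]
  index_table_def[THEN arg_cong, of "\<lambda>t. t ! 1", simplified]
  index_table_def[THEN arg_cong, of "\<lambda>t. t ! 2", simplified]
  index_table_def[THEN arg_cong, of "\<lambda>t. t ! 3", simplified]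
  index_table_def[THEN arg_cong, of "\<lambda>t. t ! 4", simplified]
  index_table_def[THEN arg_cong, of "\<lambda>t. t ! 5", simplified]
  index_table_def[THEN arg_cong, of "\<lambda>t. t ! 6", simplified]
  index_table_def[THEN arg_cong, of "\<lambda>t. t ! 7", simplified]

definition lin :: "nat \<Rightarrow> nat \<Rightarrow> nat \<Rightarrow> real"
  where "lin i j k = (if k = index_table ! i ! j then coeff_table ! i ! j else 0)"

definition quad :: "nat \<Rightarrow> nat \<Rightarrow> real"
  where "quad i j = (if i = 3 \<and> j = 4 then 1 else if i = 4 \<and> j = 3 then -1 else 0)"

text \<open>The Lie-Poisson bivector plus the so(3) Casimir function times the sl(2)-invariant area
  form on the plane of coordinates 3 and 4.\<close>

definition pi0 :: "nat \<Rightarrow> nat \<Rightarrow> (nat \<Rightarrow> real) \<Rightarrow> real"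
  where "pi0 i j x = coeff_table ! i ! j * x (index_table ! i ! j) + quad i j * ((x 5)\<^sup>2 + (x 6)\<^sup>2 + (x 7)\<^sup>2)"

definition dpi0 :: "nat \<Rightarrow> nat \<Rightarrow> nat \<Rightarrow> (nat \<Rightarrow> real) \<Rightarrow> real"
  where "dpi0 l i j x = lin i j l + quad i j * (if 5 \<le> l \<and> l < 8 then 2 * x l else 0)"

lemma all_less_8: "(\<forall>i<(8::nat). P i) \<longleftrightarrow> P 0 \<and> P 1 \<and> P 2 \<and> P 3 \<and> P 4 \<and> P 5 \<and> P 6 \<and> P 7"
  by (simp add: eval_nat_numeral less_Suc_eq all_conj_distrib) 

lemma tables: "length coeff_table = 8" "length index_table = 8" "i < 8 \<Longrightarrow> j < 8 \<Longrightarrow> index_table ! i ! j < 8"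
proof -
  have "\<forall>i<8. \<forall>j<8. index_table ! i ! j < 8"
    unfolding all_less_8 by (simp add: index_table_def)
  thus "i < 8 \<Longrightarrow> j < 8 \<Longrightarrow> index_table ! i ! j < 8" by blast
qed (simp_all add: coeff_table_def index_table_def)

text \<open>The second part expresses that so(3) is a direct summand: a nonzero structure constant
  has all its indices in so(3) or all outside it. The elimination of graphs in \<open>op_3\<close>
  depends on this.\<close>

lemma lin_props:
  assumes "i < 8" "j < 8" "k < 8"
  shows "lin j i k = - lin i j k" and "lin i j k \<noteq> 0 \<Longrightarrow> (5 \<le> j \<longleftrightarrow> 5 \<le> i) \<and> (5 \<le> k \<longleftrightarrow> 5 \<le> i)"
proof -
  have "\<forall>i<8. \<forall>j<8. coeff_table ! j ! i = - coeff_table ! i ! j \<and> index_table ! j ! i = index_table ! i ! j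
      \<and> (coeff_table ! i ! j \<noteq> 0 \<longrightarrow> (5 \<le> j \<longleftrightarrow> 5 \<le> i) \<and> (5 \<le> index_table ! i ! j \<longleftrightarrow> 5 \<le> i))"
    unfolding all_less_8 by (simp add: index_rows coeff_rows)
  from this[rule_format, OF assms(1,2)]
  show "lin j i k = - lin i j k" "lin i j k \<noteq> 0 \<Longrightarrow> (5 \<le> j \<longleftrightarrow> 5 \<le> i) \<and> (5 \<le> k \<longleftrightarrow> 5 \<le> i)"
    by (auto simp: lin_def split: if_splits)
qed

lemma quad_antisym: "quad j i = - quad i j" by (simp add: quad_def)

lemma pi0_antisym:
  assumes "i < 8" "j < 8"
  shows "pi0 j i x = - pi0 i j x"
proof -
  have "\<forall>i<8. \<forall>j<8. coeff_table ! j ! i = - coeff_table ! i ! j \<and> index_table ! j ! i = index_table ! i ! j"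
    unfolding all_less_8 by (simp add: index_rows coeff_rows)
  from this[rule_format, OF assms] show ?thesis by (simp add: pi0_def quad_antisym[of j i])
qed

lemma dpi0_antisym: "i < 8 \<Longrightarrow> j < 8 \<Longrightarrow> l < 8 \<Longrightarrow> dpi0 l j i x = - dpi0 l i j x"
  by (simp add: dpi0_def lin_props(1)[of i j] quad_antisym[of j i])

definition jacobiator :: "nat \<Rightarrow> nat \<Rightarrow> nat \<Rightarrow> (nat \<Rightarrow> real) \<Rightarrow> real"
  where "jacobiator i j k x = (\<Sum>l<8. pi0 i l x * dpi0 l j k x + pi0 j l x * dpi0 l k i x + pi0 k l x * dpi0 l i j x)"

lemma sum_lessThan_8: "(\<Sum>l<(8::nat). F l) = F 0 + F 1 + F 2 + F 3 + F 4 + F 5 + F 6 + (F 7 :: real)"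
  by (simp add: eval_nat_numeral)

text \<open>Verified by direct computation. Conceptually, the linear part is a Lie algebra, the
  action of sl(2) on the plane has trace 0, and the Casimir function Poisson-commutes with all
  coordinates.\<close>

lemma jacobiator_sorted: "\<forall>i<8. \<forall>j<8. \<forall>k<8. i < j \<longrightarrow> j < k \<longrightarrow> jacobiator i j k x = 0"
  unfolding all_less_8
  by (intro conjI impI; simp add: jacobiator_def sum_lessThan_8 pi0_def dpi0_def lin_def quad_def coeff_rows index_rows)

lemma jacobiator_eq_0:
  assumes "i < 8" "j < 8" "k < 8"
  shows "jacobiator i j k x = 0"
proof -
  have rot: "jacobiator i j k x = jacobiator j k i x" for i j k
    unfolding jacobiator_def by (rule sum.cong) auto
  have swap: "jacobiator j i k x = - jacobiator i j k x" if "i < 8" "j < 8" "k < 8" for i j k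
    unfolding jacobiator_def sum_negf[symmetric] using that
    by (intro sum.cong) (auto simp: dpi0_antisym[of i k] dpi0_antisym[of k j] dpi0_antisym[of i j])
  have *: "jacobiator i j k x = 0" if "i < j" "j < k" "k < 8" for i j k
    using jacobiator_sorted[of x] that by auto
  have eq: "jacobiator i i k x = 0" if "i < 8" "k < 8" for i k
    using swap[of i i k] that by simp
  consider "i = j" | "j = k" | "i = k" | "i < j \<and> j < k" | "j < k \<and> k < i" | "k < i \<and> i < j" | "j < i \<and> i < k" | "i < k \<and> k < j" | "k < j \<and> j < i"
    by linarith
  thus ?thesis
  proof cases
    case 1 thus ?thesis using eq assms by simp
  next case 2 thus ?thesis using eq[of j i] rot[of i j j] assms by simp
  next case 3 thus ?thesis using eq[of i j] rot[of i j i] rot[of j i i] assms by simp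
  next case 4 thus ?thesis using * assms by simp
  next case 5 thus ?thesis using *[of j k i] rot[of i j k] assms by simp
  next case 6 thus ?thesis using *[of k i j] rot[of k i j] assms by simp
  next case 7 thus ?thesis using *[of j i k] swap[of j i k] assms by simp
  next case 8 thus ?thesis using *[of i k j] swap[of k j i] rot[of i j k] rot[of i k j] assms by simp
  next case 9 thus ?thesis using *[of k j i] swap[of k j i] rot[of i j k] assms by simp
  qed
qed

text \<open>The inner double sum is the trace of the square of ad(x_a), which equals -2 for each of
  the three basis vectors of so(3).\<close>

lemma killing: "(\<Sum>a\<in>{5, 6, 7}. \<Sum>c<8. \<Sum>d<8. lin a d c * lin a c d) = - 6"
  by (simp add: sum_lessThan_8 lin_def coeff_rows index_rows)

section \<open>Recognising apex graphs by counting edges\<close>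

definition apex_graph :: "nat \<Rightarrow> nat \<Rightarrow> nat \<Rightarrow> kgraph \<Rightarrow> bool"
  where "apex_graph k u v t \<longleftrightarrow> (\<exists>i<2. \<exists>j<2. \<exists>l<2.
     t (u, i) = Vertex v \<and> t (u, 1 - i) = Vertex k \<and> t (v, j) = Vertex u \<and> t (v, 1 - j) = Vertex k \<and>
     t (k, l) = VL \<and> t (k, 1 - l) = VR)"

definition edges_between :: "kgraph \<Rightarrow> nat \<Rightarrow> vertex \<Rightarrow> nat"
  where "edges_between t k x = of_bool (t (k, 0) = x) + of_bool (t (k, 1) = x)"

lemma edges_between_1:
  assumes "edges_between t x y = 1"
  shows "\<exists>i<2. t (x, 1 - i) = y \<and> t (x, i) \<noteq> y"
proof (cases "t (x, 0) = y")
  case True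
  thus ?thesis using assms by (intro exI[of _ 1]) (auto simp: edges_between_def)
next
  case False
  hence "t (x, 1) = y" using assms by (cases "t (x, 1) = y") (simp_all add: edges_between_def)
  thus ?thesis using False by (intro exI[of _ 0]) simp
qed

text \<open>The edges marked by \<open>s\<close> carry an \<open>so(3)\<close> index. The apex \<open>k\<close> is the vertex with
  two incoming edges.\<close>

lemma apex_graphI:
  fixes t :: kgraph and s :: "nat \<times> nat \<Rightarrow> bool"
  defines "c \<equiv> edges_between t"
  assumes t: "\<And>b. b < 2 \<Longrightarrow> t (k, b) \<in> {Vertex u, Vertex v, VL, VR}"
      "\<And>b. b < 2 \<Longrightarrow> t (u, b) \<in> {Vertex k, Vertex v, VL, VR}"
      "\<And>b. b < 2 \<Longrightarrow> t (v, b) \<in> {Vertex k, Vertex u, VL, VR}"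
    and kuv: "distinct [k, u, v]"
    and nk: "c u (Vertex k) + c v (Vertex k) = 2"
    and nu: "c k (Vertex u) + c v (Vertex u) = 1"
    and nv: "c k (Vertex v) + c u (Vertex v) = 1"
    and nL: "c k VL + c u VL + c v VL = 1" and nR: "c k VR + c u VR + c v VR = 1"
    and LR: "\<And>e. fst e \<in> {k, u, v} \<Longrightarrow> t e = VL \<or> t e = VR \<Longrightarrow> snd e < 2 \<Longrightarrow> \<not> s e"
    and su: "s (u, 0) = s (u, 1)" and sv: "s (v, 0) = s (v, 1)" and sk: "\<And>e. fst e \<in> {k, u, v} \<Longrightarrow> t e = Vertex k \<Longrightarrow> snd e < 2 \<Longrightarrow> s e"
    and two: "c u (Vertex k) < 2" "c v (Vertex k) < 2"
  shows "apex_graph k u v t"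
proof -
  have c1: "edges_between t u (Vertex k) = 1" "edges_between t v (Vertex k) = 1"
    using nk two unfolding c_def by linarith+
  obtain i where i: "i < 2" "t (u, 1 - i) = Vertex k" "t (u, i) \<noteq> Vertex k"
    using edges_between_1[OF c1(1)] by blast
  obtain j where j: "j < 2" "t (v, 1 - j) = Vertex k" "t (v, j) \<noteq> Vertex k"
    using edges_between_1[OF c1(2)] by blast
  note ij = i(1) j(1) i(2,3) j(2,3)
  have b2: "b = 0 \<or> b = 1" if "b < 2" for b :: nat using that by auto
  \<comment> \<open>The spokes at \<open>u\<close> and \<open>v\<close> carry so(3) indices, hence
    so do the other edges of these vertices. Those cannot end at L or R and must run along the
    rim.\<close>
  have "s (u, 1 - i)" "s (v, 1 - j)" using sk[of "(u, 1 - i)"] sk[of "(v, 1 - j)"] ij by auto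
  hence "s (u, i)" "s (v, j)" using su sv b2[OF ij(1)] b2[OF ij(2)] by auto
  hence uv: "t (u, i) = Vertex v" "t (v, j) = Vertex u"
    using t(2)[OF ij(1)] t(3)[OF ij(2)] LR[of "(u, i)"] LR[of "(v, j)"] ij by auto
  \<comment> \<open>The rim edges use up the single incoming edge of \<open>u\<close> and of
    \<open>v\<close>, so both edges of the apex go to L and R.\<close>
  have "c v (Vertex u) \<ge> 1" "c u (Vertex v) \<ge> 1"
    using uv b2[OF ij(1)] b2[OF ij(2)] unfolding c_def edges_between_def by auto
  hence "c k (Vertex u) = 0" "c k (Vertex v) = 0" using nu nv by auto
  hence "t (k, b) \<in> {VL, VR}" if "b < 2" for b
    using t(1)[OF that] b2[OF that] unfolding c_def edges_between_def by (auto split: if_splits)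
  hence k01: "t (k, 0) \<in> {VL, VR}" "t (k, 1) \<in> {VL, VR}" by auto
  have "\<not> (t (k, 0) = VL \<and> t (k, 1) = VL)" "\<not> (t (k, 0) = VR \<and> t (k, 1) = VR)"
    using nL nR unfolding c_def edges_between_def by auto
  hence "\<exists>l<2. t (k, l) = VL \<and> t (k, 1 - l) = VR"
    using k01 by (cases "t (k, 0) = VL") (auto intro: exI[of _ 0] exI[of _ 1])
  with ij uv show ?thesis unfolding apex_graph_def by blast
qed

section \<open>Derivatives of \<open>pi0\<close> and the Poisson property\<close>

lemma dpi0_eq: "l < 8 \<Longrightarrow> i < 8 \<Longrightarrow> j < 8 \<Longrightarrow> ((\<lambda>t. pi0 i j (x(l := t))) has_vector_derivative dpi0 l i j x) (at (x l))"
proof -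
  assume l: "l < 8" "i < 8" "j < 8"
  define b where "b = index_table ! i ! j"
  have c: "((\<lambda>t. (x(l := t)) k) has_real_derivative (if l = k then 1 else 0)) (at (x l))" for k
    by (auto intro!: derivative_eq_intros)
  have "((\<lambda>t. coeff_table ! i ! j * (x(l := t)) b + quad i j * (((x(l := t)) 5)\<^sup>2 + ((x(l := t)) 6)\<^sup>2 + ((x(l := t)) 7)\<^sup>2)) has_real_derivative
     coeff_table ! i ! j * (if l = b then 1 else 0) + quad i j * (2 * (if l = 5 then 1 else 0) * x 5 + 2 * (if l = 6 then 1 else 0) * x 6 + 2 * (if l = 7 then 1 else 0) * x 7)) (at (x l))"
    by (rule derivative_eq_intros c refl)+ (simp add: algebra_simps)
  also have "coeff_table ! i ! j * (if l = b then 1 else 0) + quad i j * (2 * (if l = 5 then 1 else 0) * x 5 + 2 * (if l = 6 then 1 else 0) * x 6 + 2 * (if l = 7 then 1 else 0) * x 7)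
     = dpi0 l i j x"
  proof -
    have "l = 5 \<or> l = 6 \<or> l = 7 \<or> l < 5" using l by linarith
    thus ?thesis by (auto simp: dpi0_def lin_def b_def)
  qed
  finally show ?thesis by (simp add: pi0_def b_def has_real_derivative_iff_has_vector_derivative)
qed

lemma smooth_const_mult_real: "smooth_fun n f \<Longrightarrow> smooth_fun n (\<lambda>x. c * f x)" for c :: real
  by (intro smooth_mult smooth_const)

lemma smooth_pi0:
  assumes "i < 8" "j < 8"
  shows "smooth_fun 8 (pi0 i j)"
  unfolding pi0_def[abs_def] power2_eq_square
  by (intro smooth_add smooth_const_mult_real smooth_mult smooth_coordinate(1)) (use tables(3)[OF assms] in auto)

lemma pderivs_pi0_1: "l < 8 \<Longrightarrow> i < 8 \<Longrightarrow> j < 8 \<Longrightarrow> pderiv_coord l (pi0 i j) x = dpi0 l i j x"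
  by (intro pderiv_coord_eqI dpi0_eq)

lemma pderiv_coord_dpi0:
  "l < 8 \<Longrightarrow> pderiv_coord k (dpi0 l i j) x = quad i j * (if k = l \<and> 5 \<le> l then 2 else 0)"
proof (rule pderiv_coord_eqI)
  assume "l < 8"
  have c: "((\<lambda>t. (x(k := t)) l) has_real_derivative (if k = l then 1 else 0)) (at (x k))"
    by (auto intro!: derivative_eq_intros)
  have "((\<lambda>t. lin i j l + quad i j * (of_bool (5 \<le> l) * (2 * (x(k := t)) l))) has_real_derivative
     quad i j * (of_bool (5 \<le> l) * (2 * (if k = l then 1 else 0)))) (at (x k))"
    by (auto intro!: derivative_eq_intros c)
  also have "(\<lambda>t. lin i j l + quad i j * (of_bool (5 \<le> l) * (2 * (x(k := t)) l))) = (\<lambda>t. dpi0 l i j (x(k := t)))"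
    using \<open>l < 8\<close> by (auto simp: dpi0_def fun_eq_iff)
  also have "quad i j * (of_bool (5 \<le> l) * (2 * (if k = l then 1 else 0))) = quad i j * (if k = l \<and> 5 \<le> l then 2 else 0)" by auto
  finally show "((\<lambda>t. dpi0 l i j (x(k := t))) has_vector_derivative quad i j * (if k = l \<and> 5 \<le> l then 2 else 0)) (at (x k))"
    by (simp only: has_real_derivative_iff_has_vector_derivative)
qed

lemma pderivs_zero_fun: "I \<noteq> [] \<Longrightarrow> pderivs I (\<lambda>_. c) = (\<lambda>_. 0)"
proof (induction I)
  case (Cons i I)
  thus ?case by (cases "I = []") (auto simp: pderivs_Cons)
qed simp

lemma pderivs_pi0:
  assumes ij: "i < 8" "j < 8" and L: "L \<in> lists {..<8}"
  shows "pderivs L (pi0 i j) (\<lambda>_. 0) = (case L of [] \<Rightarrow> 0 | [k] \<Rightarrow> lin i j k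
    | [k, l] \<Rightarrow> quad i j * (if k = l \<and> 5 \<le> l then 2 else 0) | _ \<Rightarrow> 0)"
proof -
  consider "L = []" | k where "L = [k]" | L' k l where "L = L' @ [k, l]"
    by (metis append_Cons append_Nil append_assoc rev_exhaust)
  thus ?thesis
  proof cases
    case 3
    have kl: "k < 8" "l < 8" "L' \<in> lists {..<8}" using L 3 by auto
    have "pderivs [k, l] (pi0 i j) x = quad i j * (if k = l \<and> 5 \<le> l then 2 else 0)" for x
    proof -
      have "pderiv_coord l (pi0 i j) = dpi0 l i j" using pderivs_pi0_1[OF kl(2) ij] by (rule ext)
      thus ?thesis using kl by (simp add: pderivs_Cons pderiv_coord_dpi0)
    qed
    hence e: "pderivs [k, l] (pi0 i j) = (\<lambda>_. quad i j * (if k = l \<and> 5 \<le> l then 2 else 0))" by (rule ext)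
    show ?thesis
    proof (cases "L' = []")
      case True
      thus ?thesis using e 3 by simp
    next
      case False
      have "pderivs L (pi0 i j) = (\<lambda>_. 0)" unfolding 3 pderivs_append e by (rule pderivs_zero_fun[OF False])
      thus ?thesis using False 3 by (auto split: list.split simp: append_eq_Cons_conv)
    qed
  qed (use ij L pderivs_pi0_1 in \<open>auto simp: pi0_def dpi0_def pderivs_Cons\<close>)
qed

lemma formal_smooth_fps_const_real:
  fixes f :: "(nat \<Rightarrow> real) \<Rightarrow> real"
  assumes "smooth_fun n f"
  shows "formal_smooth n (\<lambda>x. fps_const (f x))"
  unfolding formal_smooth_def
proof
  fix k
  show "smooth_fun n (\<lambda>x. fps_nth (fps_const (f x)) k)" using assms by (cases k) auto
qed

lemma formal_pderivs_fps_const: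
  "formal_pderivs I (\<lambda>x. fps_const (f x)) x = fps_const (pderivs I f x)"
proof (rule fps_ext)
  fix k
  show "fps_nth (formal_pderivs I (\<lambda>x. fps_const (f x)) x) k = fps_nth (fps_const (pderivs I f x)) k"
    by (cases k; cases "I = []") (auto simp: formal_pderivs_def pderivs_zero_fun)
qed

lemma poisson_pi0: "poisson_structure 8 pi0"
proof -
  have d: "formal_pderivs [l] (const_bivector pi0 i j) x = fps_const (dpi0 l i j x)" if "l < 8" "i < 8" "j < 8" for l i j x
    using formal_pderivs_fps_const[of "[l]" "pi0 i j" x] that
    by (simp add: const_bivector_def[abs_def] pderivs_Cons pderivs_pi0_1)
  have "schouten_bracket 8 (const_bivector pi0) (const_bivector pi0) i j k x = fps_const (2 * jacobiator i j k x)"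
    if "i < 8" "j < 8" "k < 8" for i j k x
  proof -
    have "schouten_bracket 8 (const_bivector pi0) (const_bivector pi0) i j k x =
       (\<Sum>l<8. fps_const (2 * (pi0 i l x * dpi0 l j k x + pi0 j l x * dpi0 l k i x + pi0 k l x * dpi0 l i j x)))"
      unfolding schouten_bracket_def using that
      by (intro sum.cong refl) (simp add: d const_bivector_def[of pi0 _ _ x] algebra_simps)
    also have "\<dots> = fps_const (2 * jacobiator i j k x)"
      by (rule fps_ext) (simp add: fps_sum_nth jacobiator_def sum_distrib_left)
    finally show ?thesis .
  qed
  hence 1: "\<forall>i<8. \<forall>j<8. \<forall>k<8. \<forall>x \<in> E 8. schouten_bracket 8 (const_bivector pi0) (const_bivector pi0) i j k x = 0"
    by (simp add: jacobiator_eq_0)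
  have 2: "formal_smooth 8 (const_bivector pi0 i j)" if "i < 8" "j < 8" for i j
    using formal_smooth_fps_const_real[OF smooth_pi0[OF that]] by (simp add: const_bivector_def[abs_def])
  have 3: "const_bivector pi0 j i x = - const_bivector pi0 i j x" if "i < 8" "j < 8" for i j x
    using pi0_antisym[OF that] by (simp add: const_bivector_def)
  show ?thesis
    unfolding poisson_structure_def formal_poisson_def formal_bivector_field_def
    by (intro conjI allI impI ballI 2 3 1[rule_format]) assumption+
qed

section \<open>Graph sums with at most two vertices\<close>

lemma sum_PiE_insert:
  assumes "x \<notin> S"
  shows "(\<Sum>g\<in>PiE (insert x S) T. F g) = (\<Sum>y\<in>T x. \<Sum>g\<in>PiE S T. F (g(x := y)))"
proof -
  have "(\<Sum>g\<in>PiE (insert x S) T. F g) = (\<Sum>(y, g)\<in>T x \<times> PiE S T. F (g(x := y)))"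
    unfolding PiE_insert_eq by (subst sum.reindex[OF inj_combinator[OF assms]]) (auto simp: split_beta intro!: sum.cong)
  also have "\<dots> = (\<Sum>y\<in>T x. \<Sum>g\<in>PiE S T. F (g(x := y)))" by (rule sum.cartesian_product[symmetric])
  finally show ?thesis .
qed

lemma pderivs_X:
  assumes "a < n" "L \<in> lists {..<n}" "x \<in> E n"
  shows "pderivs L (X a) x = (case L of [] \<Rightarrow> X a x | [i] \<Rightarrow> of_bool (i = a) | _ \<Rightarrow> 0)"
proof -
  consider "L = []" | k where "L = [k]" | L' k where "L = L' @ [k]" "L' \<noteq> []"
    by (metis append_Nil rev_exhaust)
  thus ?thesis
  proof cases
    case 3
    have k: "k < n" "L' \<in> lists {..<n}" using assms 3 by auto
    have "pderivs L (X a) x = pderivs L' (\<lambda>_. of_bool (k = a)) x"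
      unfolding 3 pderivs_snoc by (rule pderivs_cong) (use k assms pderiv_coord_X in auto)
    also have "\<dots> = 0" using pderivs_zero_fun[OF 3(2)] by metis
    finally show ?thesis using 3 by (auto split: list.split simp: append_eq_Cons_conv)
  qed (use assms in \<open>auto simp: pderivs_Cons pderiv_coord_X[of a n]\<close>)
qed

lemma formal_pderivs_Nil [simp]: "formal_pderivs [] F x = F x"
  by (rule fps_ext) (simp add: formal_pderivs_def)

lemma kgraphs_no_loop:
  assumes "\<Gamma> \<in> kgraphs N" "k < N" "b < 2"
  shows "\<Gamma> (k, b) \<in> (Vertex ` {..<N} \<union> {VL, VR}) - {Vertex k}"
  using PiE_mem[OF assms(1)[unfolded kgraphs_def], of "(k, b)"] assms by auto

lemma kgraphs_0: "kgraphs 0 = {\<lambda>_. undefined}"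
  by (simp add: kgraphs_def)

text \<open>The empty determinant is 1, and the only configuration of no points has mass 1.\<close>

lemma kweight_0: "kweight 0 \<Gamma> = 1"
proof -
  have "configurations 0 = {\<lambda>_. undefined}" by (auto simp: configurations_def)
  moreover have "weight_density 0 \<Gamma> p = 1" for p unfolding weight_density_def by (simp add: det_dim_zero)
  ultimately show ?thesis
    by (simp add: kweight_def set_lebesgue_integral_def PiM_empty lebesgue_integral_count_space_finite)
qed

lemma graph_sum_0: "graph_sum n 0 \<alpha> f g x = f x * g x"
  by (simp add: graph_sum_def kgraphs_0 kweight_0 graph_operator_def incoming_def edge_list_def)

lemma edge_sets: "{..<1::nat} \<times> {..<2::nat} = {(0, 0), (0, 1)}"
  "{..<2::nat} \<times> {..<2::nat} = {(0, 0), (0, 1), (1, 0), (1, 1)}"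
  by auto

lemma edge_lists: "edge_list (Suc 0) = [(0, 0), (0, 1)]" "edge_list 2 = [(0, 0), (0, 1), (1, 0), (1, 1)]"
  "edge_list 3 = [(0, 0), (0, 1), (1, 0), (1, 1), (2, 0), (2, 1)]"
  by (simp_all add: edge_list_def upt_rec eval_nat_numeral)

text \<open>No edge can enter the only vertex, so \<alpha> occurs undifferentiated.\<close>

lemma graph_sum_1_eq_0:
  assumes "\<And>i j. i < n \<Longrightarrow> j < n \<Longrightarrow> \<alpha> i j x = 0"
  shows "graph_sum n 1 \<alpha> f g x = 0"
proof -
  have "graph_operator n 1 \<Gamma> \<alpha> f g x = 0" if "\<Gamma> \<in> kgraphs 1" for \<Gamma>
    unfolding graph_operator_def
  proof (intro sum.neutral ballI)
    fix I assume I: "I \<in> {..<1::nat} \<times> {..<2::nat} \<rightarrow>\<^sub>E {..<n}"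
    have i: "I (0, b) < n" if "b < 2" for b using PiE_mem[OF I, of "(0, b)"] that by auto
    have "\<Gamma> (0, b) \<noteq> Vertex 0" if "b < 2" for b using kgraphs_no_loop[OF \<open>\<Gamma> \<in> _\<close>, of 0 b] that by auto
    from this[of 0] this[of 1] have "incoming 1 \<Gamma> I (Vertex 0) = []" by (simp add: incoming_def edge_lists)
    thus "(\<Prod>k<1. formal_pderivs (incoming 1 \<Gamma> I (Vertex k)) (\<alpha> (I (k, 0)) (I (k, 1))) x) *
          formal_pderivs (incoming 1 \<Gamma> I VL) f x * formal_pderivs (incoming 1 \<Gamma> I VR) g x = 0"
      using i by (simp add: assms)
  qed
  thus ?thesis unfolding graph_sum_def by (intro sum.neutral) simp
qed

lemma mult_if_1: "x * (if P then 1 else 0) = (if P then x else (0 :: complex fps))"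
  by simp

lemma sum_if_const: "(\<Sum>x\<in>A. if P then F x else 0) = (if P then \<Sum>x\<in>A. F x else 0)"
  by simp

lemma formal_pderivs_X:
  assumes "a < n" "L \<in> lists {..<n}" "x \<in> E n" "L \<noteq> []"
  shows "formal_pderivs L (\<lambda>x. fps_const (X a x)) x = (if L = [a] then 1 else 0)"
  using assms by (simp add: formal_pderivs_fps_const pderivs_X[of a n] split: list.split)

text \<open>A graph with both edges at L or both at R differentiates a coordinate twice. The other
  two graphs have opposite weights and, by antisymmetry, opposite operators, so they add up, which
  doubles the weight.\<close>

lemma graph_sum_1:
  "\<exists>w > 0. \<forall>n \<alpha> a b x. a < n \<longrightarrow> b < n \<longrightarrow> x \<in> E n \<longrightarrow> \<alpha> b a x = - \<alpha> a b x \<longrightarrow>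
     graph_sum n 1 \<alpha> (\<lambda>x. fps_const (X a x)) (\<lambda>x. fps_const (X b x)) x = fps_const (of_real w) * \<alpha> a b x"
proof -
  obtain w where w: "w > 0"
    "\<And>\<Gamma> l. l < 2 \<Longrightarrow> \<Gamma> (0, l) = VL \<Longrightarrow> \<Gamma> (0, 1 - l) = VR \<Longrightarrow> kweight 1 \<Gamma> = (-1) ^ l * w"
    using kweight_1 by blast
  show ?thesis
  proof (intro exI[of _ "2 * w"] conjI allI impI)
    show "0 < 2 * w" using w by simp
    fix n a b and \<alpha> :: "nat \<Rightarrow> nat \<Rightarrow> formal_function" and x :: "nat \<Rightarrow> real"
    assume ab: "a < n" "b < n" "x \<in> E n" and anti: "\<alpha> b a x = - \<alpha> a b x"
    let ?op = "\<lambda>\<Gamma>. graph_operator n 1 \<Gamma> \<alpha> (\<lambda>x. fps_const (X a x)) (\<lambda>x. fps_const (X b x)) x"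
    let ?\<Gamma> = "\<lambda>s t. (\<lambda>_. undefined)((0, 1) := t, (0, 0) := s) :: kgraph"
    have op: "?op (?\<Gamma> s t) = (\<Sum>i<n. \<Sum>j<n. \<alpha> i j x *
        formal_pderivs ((if s = VL then [i] else []) @ (if t = VL then [j] else [])) (\<lambda>x. fps_const (X a x)) x *
        formal_pderivs ((if s = VR then [i] else []) @ (if t = VR then [j] else [])) (\<lambda>x. fps_const (X b x)) x)"
      if "s \<in> {VL, VR}" "t \<in> {VL, VR}" for s t
      unfolding graph_operator_def edge_sets using that
      by (subst sum_PiE_insert, simp, subst sum_PiE_insert) (auto simp: incoming_def edge_lists intro!: sum.cong)
    have two: "?op (?\<Gamma> VL VL) = 0" "?op (?\<Gamma> VR VR) = 0"
      by (subst op; simp add: formal_pderivs_X[of _ n] ab)+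
    have LR: "?op (?\<Gamma> VL VR) = \<alpha> a b x" "?op (?\<Gamma> VR VL) = \<alpha> b a x"
      by (subst op; simp add: formal_pderivs_X[of _ n] ab mult_if_1 sum_if_const)+
    have K: "kgraphs 1 = ({(0, 0), (0, 1)} \<rightarrow>\<^sub>E {VL, VR} :: kgraph set)"
      unfolding kgraphs_def edge_sets by (rule PiE_cong) auto
    have "graph_sum n 1 \<alpha> (\<lambda>x. fps_const (X a x)) (\<lambda>x. fps_const (X b x)) x =
       (\<Sum>s\<in>{VL, VR}. \<Sum>t\<in>{VL, VR}. fps_const (of_real (kweight 1 (?\<Gamma> s t))) * ?op (?\<Gamma> s t))"
      unfolding graph_sum_def K by (simp add: sum_PiE_insert) (simp add: fun_upd_def)
    also have "\<dots> = fps_const (of_real w) * \<alpha> a b x - fps_const (of_real w) * \<alpha> b a x"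
      using w(2)[of 0 "?\<Gamma> VL VR"] w(2)[of 1 "?\<Gamma> VR VL"] by (simp add: two[unfolded One_nat_def] LR[unfolded One_nat_def] fps_const_neg[symmetric] del: fps_const_neg)
    finally show "graph_sum n 1 \<alpha> (\<lambda>x. fps_const (X a x)) (\<lambda>x. fps_const (X b x)) x = fps_const (of_real (2 * w)) * \<alpha> a b x"
      by (simp add: anti fps_const_mult[symmetric] algebra_simps del: fps_const_mult)
  qed
qed


lemma graph_operator_2:
  "graph_operator n 2 \<Gamma> \<alpha> f g x = (\<Sum>p<n. \<Sum>q<n. \<Sum>r<n. \<Sum>s<n.
     let L = (\<lambda>v. (if \<Gamma> (0, 0) = v then [p] else []) @ (if \<Gamma> (0, 1) = v then [q] else []) @
       (if \<Gamma> (1, 0) = v then [r] else []) @ (if \<Gamma> (1, 1) = v then [s] else []))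
     in formal_pderivs (L (Vertex 0)) (\<alpha> p q) x * formal_pderivs (L (Vertex 1)) (\<alpha> r s) x *
       formal_pderivs (L VL) f x * formal_pderivs (L VR) g x)"
proof -
  define F where "F I = (\<Prod>k<2. formal_pderivs (incoming 2 \<Gamma> I (Vertex k)) (\<alpha> (I (k, 0)) (I (k, 1))) x) *
       formal_pderivs (incoming 2 \<Gamma> I VL) f x * formal_pderivs (incoming 2 \<Gamma> I VR) g x" for I
  have expand: "graph_operator n 2 \<Gamma> \<alpha> f g x = (\<Sum>p<n. \<Sum>q<n. \<Sum>r<n. \<Sum>s<n.
     F ((\<lambda>_. undefined)((1, 1) := s, (1, 0) := r, (0, 1) := q, (0, 0) := p)))"
    unfolding graph_operator_def F_def[symmetric] edge_sets by (simp add: sum_PiE_insert) (simp add: fun_upd_def)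
  have "F ((\<lambda>_. undefined)((1, 1) := s, (1, 0) := r, (0, 1) := q, (0, 0) := p)) =
     (let L = (\<lambda>v. (if \<Gamma> (0, 0) = v then [p] else []) @ (if \<Gamma> (0, 1) = v then [q] else []) @
       (if \<Gamma> (1, 0) = v then [r] else []) @ (if \<Gamma> (1, 1) = v then [s] else []))
     in formal_pderivs (L (Vertex 0)) (\<alpha> p q) x * formal_pderivs (L (Vertex 1)) (\<alpha> r s) x *
       formal_pderivs (L VL) f x * formal_pderivs (L VR) g x)" for p q r s
  proof -
    define I where "I = (\<lambda>_. undefined)((1::nat, 1::nat) := s, (1, 0) := r, (0, 1) := q, (0, 0) := p)"
    have I: "I (0, 0) = p" "I (0, 1) = q" "I (1, 0) = r" "I (1, 1) = s" by (simp_all add: I_def)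
    have inc: "incoming 2 \<Gamma> I v = (if \<Gamma> (0, 0) = v then [p] else []) @ (if \<Gamma> (0, 1) = v then [q] else []) @
       (if \<Gamma> (1, 0) = v then [r] else []) @ (if \<Gamma> (1, 1) = v then [s] else [])" for v
      unfolding incoming_def edge_lists by (simp add: I del: One_nat_def)
    have two: "{..<2} = {0, 1::nat}" by auto
    show ?thesis
      unfolding I_def[symmetric] F_def inc[symmetric] Let_def two
      by (subst prod.insert, simp, simp, subst prod.insert) (simp_all only: I prod.empty mult_1_right empty_iff not_False_eq_True finite.emptyI)
  qed
  thus ?thesis unfolding expand by simp
qed

text \<open>The operator of a two-wheel on coordinates: formally the trace of ad(x_a) ad(x_b) for
  the linear part of \<alpha> at 0, a scaled Killing form when the bivector is half a Lie-Poisson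
  one.\<close>

definition contraction :: "nat \<Rightarrow> (nat \<Rightarrow> nat \<Rightarrow> formal_function) \<Rightarrow> nat \<Rightarrow> nat \<Rightarrow> complex fps"
  where "contraction n \<alpha> a b = (\<Sum>c<n. \<Sum>d<n.
     formal_pderivs [c] (\<alpha> a d) (\<lambda>_. 0) * formal_pderivs [d] (\<alpha> b c) (\<lambda>_. 0))"

lemma contraction_commute: "contraction n \<alpha> a b = contraction n \<alpha> b a"
  unfolding contraction_def by (subst sum.swap) (simp add: mult.commute)

definition wheel_graph :: "nat \<Rightarrow> nat \<Rightarrow> vertex \<Rightarrow> vertex \<Rightarrow> kgraph \<Rightarrow> bool"
  where "wheel_graph i j s t \<Gamma> \<longleftrightarrow> i < 2 \<and> j < 2 \<and> {s, t} = {VL, VR} \<and>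
     \<Gamma> (0, i) = Vertex 1 \<and> \<Gamma> (0, 1 - i) = s \<and> \<Gamma> (1, j) = Vertex 0 \<and> \<Gamma> (1, 1 - j) = t"

locale vanishing_bivector =
  fixes n :: nat and \<alpha> :: "nat \<Rightarrow> nat \<Rightarrow> formal_function" and a b :: nat
  assumes vanishing: "\<And>i j. i < n \<Longrightarrow> j < n \<Longrightarrow> \<alpha> i j (\<lambda>_. 0) = 0"
    and antisym: "\<And>i j k. i < n \<Longrightarrow> j < n \<Longrightarrow> k < n \<Longrightarrow>
      formal_pderivs [k] (\<alpha> j i) (\<lambda>_. 0) = - formal_pderivs [k] (\<alpha> i j) (\<lambda>_. 0)"
    and ab: "a < n" "b < n"
begin

abbreviation "op N \<Gamma> \<equiv> graph_operator n N \<Gamma> \<alpha> (\<lambda>x. fps_const (X a x)) (\<lambda>x. fps_const (X b x)) (\<lambda>_. 0)"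

lemma formal_pderivs_X_0:
  assumes "L \<in> lists {..<n}" "c < n"
  shows "formal_pderivs L (\<lambda>x. fps_const (X c x)) (\<lambda>_. 0) = (if L = [c] then 1 else 0)"
  using formal_pderivs_X[of c n L "\<lambda>_. 0"] assms by (cases "L = []") auto

text \<open>Each spoke carries the index of the coordinate placed at its end, and the two rim edges
  carry the summation indices. Exchanging the edges at a vertex costs a sign by
  antisymmetry.\<close>

lemma op_wheel_graph:
  assumes "wheel_graph i j s t \<Gamma>"
  shows "op 2 \<Gamma> = (-1) ^ (i + j) * contraction n \<alpha> a b"
proof -
  have st: "s = VL \<and> t = VR \<or> s = VR \<and> t = VL"
    and ij: "i = 0 \<or> i = 1" "j = 0 \<or> j = 1"
    using assms by (auto simp: wheel_graph_def doubleton_eq_iff)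
  define x y where "x = (if s = VL then a else b)" and "y = (if s = VL then b else a)"
  have xy: "x < n" "y < n" using ab by (auto simp: x_def y_def)
  have "op 2 \<Gamma> = (\<Sum>p<n. \<Sum>r<n. formal_pderivs [r] (if i = 0 then \<alpha> p x else \<alpha> x p) (\<lambda>_. 0) *
     formal_pderivs [p] (if j = 0 then \<alpha> r y else \<alpha> y r) (\<lambda>_. 0))"
    unfolding graph_operator_2 Let_def x_def y_def using st ij assms unfolding wheel_graph_def
    by (elim disjE; simp add: formal_pderivs_X_0 ab mult_if_1 sum_if_const)
  also have "\<dots> = (\<Sum>p<n. \<Sum>r<n. (-1) ^ (i + j) * (formal_pderivs [r] (\<alpha> x p) (\<lambda>_. 0) * formal_pderivs [p] (\<alpha> y r) (\<lambda>_. 0)))"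
    using ij by (intro sum.cong refl) (auto simp: antisym[of x] antisym[of y] xy)
  also have "\<dots> = (-1) ^ (i + j) * contraction n \<alpha> x y"
    unfolding contraction_def sum_distrib_left by (rule sum.swap)
  also have "contraction n \<alpha> x y = contraction n \<alpha> a b"
    using st by (auto simp: x_def y_def contraction_commute)
  finally show ?thesis .
qed

text \<open>Both vertices must be differentiated because \<alpha> vanishes at 0, and L and R must
  receive exactly one edge each because coordinates vanish at 0 and are linear. Four edges then
  leave only two-wheels.\<close>

lemma op_2_eq_0:
  assumes \<Gamma>: "\<Gamma> \<in> kgraphs 2" and w: "\<And>i j s t. \<not> wheel_graph i j s t \<Gamma>"
  shows "op 2 \<Gamma> = 0"
proof -
  have V2: "Vertex ` {..<2::nat} = {Vertex 0, Vertex 1}" by (auto simp: less_2_cases_iff)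
  have t: "\<Gamma> (0, 0) \<in> {Vertex 1, VL, VR}" "\<Gamma> (0, 1) \<in> {Vertex 1, VL, VR}"
     "\<Gamma> (1, 0) \<in> {Vertex 0, VL, VR}" "\<Gamma> (1, 1) \<in> {Vertex 0, VL, VR}"
    using kgraphs_no_loop[OF \<Gamma>, of 0 0] kgraphs_no_loop[OF \<Gamma>, of 0 1] kgraphs_no_loop[OF \<Gamma>, of 1 0]
      kgraphs_no_loop[OF \<Gamma>, of 1 1] by (auto simp: V2)
  define L where "L p q r s v = (if \<Gamma> (0, 0) = v then [p] else []) @ (if \<Gamma> (0, 1) = v then [q] else []) @
       (if \<Gamma> (1, 0) = v then [r] else []) @ (if \<Gamma> (1, 1) = v then [s] else [])" for p q r s :: nat and v
  have L: "L p q r s (Vertex 0) = [] \<or> L p q r s (Vertex 1) = [] \<or> length (L p q r s VL) \<noteq> 1 \<or> length (L p q r s VR) \<noteq> 1" for p q r s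
  proof (rule ccontr)
    assume *: "\<not> ?thesis"
    have c: "edges_between \<Gamma> 0 v + edges_between \<Gamma> 1 v = 1" if "v = VL \<or> v = VR" for v
    proof -
      have "length (L p q r s v) = 1" using * that by auto
      thus ?thesis by (simp add: L_def edges_between_def split: if_splits)
    qed
    have "\<Gamma> (0, 0) = Vertex 1 \<or> \<Gamma> (0, 1) = Vertex 1" "\<Gamma> (1, 0) = Vertex 0 \<or> \<Gamma> (1, 1) = Vertex 0"
    proof -
      have "\<Gamma> (0, 0) \<noteq> Vertex 0" "\<Gamma> (0, 1) \<noteq> Vertex 0" "\<Gamma> (1, 0) \<noteq> Vertex 1" "\<Gamma> (1, 1) \<noteq> Vertex 1" using t by auto
      moreover have "L p q r s (Vertex 0) \<noteq> []" "L p q r s (Vertex 1) \<noteq> []" using * by auto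
      ultimately show "\<Gamma> (0, 0) = Vertex 1 \<or> \<Gamma> (0, 1) = Vertex 1" "\<Gamma> (1, 0) = Vertex 0 \<or> \<Gamma> (1, 1) = Vertex 0"
        by (simp_all add: L_def split: if_splits)
    qed
    then obtain i j where ij: "i < 2" "j < 2" "\<Gamma> (0, i) = Vertex 1" "\<Gamma> (1, j) = Vertex 0"
      by (metis one_less_numeral_iff pos2 semiring_norm(76))
    have ij': "edges_between \<Gamma> 0 v = of_bool (\<Gamma> (0, 1 - i) = v)" "edges_between \<Gamma> 1 v = of_bool (\<Gamma> (1, 1 - j) = v)"
      if "v = VL \<or> v = VR" for v
      using ij that by (auto simp: edges_between_def less_2_cases_iff)
    have "{\<Gamma> (0, 1 - i), \<Gamma> (1, 1 - j)} = {VL, VR}"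
    proof -
      have *: "of_bool (x = VL) + of_bool (y = VL) = (1::nat) \<Longrightarrow> of_bool (x = VR) + of_bool (y = VR) = (1::nat) \<Longrightarrow> {x, y} = {VL, VR}" for x y
        by (cases x; cases y) auto
      show ?thesis by (rule *) (use c[of VL] c[of VR] ij'[of VL] ij'[of VR] in simp_all)
    qed
    hence "wheel_graph i j (\<Gamma> (0, 1 - i)) (\<Gamma> (1, 1 - j)) \<Gamma>" using ij by (simp add: wheel_graph_def)
    thus False using w by blast
  qed
  have z: "formal_pderivs (L p q r s (Vertex 0)) (\<alpha> p q) (\<lambda>_. 0) * formal_pderivs (L p q r s (Vertex 1)) (\<alpha> r s) (\<lambda>_. 0) *
       formal_pderivs (L p q r s VL) (\<lambda>x. fps_const (X a x)) (\<lambda>_. 0) * formal_pderivs (L p q r s VR) (\<lambda>x. fps_const (X b x)) (\<lambda>_. 0) = 0"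
    if "p < n" "q < n" "r < n" "s < n" for p q r s
  proof -
    have li: "L p q r s v \<in> lists {..<n}" for v using that by (auto simp: L_def)
    from L[of p q r s] show ?thesis
      by (elim disjE) (auto simp: vanishing that formal_pderivs_X_0[OF li] ab)
  qed
  show ?thesis
    unfolding graph_operator_2 Let_def L_def[symmetric] by (intro sum.neutral ballI z) simp_all
qed

end

lemma wheel_graph_kweight:
  "\<exists>w < 0. \<forall>\<Gamma> i j. wheel_graph i j s t \<Gamma> \<longrightarrow> kweight 2 \<Gamma> = (-1) ^ (i + j) * w"
proof (cases "{s, t} = {VL, VR}")
  case True
  show ?thesis using kweight_2[OF True] unfolding wheel_graph_def by blast
next
  case False
  thus ?thesis by (intro exI[of _ "-1"]) (auto simp: wheel_graph_def)
qed

text \<open>The sign from the order of the edges occurs in the weight and in the operator and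
  cancels, so every two-wheel contributes a negative multiple of the same contraction. The constant
  is uniform in \<alpha>, so all orders in the formal parameter are covered.\<close>

lemma graph_sum_2:
  "\<exists>G < 0. \<forall>\<alpha> a b. vanishing_bivector n \<alpha> a b \<longrightarrow>
     graph_sum n 2 \<alpha> (\<lambda>x. fps_const (X a x)) (\<lambda>x. fps_const (X b x)) (\<lambda>_. 0) = fps_const (of_real G) * contraction n \<alpha> a b"
proof -
  have "\<forall>s t. \<exists>w < 0. \<forall>\<Gamma> i j. wheel_graph i j s t \<Gamma> \<longrightarrow> kweight 2 \<Gamma> = (-1) ^ (i + j) * w"
    using wheel_graph_kweight by blast
  then obtain w where w: "\<And>s t. w s t < 0"
      "\<And>\<Gamma> i j s t. wheel_graph i j s t \<Gamma> \<Longrightarrow> kweight 2 \<Gamma> = (-1) ^ (i + j) * (w s t :: real)"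
    by metis
  \<comment> \<open>\<open>g\<close> is the coefficient contributed by the graph: never positive,
    and strictly negative for the one graph chosen below.\<close>
  define good where "good \<Gamma> g \<longleftrightarrow> g \<le> 0 \<and> (\<Gamma> (0, 0) = VL \<and> \<Gamma> (0, 1) = Vertex 1 \<and> \<Gamma> (1, 0) = VR \<and> \<Gamma> (1, 1) = Vertex 0 \<longrightarrow> g < 0) \<and>
     (\<forall>\<alpha> a b. vanishing_bivector n \<alpha> a b \<longrightarrow> fps_const (of_real (kweight 2 \<Gamma>)) *
       graph_operator n 2 \<Gamma> \<alpha> (\<lambda>x. fps_const (X a x)) (\<lambda>x. fps_const (X b x)) (\<lambda>_. 0) = fps_const (of_real g) * contraction n \<alpha> a b)"
    for \<Gamma> :: kgraph and g :: real
  have ex: "\<exists>g. good \<Gamma> g"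
    if \<Gamma>: "\<Gamma> \<in> kgraphs 2" for \<Gamma>
  proof (cases "\<exists>i j s t. wheel_graph i j s t \<Gamma>")
    case True
    then obtain i j s t where W: "wheel_graph i j s t \<Gamma>" by blast
    have "fps_const (of_real (kweight 2 \<Gamma>)) *
       graph_operator n 2 \<Gamma> \<alpha> (\<lambda>x. fps_const (X a x)) (\<lambda>x. fps_const (X b x)) (\<lambda>_. 0) = fps_const (of_real (w s t)) * contraction n \<alpha> a b"
      if "vanishing_bivector n \<alpha> a b" for \<alpha> a b
      using vanishing_bivector.op_wheel_graph[OF that W] w(2)[OF W] by (cases "even (i + j)") (simp_all flip: fps_const_neg)
    thus ?thesis using w(1)[of s t] unfolding good_def by (intro exI[of _ "w s t"]) simp
  next
    case False
    have "\<not> (\<Gamma> (0, 0) = VL \<and> \<Gamma> (0, 1) = Vertex 1 \<and> \<Gamma> (1, 0) = VR \<and> \<Gamma> (1, 1) = Vertex 0)"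
      using False[simplified, rule_format, of 1 1 VL VR] by (auto simp: wheel_graph_def)
    thus ?thesis using False vanishing_bivector.op_2_eq_0[OF _ \<Gamma>] unfolding good_def by (intro exI[of _ 0]) simp
  qed
  obtain g where g: "good \<Gamma> (g \<Gamma>)" if "\<Gamma> \<in> kgraphs 2" for \<Gamma>
    using bchoice[of "kgraphs 2" good] ex by blast
  have g_nonpos: "g \<Gamma> \<le> 0" if "\<Gamma> \<in> kgraphs 2" for \<Gamma>
    using g[OF that] unfolding good_def by (elim conjE)
  \<comment> \<open>A particular two-wheel, which makes the total strictly negative.\<close>
  define \<Gamma>0 :: kgraph where "\<Gamma>0 = (\<lambda>e. if e = (0, 0) then VL else if e = (0, 1) then Vertex 1 else
      if e = (1, 0) then VR else if e = (1, 1) then Vertex 0 else undefined)"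
  have fin: "finite (kgraphs 2)" unfolding kgraphs_def by (intro finite_PiE) auto
  have \<Gamma>0: "\<Gamma>0 \<in> kgraphs 2" unfolding kgraphs_def edge_sets \<Gamma>0_def by (auto simp: PiE_def Pi_def extensional_def)
  have "g \<Gamma>0 < 0" using g[OF \<Gamma>0] unfolding good_def by (elim conjE impE) (simp_all add: \<Gamma>0_def)
  moreover have "sum g (kgraphs 2 - {\<Gamma>0}) \<le> 0" using g_nonpos by (intro sum_nonpos) auto
  ultimately have "sum g (kgraphs 2) < 0" by (subst sum.remove[OF fin \<Gamma>0]) simp
  moreover have "graph_sum n 2 \<alpha> (\<lambda>x. fps_const (X a x)) (\<lambda>x. fps_const (X b x)) (\<lambda>_. 0)
     = fps_const (of_real (sum g (kgraphs 2))) * contraction n \<alpha> a b" if "vanishing_bivector n \<alpha> a b" for \<alpha> a b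
  proof -
    have "graph_sum n 2 \<alpha> (\<lambda>x. fps_const (X a x)) (\<lambda>x. fps_const (X b x)) (\<lambda>_. 0) =
      (\<Sum>\<Gamma>\<in>kgraphs 2. fps_const (of_real (g \<Gamma>)) * contraction n \<alpha> a b)"
      unfolding graph_sum_def using g that unfolding good_def by (intro sum.cong refl) blast
    also have "\<dots> = (\<Sum>\<Gamma>\<in>kgraphs 2. fps_const (of_real (g \<Gamma>))) * contraction n \<alpha> a b"
      by (rule sum_distrib_right[symmetric])
    also have "(\<Sum>\<Gamma>\<in>kgraphs 2. fps_const (complex_of_real (g \<Gamma>))) = fps_const (of_real (sum g (kgraphs 2)))"
      by (rule fps_ext) (simp add: fps_sum_nth)
    finally show ?thesis .
  qed
  ultimately show ?thesis by blast
qed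

section \<open>Graph sums with three vertices\<close>

lemma fps_prod_nth_0': "fps_nth (\<Prod>a\<in>A. F a) 0 = (\<Prod>a\<in>A. fps_nth (F a) 0 :: complex)"
  by (induction A rule: infinite_finite_induct) simp_all

lemma length_incoming_3:
  "length (incoming 3 \<Gamma> I v) = edges_between \<Gamma> 0 v + edges_between \<Gamma> 1 v + edges_between \<Gamma> 2 v"
  by (simp add: incoming_def edge_lists edges_between_def)

lemma incoming_member:
  "k < N \<Longrightarrow> c < 2 \<Longrightarrow> \<Gamma> (k, c) = v \<Longrightarrow> I (k, c) \<in> set (incoming N \<Gamma> I v)"
  by (auto simp: incoming_def edge_list_def)

lemma less_3_cases: "k < 3 \<longleftrightarrow> k = 0 \<or> k = 1 \<or> k = (2::nat)" by auto

lemma edges_between_sum: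
  assumes "\<Gamma> \<in> kgraphs 3" "k < 3"
  shows "edges_between \<Gamma> k (Vertex 0) + edges_between \<Gamma> k (Vertex 1) + edges_between \<Gamma> k (Vertex 2)
    + edges_between \<Gamma> k VL + edges_between \<Gamma> k VR = 2"
proof -
  have "\<Gamma> (k, c) \<in> {Vertex 0, Vertex 1, Vertex 2, VL, VR}" if "c < 2" for c
    using kgraphs_no_loop[OF assms that] by (auto simp: less_3_cases)
  hence "of_bool (\<Gamma> (k, c) = Vertex 0) + of_bool (\<Gamma> (k, c) = Vertex 1) + of_bool (\<Gamma> (k, c) = Vertex 2)
     + of_bool (\<Gamma> (k, c) = VL) + of_bool (\<Gamma> (k, c) = VR) = (1::nat)" if "c < 2" for c
    using that by fastforce
  from this[of 0] this[of 1] show ?thesis by (simp add: edges_between_def)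
qed

text \<open>A vertex evaluated at 0 contributes in two ways only: through the linear part, with one
  incoming edge, or through the Casimir term, with two incoming edges of the same so(3)
  index.\<close>

lemma pderivs_pi0_neq_0:
  assumes ij: "i < 8" "j < 8" and L: "L \<in> lists {..<8}" and neq: "pderivs L (pi0 i j) (\<lambda>_. 0) \<noteq> 0"
  shows "(\<exists>m<8. L = [m] \<and> lin i j m \<noteq> 0) \<or> (\<exists>m. L = [m, m] \<and> 5 \<le> m \<and> i < 5 \<and> j < 5)"
proof -
  consider "L = []" | m where "L = [m]" | m m' where "L = [m, m']" | m m' m'' L' where "L = m # m' # m'' # L'"
    by (metis list.exhaust)
  thus ?thesis using neq L unfolding pderivs_pi0[OF ij L]
    by cases (auto simp: quad_def split: if_splits)
qed

text \<open>Of six edges two end at L and R, so four enter three vertices that receive one or two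
  each. Exactly one vertex is therefore quadratic, with two incoming edges of equal so(3) index, and
  the types of the indices then force an apex graph, whose weight is 0.\<close>

lemma op_3:
  assumes ab: "{a, b} = {3, 4}" and \<Gamma>: "\<Gamma> \<in> kgraphs 3"
    and \<alpha>: "\<And>i j L. i < 8 \<Longrightarrow> j < 8 \<Longrightarrow> L \<in> lists {..<8} \<Longrightarrow>
      fps_nth (formal_pderivs L (\<alpha> i j) (\<lambda>_. 0)) 0 = complex_of_real (pderivs L (pi0 i j) (\<lambda>_. 0) / 2)"
    and op: "fps_nth (graph_operator 8 3 \<Gamma> \<alpha> (\<lambda>x. fps_const (X a x)) (\<lambda>x. fps_const (X b x)) (\<lambda>_. 0)) 0 \<noteq> 0"
  shows "kweight 3 \<Gamma> = 0"
proof -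
  have ab': "a = 3 \<and> b = 4 \<or> a = 4 \<and> b = 3" using ab by (auto simp: doubleton_eq_iff)
  from op obtain I where I: "I \<in> {..<3} \<times> {..<2} \<rightarrow>\<^sub>E {..<8}" and nz: "fps_nth
       ((\<Prod>k<3. formal_pderivs (incoming 3 \<Gamma> I (Vertex k)) (\<alpha> (I (k, 0)) (I (k, 1))) (\<lambda>_. 0)) *
       formal_pderivs (incoming 3 \<Gamma> I VL) (\<lambda>x. fps_const (X a x)) (\<lambda>_. 0) *
       formal_pderivs (incoming 3 \<Gamma> I VR) (\<lambda>x. fps_const (X b x)) (\<lambda>_. 0)) 0 \<noteq> 0"
    unfolding graph_operator_def fps_sum_nth by (rule sum.not_neutral_contains_not_neutral)
  define inc where "inc = incoming 3 \<Gamma> I"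
  have li: "inc v \<in> lists {..<8}" for v unfolding inc_def by (rule incoming_lists[OF I])
  have I8: "I (k, c) < 8" if "k < 3" "c < 2" for k c using PiE_mem[OF I, of "(k, c)"] that by auto
  have "fps_nth (formal_pderivs (inc v) (\<lambda>x. fps_const (X c x)) (\<lambda>_. 0)) 0 = (if inc v = [c] then 1 else 0)" if "c < 8" for v c
    using formal_pderivs_X[OF that li[of v], of "\<lambda>_. 0"] by (cases "inc v = []") auto
  hence incLR: "inc VL = [a]" "inc VR = [b]"
    using nz ab' by (auto simp: fps_prod_nth_0' inc_def[symmetric] split: if_splits)
  have dv: "(\<exists>m<8. inc (Vertex k) = [m] \<and> lin (I (k, 0)) (I (k, 1)) m \<noteq> 0) \<or>
      (\<exists>m. inc (Vertex k) = [m, m] \<and> 5 \<le> m \<and> I (k, 0) < 5 \<and> I (k, 1) < 5)" if k: "k < 3" for k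
  proof (rule pderivs_pi0_neq_0[OF I8[OF k] I8[OF k] li])
    have "fps_nth (formal_pderivs (inc (Vertex k)) (\<alpha> (I (k, 0)) (I (k, 1))) (\<lambda>_. 0)) 0 \<noteq> 0"
      using nz k by (auto simp: fps_prod_nth_0' inc_def[symmetric] prod_zero_iff)
    thus "pderivs (inc (Vertex k)) (pi0 (I (k, 0)) (I (k, 1))) (\<lambda>_. 0) \<noteq> 0"
      using \<alpha>[OF I8[OF k] I8[OF k] li, of 0 1 "Vertex k"] by auto
  qed auto
  have len: "length (inc v) = edges_between \<Gamma> 0 v + edges_between \<Gamma> 1 v + edges_between \<Gamma> 2 v" for v
    unfolding inc_def by (rule length_incoming_3)
  have total: "length (inc (Vertex 0)) + length (inc (Vertex 1)) + length (inc (Vertex 2)) = 4"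
    using edges_between_sum[OF \<Gamma>, of 0] edges_between_sum[OF \<Gamma>, of 1] edges_between_sum[OF \<Gamma>, of 2]
      len[of VL] len[of VR] incLR len[of "Vertex 0"] len[of "Vertex 1"] len[of "Vertex 2"] by simp
  have l12: "length (inc (Vertex k)) = 1 \<or> length (inc (Vertex k)) = 2" if "k < 3" for k
    using dv[OF that] by auto
  have "\<exists>k<3. length (inc (Vertex k)) = 2"
  proof (rule ccontr)
    assume "\<not> ?thesis"
    hence "length (inc (Vertex k)) = 1" if "k < 3" for k using l12 that by blast
    from this[of 0] this[of 1] this[of 2] total show False by simp
  qed
  then obtain k where k: "k < 3" "length (inc (Vertex k)) = 2" by blast
  define u v where "u = (if k = 0 then 1 else 0 :: nat)" and "v = (if k = 2 then 1 else 2 :: nat)"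
  have uv: "u < 3" "v < 3" "distinct [k, u, v]" using k by (auto simp: u_def v_def)
  have kuv3: "F 0 + F 1 + F 2 = F k + F u + F v" for F :: "nat \<Rightarrow> nat"
    using k by (auto simp: u_def v_def less_3_cases)
  have "length (inc (Vertex u)) + length (inc (Vertex v)) = 2"
    using total kuv3[of "\<lambda>x. length (inc (Vertex x))"] k by simp
  hence luv: "length (inc (Vertex u)) = 1" "length (inc (Vertex v)) = 1"
    using l12[OF uv(1)] l12[OF uv(2)] by linarith+
  have le: "edges_between \<Gamma> k x + edges_between \<Gamma> u x + edges_between \<Gamma> v x = length (inc x)" for x
    using len[of x] kuv3[of "\<lambda>y. edges_between \<Gamma> y x"] by simp
  have loop: "edges_between \<Gamma> x (Vertex x) = 0" if "x < 3" for x
    using kgraphs_no_loop[OF \<Gamma> that, of 0] kgraphs_no_loop[OF \<Gamma> that, of 1] by (auto simp: edges_between_def)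
  have dk: "\<exists>m. inc (Vertex k) = [m, m] \<and> 5 \<le> m" using dv[OF k(1)] k(2) by auto
  have sk: "5 \<le> I (x, c)" if "x < 3" "c < 2" "\<Gamma> (x, c) = Vertex k" for x c
    using incoming_member[of x 3 c \<Gamma> "Vertex k" I] that dk by (auto simp: inc_def[symmetric])
  \<comment> \<open>A vertex with one incoming edge carries a structure constant: its two outgoing
    indices have the same type and, by antisymmetry, are different.\<close>
  have so: "(5 \<le> I (x, 0)) = (5 \<le> I (x, 1))" "I (x, 0) \<noteq> I (x, 1)" if x: "x < 3" and lx: "length (inc (Vertex x)) = 1" for x
  proof -
    obtain m where m: "m < 8" "lin (I (x, 0)) (I (x, 1)) m \<noteq> 0" using dv[OF x] lx by auto
    show "(5 \<le> I (x, 0)) = (5 \<le> I (x, 1))" using lin_props(2)[OF _ _ m] I8[OF x] by auto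
    show "I (x, 0) \<noteq> I (x, 1)" using lin_props(1)[of "I (x, 0)" "I (x, 1)" m] I8[OF x] m by auto
  qed
  \<comment> \<open>Both edges at the quadratic vertex carry the same index, so they cannot come
    from one vertex with distinct indices.\<close>
  have less2: "edges_between \<Gamma> x (Vertex k) < 2" if "x < 3" "length (inc (Vertex x)) = 1" for x
  proof (rule ccontr)
    assume "\<not> ?thesis"
    hence "\<Gamma> (x, 0) = Vertex k" "\<Gamma> (x, 1) = Vertex k"
      by (cases "\<Gamma> (x, 0) = Vertex k"; cases "\<Gamma> (x, 1) = Vertex k"; simp add: edges_between_def)+
    hence "I (x, 0) \<in> set (inc (Vertex k))" "I (x, 1) \<in> set (inc (Vertex k))"
      using incoming_member[OF that(1), of _ \<Gamma> "Vertex k" I] by (simp_all add: inc_def)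
    thus False using dk so(2)[OF that] by auto
  qed
  have perm: "w = k \<or> w = u \<or> w = v" if "w < 3" for w
    using that k(1) by (auto simp: u_def v_def)
  have tgt: "\<Gamma> (x, c) \<in> {Vertex y, Vertex z, VL, VR}" if "c < 2" "x < 3" "\<And>w. w < 3 \<Longrightarrow> w = x \<or> w = y \<or> w = z" for x y z c
    using kgraphs_no_loop[OF \<Gamma> that(2,1)] that(3) by auto
  have "apex_graph k u v \<Gamma>"
  proof (rule apex_graphI[where s = "\<lambda>e. 5 \<le> I e"])
    show "\<Gamma> (k, c) \<in> {Vertex u, Vertex v, VL, VR}" "\<Gamma> (u, c) \<in> {Vertex k, Vertex v, VL, VR}"
      "\<Gamma> (v, c) \<in> {Vertex k, Vertex u, VL, VR}" if "c < 2" for c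
      by (rule tgt[OF that]; use k(1) uv(1,2) perm in blast)+
    show "\<not> 5 \<le> I e" if "fst e \<in> {k, u, v}" "\<Gamma> e = VL \<or> \<Gamma> e = VR" "snd e < 2" for e
    proof -
      have "fst e < 3" using that(1) k(1) uv by auto
      hence "I e \<in> set (inc VL) \<union> set (inc VR)"
        using incoming_member[of "fst e" 3 "snd e" \<Gamma> _ I] that by (auto simp: inc_def)
      thus ?thesis using incLR ab' by auto
    qed
    show "5 \<le> I e" if "fst e \<in> {k, u, v}" "\<Gamma> e = Vertex k" "snd e < 2" for e
      using sk[of "fst e" "snd e"] that k(1) uv by auto
  qed (use le[of "Vertex k"] le[of "Vertex u"] le[of "Vertex v"] le[of VL] le[of VR] loop[OF k(1)] loop[OF uv(1)] loop[OF uv(2)]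
        luv k(2) incLR uv so(1)[OF uv(1) luv(1)] so(1)[OF uv(2) luv(2)] less2[OF uv(1) luv(1)] less2[OF uv(2) luv(2)] in simp_all)
  then obtain i j l where "i < 2" "j < 2" "l < 2" "\<Gamma> (u, i) = Vertex v" "\<Gamma> (u, 1 - i) = Vertex k"
     "\<Gamma> (v, j) = Vertex u" "\<Gamma> (v, 1 - j) = Vertex k" "\<Gamma> (k, l) = VL" "\<Gamma> (k, 1 - l) = VR"
    unfolding apex_graph_def by blast
  thus ?thesis using kweight_3_eq_0[OF k(1) u_def v_def] by blast
qed

lemma graph_sum_3:
  assumes "{a, b} = {3, 4}"
    and "\<And>i j L. i < 8 \<Longrightarrow> j < 8 \<Longrightarrow> L \<in> lists {..<8} \<Longrightarrow>
      fps_nth (formal_pderivs L (\<alpha> i j) (\<lambda>_. 0)) 0 = complex_of_real (pderivs L (pi0 i j) (\<lambda>_. 0) / 2)"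
  shows "fps_nth (graph_sum 8 3 \<alpha> (\<lambda>x. fps_const (X a x)) (\<lambda>x. fps_const (X b x)) (\<lambda>_. 0)) 0 = 0"
  unfolding graph_sum_def fps_sum_nth
proof (intro sum.neutral ballI)
  fix \<Gamma> assume \<Gamma>: "\<Gamma> \<in> kgraphs 3"
  show "fps_nth (fps_const (complex_of_real (kweight 3 \<Gamma>)) *
      graph_operator 8 3 \<Gamma> \<alpha> (\<lambda>x. fps_const (X a x)) (\<lambda>x. fps_const (X b x)) (\<lambda>_. 0)) 0 = 0"
    using op_3[OF assms(1) \<Gamma>, of \<alpha>] assms(2) by fastforce
qed

section \<open>Nonexistence of a quantization\<close>

lemma const_bivector_extends: "extends_poisson n (const_bivector \<pi>) \<pi>"
  by (simp add: extends_poisson_def const_bivector_def)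

text \<open>A strong form of perfectness of the Lie algebra: every basis vector is a multiple of a
  bracket of two basis vectors. The pairs avoid {3, 4}, so the quadratic term does not
  interfere.\<close>

lemma pi0_single:
  assumes "i < 8"
  shows "\<exists>a<8. \<exists>b<8. \<exists>c. c \<noteq> 0 \<and> (\<forall>x. pi0 a b x = c * x i)"
proof -
  have *: "?thesis" if "i = k" "a < 8" "b < 8" "c \<noteq> 0" "\<And>x. pi0 a b x = c * x k" for a b c k
    using that by blast
  have "i = 0 \<or> i = 1 \<or> i = 2 \<or> i = 3 \<or> i = 4 \<or> i = 5 \<or> i = 6 \<or> i = 7" using assms by auto
  thus ?thesis
  proof (elim disjE)
    assume "i = 0"
    from *[OF this, of 2 0 "2"] show ?thesis by (simp add: pi0_def quad_def coeff_rows index_rows)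
  next
    assume "i = 1"
    from *[OF this, of 2 1 "- 2"] show ?thesis by (simp add: pi0_def quad_def coeff_rows index_rows)
  next
    assume "i = 2"
    from *[OF this, of 0 1 "1"] show ?thesis by (simp add: pi0_def quad_def coeff_rows index_rows)
  next
    assume "i = 3"
    from *[OF this, of 2 3 "1"] show ?thesis by (simp add: pi0_def quad_def coeff_rows index_rows)
  next
    assume "i = 4"
    from *[OF this, of 2 4 "- 1"] show ?thesis by (simp add: pi0_def quad_def coeff_rows index_rows)
  next
    assume "i = 5"
    from *[OF this, of 6 7 "1"] show ?thesis by (simp add: pi0_def quad_def coeff_rows index_rows)
  next
    assume "i = 6"
    from *[OF this, of 7 5 "1"] show ?thesis by (simp add: pi0_def quad_def coeff_rows index_rows)
  next
    assume "i = 7"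
    from *[OF this, of 5 6 "1"] show ?thesis by (simp add: pi0_def quad_def coeff_rows index_rows)
  qed
qed

lemma eps_linear_extension_nth:
  "fps_nth (eps_linear_extension \<rho> F) K = (\<Sum>k\<le>K. fps_nth (\<rho> (\<lambda>x. fps_nth (F x) k)) (K - k))"
  unfolding eps_linear_extension_def fps_nth_Abs_fps fps_sum_nth
  by (rule sum.cong) (simp_all add: fps_X_power_mult_nth)

text \<open>The hypotheses of the refutation: a quantization for an arbitrary formal extension of
  \<open>pi0\<close> that vanishes at 0.\<close>

locale quantization =
  fixes \<pi> :: formal_bivector and \<rho> :: "((nat \<Rightarrow> real) \<Rightarrow> complex) \<Rightarrow> complex fps"
  assumes bivector: "formal_bivector_field 8 \<pi>"
    and extending: "extends_poisson 8 \<pi> pi0"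
    and van: "\<And>i j. i < 8 \<Longrightarrow> j < 8 \<Longrightarrow> \<pi> i j (\<lambda>_. 0) = 0"
    and quant: "is_quantization 8 (\<lambda>_. 0) \<pi> \<rho>"
begin

abbreviation "\<alpha> \<equiv> half_bivector \<pi>"

definition "r k f = fps_nth (\<rho> f) k"
definition "S k f g x = fps_nth (star_product 8 \<pi> (\<lambda>x. fps_const (f x)) (\<lambda>x. fps_const (g x)) x) k"

lemma \<alpha>_nth_0: "i < 8 \<Longrightarrow> j < 8 \<Longrightarrow> x \<in> E 8 \<Longrightarrow> fps_nth (\<alpha> i j x) 0 = complex_of_real (pi0 i j x / 2)"
  using extending by (simp add: half_bivector_def extends_poisson_def)

lemma \<alpha>_antisym:
  assumes "i < 8" "j < 8" "x \<in> E 8"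
  shows "\<alpha> j i x = - \<alpha> i j x"
proof -
  have "\<pi> j i x = - \<pi> i j x" using bivector assms unfolding formal_bivector_field_def by blast
  thus ?thesis by (intro fps_ext) (simp add: half_bivector_def)
qed

lemma \<alpha>_0: "i < 8 \<Longrightarrow> j < 8 \<Longrightarrow> \<alpha> i j (\<lambda>_. 0) = 0"
  using van by (intro fps_ext) (simp add: half_bivector_def)

lemma lead:
  assumes "i < 8" "j < 8" "L \<in> lists {..<8}"
  shows "fps_nth (formal_pderivs L (\<alpha> i j) (\<lambda>_. 0)) 0 = complex_of_real (pderivs L (pi0 i j) (\<lambda>_. 0) / 2)"
proof -
  have "fps_nth (formal_pderivs L (\<alpha> i j) (\<lambda>_. 0)) 0 = pderivs L (\<lambda>x. complex_of_real (pi0 i j x / 2)) (\<lambda>_. 0)"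
    unfolding formal_pderivs_def fps_nth_Abs_fps
    by (rule pderivs_cong[of 8]) (use assms in \<open>auto simp: \<alpha>_nth_0\<close>)
  also have "\<dots> = complex_of_real (pderivs L (pi0 i j) (\<lambda>_. 0) / 2)"
    by (rule pderivs_linear[OF bounded_linear_compose[OF bounded_linear_of_real bounded_linear_divide] smooth_pi0])
       (use assms in auto)
  finally show ?thesis .
qed

lemma vanishing: 
  assumes "a < 8" "b < 8"
  shows "vanishing_bivector 8 \<alpha> a b"
proof
  fix i j k :: nat assume ijk: "i < 8" "j < 8" "k < 8"
  have sm: "smooth_fun 8 (\<lambda>x. fps_nth (\<alpha> i j x) m)" for m
    using formal_smooth_half[OF bivector ijk(1,2)] by (rule formal_smooth_nth)
  show "formal_pderivs [k] (\<alpha> j i) (\<lambda>_. 0) = - formal_pderivs [k] (\<alpha> i j) (\<lambda>_. 0)"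
  proof (rule fps_ext)
    fix m
    have anti: "fps_nth (\<alpha> j i x) m = - fps_nth (\<alpha> i j x) m" if "x \<in> E 8" for x
      by (simp only: \<alpha>_antisym[OF ijk(1,2) that] fps_neg_nth)
    have "pderivs [k] (\<lambda>x. fps_nth (\<alpha> j i x) m) (\<lambda>_. 0) = pderivs [k] (\<lambda>x. - fps_nth (\<alpha> i j x) m) (\<lambda>_. 0)"
      by (rule pderivs_cong[of 8, OF anti]) (use ijk in auto)
    also have "\<dots> = - pderivs [k] (\<lambda>x. fps_nth (\<alpha> i j x) m) (\<lambda>_. 0)"
      by (rule pderivs_linear[OF bounded_linear_minus[OF bounded_linear_ident] sm]) (use ijk in auto)
    finally show "fps_nth (formal_pderivs [k] (\<alpha> j i) (\<lambda>_. 0)) m = fps_nth (- formal_pderivs [k] (\<alpha> i j) (\<lambda>_. 0)) m"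
      by (simp add: formal_pderivs_def)
  qed
qed (use assms \<alpha>_0 in auto)

lemma r_linear: "smooth_fun 8 f \<Longrightarrow> smooth_fun 8 g \<Longrightarrow> r k (\<lambda>x. a * f x + b * g x) = a * r k f + b * r k g"
  using quant by (simp add: is_quantization_def r_def)

lemma r_0: "smooth_fun 8 f \<Longrightarrow> r 0 f = f (\<lambda>_. 0)"
  using quant by (simp add: is_quantization_def r_def)

lemma r_differential:
  assumes "k \<ge> 1"
  obtains c where "finite {I. c I \<noteq> 0}" "{I. c I \<noteq> 0} \<subseteq> lists {..<8}"
    "\<And>f. smooth_fun 8 f \<Longrightarrow> r k f = (\<Sum>I | c I \<noteq> 0. c I * pderivs I f (\<lambda>_. 0))"
proof -
  have "\<forall>k\<ge>1. \<exists>c :: nat list \<Rightarrow> complex.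
       finite {I. c I \<noteq> 0} \<and> {I. c I \<noteq> 0} \<subseteq> lists {..<8} \<and>
       (\<forall>f. smooth_fun 8 f \<longrightarrow> fps_nth (\<rho> f) k = (\<Sum>I | c I \<noteq> 0. c I * pderivs I f (\<lambda>_. 0)))"
    using quant unfolding is_quantization_def by (elim conjE)
  from this[rule_format, OF assms] show ?thesis using that unfolding r_def by blast
qed

text \<open>Only values on the carrier matter, because every coefficient of \<rho> is evaluation or
  a differential operator at 0. This allows closed forms of star products valid on the carrier to be
  inserted.\<close>

lemma r_cong:
  assumes f: "smooth_fun 8 f" and g: "smooth_fun 8 g" and eq: "\<And>x. x \<in> E 8 \<Longrightarrow> f x = g x"
  shows "r k f = r k g"
proof (cases "k \<ge> 1")
  case True
  obtain c where c: "finite {I. c I \<noteq> 0}" "{I. c I \<noteq> 0} \<subseteq> lists {..<8}"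
    "\<And>f. smooth_fun 8 f \<Longrightarrow> r k f = (\<Sum>I | c I \<noteq> 0. c I * pderivs I f (\<lambda>_. 0))"
    using True by (rule r_differential) blast
  have "pderivs I f (\<lambda>_. 0) = pderivs I g (\<lambda>_. 0)" if "I \<in> lists {..<8}" for I
    by (rule pderivs_cong[of 8]) (use that eq in auto)
  thus ?thesis using c(2) unfolding c(3)[OF f] c(3)[OF g] by (intro sum.cong) auto
next
  case False
  hence "k = 0" by simp
  thus ?thesis using r_0[OF f] r_0[OF g] eq[of "\<lambda>_. 0"] by simp
qed

lemma r_mult:
  assumes "smooth_fun 8 f" "smooth_fun 8 g"
  shows "(\<Sum>k\<le>K. r (K - k) (S k f g)) = (\<Sum>k\<le>K. r k f * r (K - k) g)"
proof -
  have "eps_linear_extension \<rho> (star_product 8 \<pi> (\<lambda>x. fps_const (f x)) (\<lambda>x. fps_const (g x))) = \<rho> f * \<rho> g"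
    using quant assms by (simp add: is_quantization_def)
  from arg_cong[OF this, of "\<lambda>F. fps_nth F K"] show ?thesis
    unfolding eps_linear_extension_nth by (simp add: r_def S_def[abs_def] fps_mult_nth atMost_atLeast0)
qed

lemma smooth_S: "smooth_fun 8 f \<Longrightarrow> smooth_fun 8 g \<Longrightarrow> smooth_fun 8 (S k f g)"
  unfolding S_def[abs_def]
  by (intro formal_smooth_nth formal_smooth_star_product bivector formal_smooth_fps_const)

lemma S_eq: "S K f g x = (\<Sum>N\<le>K. fps_nth (graph_sum 8 N \<alpha> (\<lambda>x. fps_const (f x)) (\<lambda>x. fps_const (g x)) x) (K - N))"
  unfolding S_def by (rule star_product_nth)

lemma S_0: "S 0 f g = (\<lambda>x. f x * g x)"
  by (rule ext) (simp add: S_eq graph_sum_0)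

lemma S_1_0: "S 1 f g (\<lambda>_. 0) = 0"
  using graph_sum_1_eq_0[of 8 \<alpha> "\<lambda>_. 0"] \<alpha>_0 by (simp add: S_eq graph_sum_0)

text \<open>Order one of multiplicativity; the first-order term of the star product drops out
  because the bivector vanishes at 0.\<close>

lemma r_1_derivation:
  assumes "smooth_fun 8 f" "smooth_fun 8 g"
  shows "r 1 (\<lambda>x. f x * g x) = f (\<lambda>_. 0) * r 1 g + r 1 f * g (\<lambda>_. 0)"
  using r_mult[OF assms, of 1] r_0[OF smooth_S[OF assms, of 1]] S_1_0[of f g] r_0[OF assms(1)] r_0[OF assms(2)]
  by (simp add: S_0)

lemma S_1: "\<exists>w > 0. \<forall>a b x. a < 8 \<longrightarrow> b < 8 \<longrightarrow> x \<in> E 8 \<longrightarrow> S 1 (X a) (X b) x = complex_of_real w * complex_of_real (pi0 a b x)"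
proof -
  from graph_sum_1 obtain w where w: "w > 0" "\<And>n \<alpha> a b x. a < n \<Longrightarrow> b < n \<Longrightarrow> x \<in> E n \<Longrightarrow> \<alpha> b a x = - \<alpha> a b x \<Longrightarrow>
     graph_sum n 1 \<alpha> (\<lambda>x. fps_const (X a x)) (\<lambda>x. fps_const (X b x)) x = fps_const (of_real w) * \<alpha> a b x"
    by blast
  have "S 1 (X a) (X b) x = of_real (w / 2) * of_real (pi0 a b x)" if "a < 8" "b < 8" "x \<in> E 8" for a b x
    using w(2)[of a 8 b x \<alpha>, OF that \<alpha>_antisym[OF that]] \<alpha>_nth_0[OF that] by (simp add: S_eq graph_sum_0)
  thus ?thesis using w(1) by (intro exI[of _ "w / 2"]) simp
qed

text \<open>At 0 the one-vertex graphs vanish to all orders. The second order is G times the leading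
  contraction, a quarter of the Killing form. The third order is G times the next coefficient of the
  contraction, symmetric for any extension, plus the leading three-vertex term, which is 0.\<close>

lemma S_2_3: "\<exists>G < 0.
   (\<forall>a b. a < 8 \<longrightarrow> b < 8 \<longrightarrow> S 2 (X a) (X b) (\<lambda>_. 0) = complex_of_real (G * (\<Sum>c<8. \<Sum>d<8. lin a d c * lin b c d))) \<and>
   S 3 (X 3) (X 4) (\<lambda>_. 0) = S 3 (X 4) (X 3) (\<lambda>_. 0)"
proof -
  obtain G where G: "G < 0" "\<And>\<alpha> a b. vanishing_bivector 8 \<alpha> a b \<Longrightarrow>
     graph_sum 8 2 \<alpha> (\<lambda>x. fps_const (X a x)) (\<lambda>x. fps_const (X b x)) (\<lambda>_. 0) = fps_const (of_real G) * contraction 8 \<alpha> a b"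
    using graph_sum_2[of 8] by blast
  have g1: "graph_sum 8 1 \<alpha> (\<lambda>x. fps_const (X a x)) (\<lambda>x. fps_const (X b x)) (\<lambda>_. 0) = 0" for a b
    by (rule graph_sum_1_eq_0) (rule \<alpha>_0)
  have S2: "S 2 (X a) (X b) (\<lambda>_. 0) = complex_of_real (G / 4 * (\<Sum>c<8. \<Sum>d<8. lin a d c * lin b c d))" if ab: "a < 8" "b < 8" for a b
  proof -
    have l1: "fps_nth (formal_pderivs [k] (\<alpha> i j) (\<lambda>_. 0)) 0 = complex_of_real (lin i j k / 2)" if "i < 8" "j < 8" "k < 8" for i j k
      using lead[of i j "[k]"] that pderivs_pi0[of i j "[k]"] by simp
    have "fps_nth (contraction 8 \<alpha> a b) 0 = (\<Sum>c<8. \<Sum>d<8. complex_of_real (lin a d c * lin b c d / 4))"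
      unfolding contraction_def fps_sum_nth
    proof (intro sum.cong refl)
      fix c d :: nat assume "c \<in> {..<8}" "d \<in> {..<8}"
      hence cd: "c < 8" "d < 8" by auto
      show "fps_nth (formal_pderivs [c] (\<alpha> a d) (\<lambda>_. 0) * formal_pderivs [d] (\<alpha> b c) (\<lambda>_. 0)) 0 = complex_of_real (lin a d c * lin b c d / 4)"
        unfolding fps_mult_nth_0 l1[OF ab(1) cd(2,1)] l1[OF ab(2) cd] by simp
    qed
    also have "\<dots> = complex_of_real ((\<Sum>c<8. \<Sum>d<8. lin a d c * lin b c d) / 4)"
      by (simp add: sum_divide_distrib)
    finally have "fps_nth (contraction 8 \<alpha> a b) 0 = complex_of_real ((\<Sum>c<8. \<Sum>d<8. lin a d c * lin b c d) / 4)" .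
    moreover have "{..2} = {0, 1, 2::nat}" by auto
    ultimately show ?thesis
      unfolding S_eq using g1[of a b] G(2)[OF vanishing[OF ab]] by (simp add: graph_sum_0)
  qed
  have S3: "S 3 (X a) (X b) (\<lambda>_. 0) = of_real G * fps_nth (contraction 8 \<alpha> a b) 1" if ab: "{a, b} = {3, 4}" for a b
  proof -
    have "a < 8" "b < 8" using ab by (auto simp: doubleton_eq_iff)
    note G2 = G(2)[OF vanishing[OF this]]
    have "{..3} = {0, 1, 2, 3::nat}" by auto
    thus ?thesis
      unfolding S_eq using g1[of a b] G2 graph_sum_3[OF ab, of \<alpha>] lead by (simp add: graph_sum_0)
  qed
  have "S 3 (X 3) (X 4) (\<lambda>_. 0) = S 3 (X 4) (X 3) (\<lambda>_. 0)"
    unfolding S3[of 3 4, OF refl] S3[of 4 3, OF insert_commute] contraction_commute[of 8 \<alpha> 3 4] ..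
  thus ?thesis using S2 G(1) by (intro exI[of _ "G / 4"]) simp
qed

lemma smooth_cpi0: "a < 8 \<Longrightarrow> b < 8 \<Longrightarrow> smooth_fun 8 (\<lambda>x. complex_of_real (pi0 a b x))"
  by (rule smooth_linear[OF bounded_linear_of_real smooth_pi0])

lemma r_S_1:
  assumes "a < 8" "b < 8" and w: "\<And>a b x. a < 8 \<Longrightarrow> b < 8 \<Longrightarrow> x \<in> E 8 \<Longrightarrow> S 1 (X a) (X b) x = complex_of_real w * complex_of_real (pi0 a b x)"
  shows "r k (S 1 (X a) (X b)) = of_real w * r k (\<lambda>x. complex_of_real (pi0 a b x))"
    and "r k (S 1 (X b) (X a)) = - of_real w * r k (\<lambda>x. complex_of_real (pi0 a b x))"
proof -
  let ?p = "\<lambda>x. complex_of_real (pi0 a b x)"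
  note p = smooth_cpi0[OF assms(1,2)]
  have X: "smooth_fun 8 (X a)" "smooth_fun 8 (X b)" using assms by auto
  have sm: "smooth_fun 8 (\<lambda>x. c * ?p x + 0 * ?p x)" for c by (intro smooth_add smooth_cmult p)
  have "r k (S 1 (X a) (X b)) = r k (\<lambda>x. of_real w * ?p x + 0 * ?p x)"
    by (rule r_cong[OF smooth_S[OF X] sm]) (use w assms in auto)
  thus "r k (S 1 (X a) (X b)) = of_real w * r k ?p" using r_linear[OF p p, of k "of_real w" 0] by simp
  have "r k (S 1 (X b) (X a)) = r k (\<lambda>x. (- of_real w) * ?p x + 0 * ?p x)"
    by (rule r_cong[OF smooth_S[OF X(2,1)] sm]) (use w[of b a] pi0_antisym[OF assms(1,2)] assms(1,2) in auto)
  thus "r k (S 1 (X b) (X a)) = - of_real w * r k ?p" using r_linear[OF p p, of k "- of_real w" 0] by simp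
qed

lemma X_0: "a < 8 \<Longrightarrow> r 0 (X a) = 0"
  by (subst r_0) auto

lemma order_2:
  assumes "a < 8" "b < 8"
  shows "r 2 (\<lambda>x. X a x * X b x) + r 1 (S 1 (X a) (X b)) + S 2 (X a) (X b) (\<lambda>_. 0) = r 1 (X a) * r 1 (X b)"
proof -
  have X: "smooth_fun 8 (X a)" "smooth_fun 8 (X b)" using assms by auto
  have 2: "{..2} = {0, 1, 2::nat}" by auto
  show ?thesis using r_mult[OF X, of 2] r_0[OF smooth_S[OF X, of 2]] X_0 assms by (simp add: 2 S_0 add_ac)
qed

lemma order_3:
  assumes "a < 8" "b < 8" and r1: "\<And>f. smooth_fun 8 f \<Longrightarrow> r 1 f = 0"
  shows "r 3 (\<lambda>x. X a x * X b x) + r 2 (S 1 (X a) (X b)) + S 3 (X a) (X b) (\<lambda>_. 0) = 0"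
proof -
  have X: "smooth_fun 8 (X a)" "smooth_fun 8 (X b)" using assms by auto
  have 3: "{..3} = {0, 1, 2, 3::nat}" by auto
  show ?thesis using r_mult[OF X, of 3] r_0[OF smooth_S[OF X, of 3]] X_0 assms r1[OF smooth_S[OF X, of 2]] r1[OF X(1)] r1[OF X(2)]
    by (simp add: 3 S_0 add_ac)
qed

text \<open>Since second-order terms are symmetric, order two makes \<open>r 1\<close> vanish on
  brackets of coordinates, hence on coordinates, and \<open>derivation_at_0_eq_0\<close> extends
  this to all smooth functions.\<close>

lemma r_1_eq_0:
  assumes "smooth_fun 8 f"
  shows "r 1 f = 0"
proof -
  from S_1 obtain w where w: "w > 0" "\<And>a b x. a < 8 \<Longrightarrow> b < 8 \<Longrightarrow> x \<in> E 8 \<Longrightarrow> S 1 (X a) (X b) x = complex_of_real w * complex_of_real (pi0 a b x)"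
    by blast
  from S_2_3 obtain G where S2: "\<And>a b. a < 8 \<Longrightarrow> b < 8 \<Longrightarrow> S 2 (X a) (X b) (\<lambda>_. 0) = complex_of_real (G * (\<Sum>c<8. \<Sum>d<8. lin a d c * lin b c d))"
    by blast
  have S2': "S 2 (X a) (X b) (\<lambda>_. 0) = S 2 (X b) (X a) (\<lambda>_. 0)" if "a < 8" "b < 8" for a b
    unfolding S2[OF that] S2[OF that(2,1)] by (subst sum.swap) (simp add: mult.commute)
  \<comment> \<open>Order two is subtracted for the two orders of the coordinates; the bracket term
    changes sign while everything else is symmetric.\<close>
  have br: "r 1 (\<lambda>x. complex_of_real (pi0 a b x)) = 0" if ab: "a < 8" "b < 8" for a b
  proof -
    have comm: "r 2 (\<lambda>x. X a x * X b x) = r 2 (\<lambda>x. X b x * X a x)" by (simp add: mult.commute)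
    have "r 2 (\<lambda>x. X a x * X b x) + r 1 (S 1 (X a) (X b)) + S 2 (X a) (X b) (\<lambda>_. 0) = r 1 (X a) * r 1 (X b)"
      by (rule order_2[OF ab])
    also have "\<dots> = r 1 (X b) * r 1 (X a)" by (rule mult.commute)
    also have "\<dots> = r 2 (\<lambda>x. X a x * X b x) + r 1 (S 1 (X b) (X a)) + S 2 (X a) (X b) (\<lambda>_. 0)"
      unfolding comm S2'[OF ab] by (rule order_2[OF ab(2,1), symmetric])
    finally have "r 2 (\<lambda>x. X a x * X b x) + r 1 (S 1 (X a) (X b)) + S 2 (X a) (X b) (\<lambda>_. 0) =
        r 2 (\<lambda>x. X a x * X b x) + r 1 (S 1 (X b) (X a)) + S 2 (X a) (X b) (\<lambda>_. 0)" .
    hence "r 1 (S 1 (X a) (X b)) = r 1 (S 1 (X b) (X a))" by simp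
    moreover have "r 1 (S 1 (X a) (X b)) = of_real w * r 1 (\<lambda>x. complex_of_real (pi0 a b x))"
      "r 1 (S 1 (X b) (X a)) = - of_real w * r 1 (\<lambda>x. complex_of_real (pi0 a b x))"
      by (rule r_S_1[OF ab], rule w(2), assumption+)+
    ultimately show ?thesis using w(1) by simp
  qed
  have rX: "r 1 (X i) = 0" if i8: "i < 8" for i
  proof -
    obtain a b c where c: "a < 8" "b < 8" "c \<noteq> 0" "\<And>x. pi0 a b x = c * x i" using pi0_single[OF i8] by blast
    have "r 1 (\<lambda>x. complex_of_real (pi0 a b x)) = r 1 (\<lambda>x. of_real c * X i x + 0 * X i x)" by (simp add: c(4))
    also have "\<dots> = of_real c * r 1 (X i)" using r_linear[OF smooth_X[OF i8] smooth_X[OF i8], of 1 "of_real c" 0] by simp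
    finally show ?thesis using br[OF c(1,2)] c(3) by simp
  qed
  obtain c where c: "finite {I. c I \<noteq> 0}" "{I. c I \<noteq> 0} \<subseteq> lists {..<8}"
    "\<And>f. smooth_fun 8 f \<Longrightarrow> r 1 f = (\<Sum>I | c I \<noteq> 0. c I * pderivs I f (\<lambda>_. 0))"
    by (rule r_differential[of 1]) blast+
  show ?thesis by (rule derivation_at_0_eq_0[OF c(1,2,3) r_1_derivation rX assms])
qed

text \<open>The value of \<open>r 2\<close> on the Casimir function is computed twice: order three
  for x3 and x4 gives 0, order two for each square gives a nonzero multiple of the trace of the
  Killing form on so(3).\<close>

lemma contradiction: False
proof -
  from S_1 obtain w where w: "w > 0" "\<And>a b x. a < 8 \<Longrightarrow> b < 8 \<Longrightarrow> x \<in> E 8 \<Longrightarrow> S 1 (X a) (X b) x = complex_of_real w * complex_of_real (pi0 a b x)"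
    by blast
  from S_2_3 obtain G where G: "G < 0"
    "\<And>a b. a < 8 \<Longrightarrow> b < 8 \<Longrightarrow> S 2 (X a) (X b) (\<lambda>_. 0) = complex_of_real (G * (\<Sum>c<8. \<Sum>d<8. lin a d c * lin b c d))"
    "S 3 (X 3) (X 4) (\<lambda>_. 0) = S 3 (X 4) (X 3) (\<lambda>_. 0)"
    by blast
  define T where "T a = (\<Sum>c<8. \<Sum>d<8. lin a d c * lin a c d)" for a
  \<comment> \<open>With \<open>r 1\<close> = 0, order two on the diagonal determines
    \<open>r 2\<close> on squares.\<close>
  have sq: "r 2 (\<lambda>x. X a x * X a x) = - complex_of_real (G * (\<Sum>c<8. \<Sum>d<8. lin a d c * lin a c d))" if "a < 8" for a
  proof -
    have X: "smooth_fun 8 (X a)" using that by auto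
    show ?thesis
      using order_2[OF that that] r_1_eq_0[OF X] r_1_eq_0[OF smooth_S[OF X X]] by (simp add: G(2) that add_eq_0_iff2)
  qed
  have smsq: "smooth_fun 8 (\<lambda>x. X a x * X a x)" if "a < 8" for a using that by (intro smooth_mult) auto
  have "r 3 (\<lambda>x. X 3 x * X 4 x) = r 3 (\<lambda>x. X 4 x * X 3 x)" by (simp add: mult.commute)
  hence "r 3 (\<lambda>x. X 3 x * X 4 x) + r 2 (S 1 (X 3) (X 4)) + S 3 (X 3) (X 4) (\<lambda>_. 0) =
      r 3 (\<lambda>x. X 3 x * X 4 x) + r 2 (S 1 (X 4) (X 3)) + S 3 (X 3) (X 4) (\<lambda>_. 0)"
    using order_3[of 3 4, OF _ _ r_1_eq_0] order_3[of 4 3, OF _ _ r_1_eq_0] G(3) by simp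
  \<comment> \<open>\<open>r 1\<close> = 0 removes all products and the term with the second-order
    star product, and \<open>S 3\<close> is symmetric.\<close>
  hence eq: "r 2 (S 1 (X 3) (X 4)) = r 2 (S 1 (X 4) (X 3))" by simp
  have "r 2 (\<lambda>x. complex_of_real (pi0 3 4 x)) = 0"
  proof -
    have "r 2 (S 1 (X 3) (X 4)) = of_real w * r 2 (\<lambda>x. complex_of_real (pi0 3 4 x))"
      "r 2 (S 1 (X 4) (X 3)) = - of_real w * r 2 (\<lambda>x. complex_of_real (pi0 3 4 x))"
      by (rule r_S_1, simp, simp, rule w(2), assumption+)+
    with eq show ?thesis using w(1) by simp
  qed
  also have "(\<lambda>x. complex_of_real (pi0 3 4 x)) = (\<lambda>x. 1 * (1 * (X 5 x * X 5 x) + 1 * (X 6 x * X 6 x)) + 1 * (X 7 x * X 7 x))"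
    by (simp add: pi0_def quad_def coeff_rows index_rows power2_eq_square)
  also have "r 2 \<dots> = 1 * r 2 (\<lambda>x. 1 * (X 5 x * X 5 x) + 1 * (X 6 x * X 6 x)) + 1 * r 2 (\<lambda>x. X 7 x * X 7 x)"
    by (rule r_linear) (intro smooth_add smooth_cmult smsq; simp)+
  also have "r 2 (\<lambda>x. 1 * (X 5 x * X 5 x) + 1 * (X 6 x * X 6 x)) = 1 * r 2 (\<lambda>x. X 5 x * X 5 x) + 1 * r 2 (\<lambda>x. X 6 x * X 6 x)"
    by (rule r_linear) (intro smsq; simp)+
  finally have "0 = complex_of_real (- (G * T 5) - G * T 6 - G * T 7)"
    using sq[of 5] sq[of 6] sq[of 7] by (simp add: T_def[symmetric])
  hence "- (G * T 5) - G * T 6 - G * T 7 = 0" using of_real_eq_0_iff by metis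
  hence "G * (T 5 + T 6 + T 7) = 0" by (simp add: algebra_simps)
  moreover have "T 5 + T 6 + T 7 = - 6" using killing by (simp add: T_def)
  ultimately show False using G(1) by simp
qed

end

theorem theorem7:
  shows "\<exists>(n::nat) (\<pi> :: nat \<Rightarrow> nat \<Rightarrow> (nat \<Rightarrow> real) \<Rightarrow> real).
    n \<ge> 1 \<and> poisson_structure n \<pi> \<and> (\<forall>i<n. \<forall>j<n. \<pi> i j (\<lambda>_. 0) = 0) \<and>
    (\<nexists>\<rho>. is_quantization n (\<lambda>_. 0) (const_bivector \<pi>) \<rho>) \<and>
    (\<forall>\<pi>\<^sub>\<epsilon>. formal_poisson n \<pi>\<^sub>\<epsilon> \<longrightarrow> extends_poisson n \<pi>\<^sub>\<epsilon> \<pi> \<longrightarrow>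
       (\<forall>i<n. \<forall>j<n. \<pi>\<^sub>\<epsilon> i j (\<lambda>_. 0) = 0) \<longrightarrow>
       (\<nexists>\<rho>. is_quantization n (\<lambda>_. 0) \<pi>\<^sub>\<epsilon> \<rho>))"
proof -
  \<comment> \<open>This gives both claims, as the constant series of \<open>pi0\<close> is itself
    one of its formal extensions.\<close>
  have *: "\<nexists>\<rho>. is_quantization 8 (\<lambda>_. 0) \<pi> \<rho>"
    if "formal_poisson 8 \<pi>" "extends_poisson 8 \<pi> pi0" "\<forall>i<8. \<forall>j<8. \<pi> i j (\<lambda>_. 0) = 0" for \<pi>
  proof
    assume "\<exists>\<rho>. is_quantization 8 (\<lambda>_. 0) \<pi> \<rho>"
    then obtain \<rho> where "is_quantization 8 (\<lambda>_. 0) \<pi> \<rho>" ..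
    hence "quantization \<pi> \<rho>" using that by (simp add: quantization_def formal_poisson_def)
    thus False by (rule quantization.contradiction)
  qed
  have 0: "pi0 i j (\<lambda>_. 0) = 0" for i j by (simp add: pi0_def)
  have "\<nexists>\<rho>. is_quantization 8 (\<lambda>_. 0) (const_bivector pi0) \<rho>"
    using poisson_pi0 by (intro * const_bivector_extends) (simp_all add: poisson_structure_def const_bivector_def 0)
  thus ?thesis
    using * poisson_pi0 0 by (intro exI[of _ "8::nat"] exI[of _ pi0]) simp
qed

end
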